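(* For a pseudosymmetric braided category $\mathcal C$, the functor $\widetilde{\Theta'}:Br(\mathcal{PS},\mathcal C)\to\mathcal C$ defined by $\widetilde{\Theta'}(G)=G(1)$ is an equivalence of categories.
   Context: Pseudosymmetric braided category: a braided monoidal category $(\mathcal C,\otimes,I,a,l,r,c)$ (not necessarily strict) is called pseudosymmetric if for all objects $U,V,W$ $$a_{W,V,U}(c_{V,W}\otimes id_U)a_{V,W,U}^{-1}(id_V\otimes c_{W,U}^{-1})a_{V,U,W}(c_{U,V}\otimes id_W)=(id_W\otimes c_{U,V})a_{W,U,V}(c_{W,U}^{-1}\otimes id_V)a_{U,W,V}^{-1}(id_U\otimes c_{V,W})a_{U,V,W},$$ where $a_{U,V,W}:(U\otimes V)\otimes W\to U\otimes(V\otimes W)$. The category $\mathcal{PS}$: $B_n$ is the braid group on $n$ strands with standard generators $\sigma_1,\dots,\sigma_{n-1}$, $P_n$ the pure braid group, $PS_n:=B_n/[P_n,P_n]$, $\pi_n:B_n\to PS_n$ the projection. Objects of $\mathcal{PS}$ are natural numbers $n\in\mathbb N$ (including $0$); $Hom(m,n)=\emptyset$ if $m\neq n$ and $Hom(n,n)=PS_n$, with composition given by multiplication. It is strict monoidal with $m\otimes n=m+n$, unit $0$, and tensor product of morphisms induced by juxtaposition of braids $B_m\times B_n\to B_{m+n}$ ($\sigma_i\otimes1\mapsto\sigma_i$, $1\otimes\sigma_j\mapsto\sigma_{m+j}$). Its braiding is $c_{0,n}=id_n=c_{n,0}$ and $c_{n,m}=\pi_{n+m}\big((\sigma_m\sigma_{m-1}\cdots\sigma_1)(\sigma_{m+1}\sigma_m\cdots\sigma_2)\cdots(\sigma_{m+n-1}\sigma_{m+n-2}\cdots\sigma_n)\big)$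 for $m,n>0$. Braided functors: a monoidal functor $(F,\varphi_0,\varphi_2)$ between braided monoidal categories (with $\varphi_2(U,V):F(U)\otimes F(V)\to F(U\otimes V)$ natural isomorphisms and $\varphi_0:I\to F(I)$ an isomorphism, satisfying the usual coherence) is braided if $F(c_{U,V})\varphi_2(U,V)=\varphi_2(V,U)c_{F(U),F(V)}$ for all $U,V$. $Br(\mathcal A,\mathcal C)$ is the category whose objects are braided monoidal functors $\mathcal A\to\mathcal C$ and whose morphisms are natural monoidal transformations. On morphisms, $\widetilde{\Theta'}$ takes a natural monoidal transformation to its component at the object $1$. *)

theory Defs
  imports "HOL-Algebra.Sym_Groups" "HOL-Library.FuncSet"
begin

section \<open>Categories, functors, equivalences\<close>

text \<open>Categories are given by explicit sets of objects and arrows; \<open>g \<cdot> f\<close> is "g after f".\<close>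

record ('o, 'a) category =
  Obj :: "'o set"
  Arr :: "'a set"
  Dom :: "'a \<Rightarrow> 'o"
  Cod :: "'a \<Rightarrow> 'o"
  Ident :: "'o \<Rightarrow> 'a"
  Comp :: "'a \<Rightarrow> 'a \<Rightarrow> 'a"  (infixr "\<cdot>\<index>" 75)

definition Hom :: "('o, 'a, 'x) category_scheme \<Rightarrow> 'o \<Rightarrow> 'o \<Rightarrow> 'a set"
  where "Hom C X Y = {f \<in> Arr C. Dom C f = X \<and> Cod C f = Y}"

locale category =
  fixes C :: "('o, 'a, 'x) category_scheme" (structure)
  assumes Dom_Obj: "f \<in> Arr C \<Longrightarrow> Dom C f \<in> Obj C"
    and Cod_Obj: "f \<in> Arr C \<Longrightarrow> Cod C f \<in> Obj C"
    and Ident_Hom: "X \<in> Obj C \<Longrightarrow> Ident C X \<in> Hom C X X"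
    and Comp_Hom: "\<lbrakk>f \<in> Hom C X Y; g \<in> Hom C Y Z\<rbrakk> \<Longrightarrow> g \<cdot> f \<in> Hom C X Z"
    and Comp_Ident_right: "f \<in> Hom C X Y \<Longrightarrow> f \<cdot> Ident C X = f"
    and Comp_Ident_left: "f \<in> Hom C X Y \<Longrightarrow> Ident C Y \<cdot> f = f"
    and Comp_assoc: "\<lbrakk>f \<in> Hom C W X; g \<in> Hom C X Y; h \<in> Hom C Y Z\<rbrakk>
      \<Longrightarrow> (h \<cdot> g) \<cdot> f = h \<cdot> (g \<cdot> f)"

definition inverse_arrows :: "('o, 'a, 'x) category_scheme \<Rightarrow> 'a \<Rightarrow> 'a \<Rightarrow> bool"
  where "inverse_arrows C f g \<longleftrightarrow>
    f \<in> Arr C \<and> g \<in> Hom C (Cod C f) (Dom C f) \<and>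
    g \<cdot>\<^bsub>C\<^esub> f = Ident C (Dom C f) \<and> f \<cdot>\<^bsub>C\<^esub> g = Ident C (Cod C f)"

definition is_iso :: "('o, 'a, 'x) category_scheme \<Rightarrow> 'a \<Rightarrow> bool"
  where "is_iso C f \<longleftrightarrow> (\<exists>g. inverse_arrows C f g)"

definition Inverse :: "('o, 'a, 'x) category_scheme \<Rightarrow> 'a \<Rightarrow> 'a"
  where "Inverse C f = (THE g. inverse_arrows C f g)"

record ('o, 'a, 'p, 'b) "functor" =
  on_Obj :: "'o \<Rightarrow> 'p"
  on_Arr :: "'a \<Rightarrow> 'b"

locale "functor" = A: category A + C: category C
  for A :: "('o, 'a, 'x) category_scheme" and C :: "('p, 'b, 'y) category_scheme" +
  fixes F :: "('o, 'a, 'p, 'b, 'z) functor_scheme"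
  assumes on_Obj_Obj: "X \<in> Obj A \<Longrightarrow> on_Obj F X \<in> Obj C"
    and on_Arr_Hom: "f \<in> Hom A X Y \<Longrightarrow> on_Arr F f \<in> Hom C (on_Obj F X) (on_Obj F Y)"
    and on_Arr_Ident: "X \<in> Obj A \<Longrightarrow> on_Arr F (Ident A X) = Ident C (on_Obj F X)"
    and on_Arr_Comp: "\<lbrakk>f \<in> Hom A X Y; g \<in> Hom A Y Z\<rbrakk>
      \<Longrightarrow> on_Arr F (g \<cdot>\<^bsub>A\<^esub> f) = on_Arr F g \<cdot>\<^bsub>C\<^esub> on_Arr F f"

definition id_functor :: "('o, 'a, 'o, 'a) functor"
  where "id_functor = \<lparr>on_Obj = (\<lambda>X. X), on_Arr = (\<lambda>f. f)\<rparr>"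

definition comp_functor ::
    "('p, 'b, 'q, 'c, 'z) functor_scheme \<Rightarrow> ('o, 'a, 'p, 'b, 'w) functor_scheme
      \<Rightarrow> ('o, 'a, 'q, 'c) functor"
  where "comp_functor G F =
    \<lparr>on_Obj = (\<lambda>X. on_Obj G (on_Obj F X)), on_Arr = (\<lambda>f. on_Arr G (on_Arr F f))\<rparr>"

locale natural_transformation =
  F: "functor" A C F + G: "functor" A C G
  for A :: "('o, 'a, 'x) category_scheme" and C :: "('p, 'b, 'y) category_scheme"
    and F :: "('o, 'a, 'p, 'b, 'z) functor_scheme"
    and G :: "('o, 'a, 'p, 'b, 'w) functor_scheme" +
  fixes \<eta> :: "'o \<Rightarrow> 'b"
  assumes component_Hom: "X \<in> Obj A \<Longrightarrow> \<eta> X \<in> Hom C (on_Obj F X) (on_Obj G X)"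
    and naturality: "f \<in> Hom A X Y \<Longrightarrow> \<eta> Y \<cdot>\<^bsub>C\<^esub> on_Arr F f = on_Arr G f \<cdot>\<^bsub>C\<^esub> \<eta> X"

locale natural_isomorphism = natural_transformation +
  assumes component_iso: "X \<in> Obj A \<Longrightarrow> is_iso C (\<eta> X)"

definition equivalence_of_categories ::
    "('o, 'a, 'x) category_scheme \<Rightarrow> ('p, 'b, 'y) category_scheme
      \<Rightarrow> ('o, 'a, 'p, 'b, 'z) functor_scheme \<Rightarrow> bool"
  where "equivalence_of_categories A C F \<longleftrightarrow> functor A C F \<and>
    (\<exists>(G :: ('p, 'b, 'o, 'a) functor) \<eta> \<epsilon>. functor C A G \<and>
      natural_isomorphism A A id_functor (comp_functor G F) \<eta> \<and>
      natural_isomorphism C C (comp_functor F G) id_functor \<epsilon>)"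


section \<open>Braided monoidal categories\<close>

record ('o, 'a) monoidal_category = "('o, 'a) category" +
  Tens :: "'o \<Rightarrow> 'o \<Rightarrow> 'o"  (infixr "\<boxdot>\<index>" 80)
  tens :: "'a \<Rightarrow> 'a \<Rightarrow> 'a"  (infixr "\<boxtimes>\<index>" 80)
  Unit :: 'o
  assoc :: "'o \<Rightarrow> 'o \<Rightarrow> 'o \<Rightarrow> 'a"
  lunit :: "'o \<Rightarrow> 'a"
  runit :: "'o \<Rightarrow> 'a"

locale monoidal_category = category C
  for C :: "('o, 'a, 'x) monoidal_category_scheme" (structure) +
  assumes Unit_Obj: "Unit C \<in> Obj C"
    and Tens_Obj: "\<lbrakk>X \<in> Obj C; Y \<in> Obj C\<rbrakk> \<Longrightarrow> X \<boxdot> Y \<in> Obj C"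
    and tens_Hom: "\<lbrakk>f \<in> Hom C X Y; g \<in> Hom C X' Y'\<rbrakk> \<Longrightarrow> f \<boxtimes> g \<in> Hom C (X \<boxdot> X') (Y \<boxdot> Y')"
    and tens_Ident: "\<lbrakk>X \<in> Obj C; Y \<in> Obj C\<rbrakk> \<Longrightarrow> Ident C X \<boxtimes> Ident C Y = Ident C (X \<boxdot> Y)"
    and tens_Comp: "\<lbrakk>f \<in> Hom C X Y; g \<in> Hom C Y Z; f' \<in> Hom C X' Y'; g' \<in> Hom C Y' Z'\<rbrakk>
      \<Longrightarrow> (g \<cdot> f) \<boxtimes> (g' \<cdot> f') = (g \<boxtimes> g') \<cdot> (f \<boxtimes> f')"
    and assoc_Hom: "\<lbrakk>X \<in> Obj C; Y \<in> Obj C; Z \<in> Obj C\<rbrakk>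
      \<Longrightarrow> assoc C X Y Z \<in> Hom C ((X \<boxdot> Y) \<boxdot> Z) (X \<boxdot> (Y \<boxdot> Z))"
    and assoc_iso: "\<lbrakk>X \<in> Obj C; Y \<in> Obj C; Z \<in> Obj C\<rbrakk> \<Longrightarrow> is_iso C (assoc C X Y Z)"
    and assoc_natural: "\<lbrakk>f \<in> Hom C X X'; g \<in> Hom C Y Y'; h \<in> Hom C Z Z'\<rbrakk>
      \<Longrightarrow> assoc C X' Y' Z' \<cdot> ((f \<boxtimes> g) \<boxtimes> h) = (f \<boxtimes> (g \<boxtimes> h)) \<cdot> assoc C X Y Z"
    and lunit_Hom: "X \<in> Obj C \<Longrightarrow> lunit C X \<in> Hom C (Unit C \<boxdot> X) X"
    and lunit_iso: "X \<in> Obj C \<Longrightarrow> is_iso C (lunit C X)"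
    and lunit_natural: "f \<in> Hom C X Y \<Longrightarrow> lunit C Y \<cdot> (Ident C (Unit C) \<boxtimes> f) = f \<cdot> lunit C X"
    and runit_Hom: "X \<in> Obj C \<Longrightarrow> runit C X \<in> Hom C (X \<boxdot> Unit C) X"
    and runit_iso: "X \<in> Obj C \<Longrightarrow> is_iso C (runit C X)"
    and runit_natural: "f \<in> Hom C X Y \<Longrightarrow> runit C Y \<cdot> (f \<boxtimes> Ident C (Unit C)) = f \<cdot> runit C X"
    and pentagon: "\<lbrakk>W \<in> Obj C; X \<in> Obj C; Y \<in> Obj C; Z \<in> Obj C\<rbrakk>
      \<Longrightarrow> assoc C W X (Y \<boxdot> Z) \<cdot> assoc C (W \<boxdot> X) Y Z =
          (Ident C W \<boxtimes> assoc C X Y Z) \<cdot> assoc C W (X \<boxdot> Y) Z \<cdot> (assoc C W X Y \<boxtimes> Ident C Z)"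
    and triangle: "\<lbrakk>X \<in> Obj C; Y \<in> Obj C\<rbrakk>
      \<Longrightarrow> (Ident C X \<boxtimes> lunit C Y) \<cdot> assoc C X (Unit C) Y = runit C X \<boxtimes> Ident C Y"

record ('o, 'a) braided_category = "('o, 'a) monoidal_category" +
  braid :: "'o \<Rightarrow> 'o \<Rightarrow> 'a"

locale braided_category = monoidal_category C
  for C :: "('o, 'a, 'x) braided_category_scheme" (structure) +
  assumes braid_Hom: "\<lbrakk>X \<in> Obj C; Y \<in> Obj C\<rbrakk> \<Longrightarrow> braid C X Y \<in> Hom C (X \<boxdot> Y) (Y \<boxdot> X)"
    and braid_iso: "\<lbrakk>X \<in> Obj C; Y \<in> Obj C\<rbrakk> \<Longrightarrow> is_iso C (braid C X Y)"
    and braid_natural: "\<lbrakk>f \<in> Hom C X X'; g \<in> Hom C Y Y'\<rbrakk>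
      \<Longrightarrow> braid C X' Y' \<cdot> (f \<boxtimes> g) = (g \<boxtimes> f) \<cdot> braid C X Y"
    and hexagon1: "\<lbrakk>U \<in> Obj C; V \<in> Obj C; W \<in> Obj C\<rbrakk>
      \<Longrightarrow> assoc C V W U \<cdot> braid C U (V \<boxdot> W) \<cdot> assoc C U V W =
          (Ident C V \<boxtimes> braid C U W) \<cdot> assoc C V U W \<cdot> (braid C U V \<boxtimes> Ident C W)"
    and hexagon2: "\<lbrakk>U \<in> Obj C; V \<in> Obj C; W \<in> Obj C\<rbrakk>
      \<Longrightarrow> Inverse C (assoc C W U V) \<cdot> braid C (U \<boxdot> V) W \<cdot> Inverse C (assoc C U V W) =
          (braid C U W \<boxtimes> Ident C V) \<cdot> Inverse C (assoc C U W V) \<cdot> (Ident C U \<boxtimes> braid C V W)"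

locale pseudosymmetric_braided_category = braided_category +
  assumes pseudosymmetry: "\<lbrakk>U \<in> Obj C; V \<in> Obj C; W \<in> Obj C\<rbrakk>
    \<Longrightarrow> assoc C W V U \<cdot> (braid C V W \<boxtimes> Ident C U) \<cdot> Inverse C (assoc C V W U)
          \<cdot> (Ident C V \<boxtimes> Inverse C (braid C W U)) \<cdot> assoc C V U W \<cdot> (braid C U V \<boxtimes> Ident C W) =
        (Ident C W \<boxtimes> braid C U V) \<cdot> assoc C W U V \<cdot> (Inverse C (braid C W U) \<boxtimes> Ident C V)
          \<cdot> Inverse C (assoc C U W V) \<cdot> (Ident C U \<boxtimes> braid C V W) \<cdot> assoc C U V W"


section \<open>The category of braided functors\<close>

record ('o, 'a, 'p, 'b) monoidal_functor = "('o, 'a, 'p, 'b) functor" +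
  phi0 :: 'b
  phi2 :: "'o \<Rightarrow> 'o \<Rightarrow> 'b"

locale monoidal_functor =
  A: monoidal_category A + C: monoidal_category C + "functor" A C F
  for A :: "('o, 'a, 'x) monoidal_category_scheme"
    and C :: "('p, 'b, 'y) monoidal_category_scheme"
    and F :: "('o, 'a, 'p, 'b, 'z) monoidal_functor_scheme" +
  assumes phi0_Hom: "phi0 F \<in> Hom C (Unit C) (on_Obj F (Unit A))"
    and phi0_iso: "is_iso C (phi0 F)"
    and phi2_Hom: "\<lbrakk>U \<in> Obj A; V \<in> Obj A\<rbrakk>
      \<Longrightarrow> phi2 F U V \<in> Hom C (on_Obj F U \<boxdot>\<^bsub>C\<^esub> on_Obj F V) (on_Obj F (U \<boxdot>\<^bsub>A\<^esub> V))"
    and phi2_iso: "\<lbrakk>U \<in> Obj A; V \<in> Obj A\<rbrakk> \<Longrightarrow> is_iso C (phi2 F U V)"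
    and phi2_natural: "\<lbrakk>f \<in> Hom A U U'; g \<in> Hom A V V'\<rbrakk>
      \<Longrightarrow> phi2 F U' V' \<cdot>\<^bsub>C\<^esub> (on_Arr F f \<boxtimes>\<^bsub>C\<^esub> on_Arr F g)
          = on_Arr F (f \<boxtimes>\<^bsub>A\<^esub> g) \<cdot>\<^bsub>C\<^esub> phi2 F U V"
    and phi2_assoc: "\<lbrakk>U \<in> Obj A; V \<in> Obj A; W \<in> Obj A\<rbrakk>
      \<Longrightarrow> phi2 F U (V \<boxdot>\<^bsub>A\<^esub> W) \<cdot>\<^bsub>C\<^esub> (Ident C (on_Obj F U) \<boxtimes>\<^bsub>C\<^esub> phi2 F V W)
            \<cdot>\<^bsub>C\<^esub> assoc C (on_Obj F U) (on_Obj F V) (on_Obj F W)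
          = on_Arr F (assoc A U V W) \<cdot>\<^bsub>C\<^esub> phi2 F (U \<boxdot>\<^bsub>A\<^esub> V) W
            \<cdot>\<^bsub>C\<^esub> (phi2 F U V \<boxtimes>\<^bsub>C\<^esub> Ident C (on_Obj F W))"
    and phi2_lunit: "U \<in> Obj A
      \<Longrightarrow> lunit C (on_Obj F U) = on_Arr F (lunit A U) \<cdot>\<^bsub>C\<^esub> phi2 F (Unit A) U
            \<cdot>\<^bsub>C\<^esub> (phi0 F \<boxtimes>\<^bsub>C\<^esub> Ident C (on_Obj F U))"
    and phi2_runit: "U \<in> Obj A
      \<Longrightarrow> runit C (on_Obj F U) = on_Arr F (runit A U) \<cdot>\<^bsub>C\<^esub> phi2 F U (Unit A)
            \<cdot>\<^bsub>C\<^esub> (Ident C (on_Obj F U) \<boxtimes>\<^bsub>C\<^esub> phi0 F)"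

locale braided_functor =
  A: braided_category A + C: braided_category C + monoidal_functor A C F
  for A :: "('o, 'a, 'x) braided_category_scheme"
    and C :: "('p, 'b, 'y) braided_category_scheme"
    and F :: "('o, 'a, 'p, 'b, 'z) monoidal_functor_scheme" +
  assumes on_Arr_braid: "\<lbrakk>U \<in> Obj A; V \<in> Obj A\<rbrakk>
    \<Longrightarrow> on_Arr F (braid A U V) \<cdot>\<^bsub>C\<^esub> phi2 F U V
        = phi2 F V U \<cdot>\<^bsub>C\<^esub> braid C (on_Obj F U) (on_Obj F V)"

locale monoidal_transformation =
  F: monoidal_functor A C F + G: monoidal_functor A C G + natural_transformation A C F G \<eta>
  for A :: "('o, 'a, 'x) monoidal_category_scheme"
    and C :: "('p, 'b, 'y) monoidal_category_scheme"
    and F :: "('o, 'a, 'p, 'b, 'z) monoidal_functor_scheme"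
    and G :: "('o, 'a, 'p, 'b, 'w) monoidal_functor_scheme"
    and \<eta> :: "'o \<Rightarrow> 'b" +
  assumes component_Unit: "\<eta> (Unit A) \<cdot>\<^bsub>C\<^esub> phi0 F = phi0 G"
    and component_Tens: "\<lbrakk>U \<in> Obj A; V \<in> Obj A\<rbrakk>
      \<Longrightarrow> \<eta> (U \<boxdot>\<^bsub>A\<^esub> V) \<cdot>\<^bsub>C\<^esub> phi2 F U V = phi2 G U V \<cdot>\<^bsub>C\<^esub> (\<eta> U \<boxtimes>\<^bsub>C\<^esub> \<eta> V)"

text \<open>
  Functors and transformations are total functions in the logic.  To make equality in the functor
  category mean equality on objects and arrows, their values outside the source category are
  fixed to be \<open>undefined\<close>.
\<close>

definition extensional_functor ::
    "('o, 'a, 'x) category_scheme \<Rightarrow> ('o, 'a, 'p, 'b) monoidal_functor \<Rightarrow> bool"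
  where "extensional_functor A F \<longleftrightarrow>
    on_Obj F \<in> extensional (Obj A) \<and> on_Arr F \<in> extensional (Arr A) \<and>
    (\<forall>U V. U \<notin> Obj A \<or> V \<notin> Obj A \<longrightarrow> phi2 F U V = undefined)"

definition Br ::
    "('o, 'a, 'x) braided_category_scheme \<Rightarrow> ('p, 'b, 'y) braided_category_scheme
      \<Rightarrow> (('o, 'a, 'p, 'b) monoidal_functor,
          ('o, 'a, 'p, 'b) monoidal_functor \<times> ('o, 'a, 'p, 'b) monoidal_functor \<times> ('o \<Rightarrow> 'b)) category"
  where "Br A C =
    (let Fs = {F. braided_functor A C F \<and> extensional_functor A F} in
      \<lparr>Obj = Fs,
       Arr = {(F, G, \<eta>). F \<in> Fs \<and> G \<in> Fs \<and> monoidal_transformation A C F G \<eta> \<and> \<eta> \<in> extensional (Obj A)},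
       Dom = (\<lambda>(F, G, \<eta>). F),
       Cod = (\<lambda>(F, G, \<eta>). G),
       Ident = (\<lambda>F. (F, F, \<lambda>X\<in>Obj A. Ident C (on_Obj F X))),
       Comp = (\<lambda>(G', H, \<tau>) (F, G, \<eta>). (F, H, \<lambda>X\<in>Obj A. \<tau> X \<cdot>\<^bsub>C\<^esub> \<eta> X))\<rparr>)"


section \<open>Braid groups\<close>

text \<open>
  The braid group on \<open>n\<close> strands is given by Artin's presentation.  The letter \<open>(i, True)\<close> is
  the generator \<open>\<sigma>\<^sub>i\<close> (for \<open>1 \<le> i < n\<close>) and \<open>(i, False)\<close> is its inverse.

  Operations on classes and cosets are computed on representatives; \<open>the_elem\<close> extracts the
  value, which is the same for all choices of representatives.
\<close>

type_synonym braid_word = "(nat \<times> bool) list"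

definition braid_words :: "nat \<Rightarrow> braid_word set"
  where "braid_words n = lists ({1..<n} \<times> UNIV)"

inductive braid_equiv :: "nat \<Rightarrow> braid_word \<Rightarrow> braid_word \<Rightarrow> bool" for n :: nat
  where
    refl: "w \<in> braid_words n \<Longrightarrow> braid_equiv n w w"
  | sym: "braid_equiv n v w \<Longrightarrow> braid_equiv n w v"
  | trans: "\<lbrakk>braid_equiv n u v; braid_equiv n v w\<rbrakk> \<Longrightarrow> braid_equiv n u w"
  | cancel: "\<lbrakk>u \<in> braid_words n; v \<in> braid_words n; i \<in> {1..<n}\<rbrakk>
      \<Longrightarrow> braid_equiv n (u @ [(i, e), (i, \<not> e)] @ v) (u @ v)"
  | far: "\<lbrakk>u \<in> braid_words n; v \<in> braid_words n; i \<in> {1..<n}; j \<in> {1..<n}; i + 2 \<le> j\<rbrakk>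
      \<Longrightarrow> braid_equiv n (u @ [(i, True), (j, True)] @ v) (u @ [(j, True), (i, True)] @ v)"
  | near: "\<lbrakk>u \<in> braid_words n; v \<in> braid_words n; i \<in> {1..<n}; Suc i \<in> {1..<n}\<rbrakk>
      \<Longrightarrow> braid_equiv n (u @ [(i, True), (Suc i, True), (i, True)] @ v)
                        (u @ [(Suc i, True), (i, True), (Suc i, True)] @ v)"

definition braid_class :: "nat \<Rightarrow> braid_word \<Rightarrow> braid_word set"
  where "braid_class n w = {w'. braid_equiv n w w'}"

definition braid_group :: "nat \<Rightarrow> braid_word set monoid"
  where "braid_group n =
    \<lparr>carrier = braid_class n ` braid_words n,
     mult = (\<lambda>X Y. the_elem {braid_class n (u @ v) | u v. u \<in> X \<and> v \<in> Y}),
     one = braid_class n []\<rparr>"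

definition word_perm :: "braid_word \<Rightarrow> nat \<Rightarrow> nat"
  where "word_perm w = foldr (\<lambda>(i, e) p. transpose i (Suc i) \<circ> p) w id"

definition braid_perm :: "braid_word set \<Rightarrow> nat \<Rightarrow> nat"
  where "braid_perm b = the_elem (word_perm ` b)"

definition pure_braids :: "nat \<Rightarrow> braid_word set set"
  where "pure_braids n = kernel (braid_group n) (sym_group n) braid_perm"

definition PS_group :: "nat \<Rightarrow> braid_word set set monoid"
  where "PS_group n = braid_group n Mod derived (braid_group n) (pure_braids n)"

definition PS_proj :: "nat \<Rightarrow> braid_word set \<Rightarrow> braid_word set set"
  where "PS_proj n b = derived (braid_group n) (pure_braids n) #>\<^bsub>braid_group n\<^esub> b"

definition juxtapose :: "nat \<Rightarrow> braid_word \<Rightarrow> braid_word \<Rightarrow> braid_word"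
  where "juxtapose m u v = u @ map (\<lambda>(i, e). (m + i, e)) v"

definition braid_tensor :: "nat \<Rightarrow> nat \<Rightarrow> braid_word set \<Rightarrow> braid_word set \<Rightarrow> braid_word set"
  where "braid_tensor m n b b' =
    the_elem {braid_class (m + n) (juxtapose m u v) | u v. u \<in> b \<and> v \<in> b'}"

definition PS_tensor ::
    "nat \<Rightarrow> nat \<Rightarrow> braid_word set set \<Rightarrow> braid_word set set \<Rightarrow> braid_word set set"
  where "PS_tensor m n X Y =
    the_elem {PS_proj (m + n) (braid_tensor m n b b') | b b'. b \<in> X \<and> b' \<in> Y}"


section \<open>The category PS\<close>

text \<open>
  The \<open>k\<close>-th block of the braiding word is \<open>\<sigma>\<^sub>m\<^sub>+\<^sub>k\<^sub>-\<^sub>1 \<dots> \<sigma>\<^sub>k\<close>, for \<open>k = 1, \<dots>, n\<close> from left to right;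
  the word is empty if \<open>n = 0\<close> or \<open>m = 0\<close>.
\<close>

definition braiding_word :: "nat \<Rightarrow> nat \<Rightarrow> braid_word"
  where "braiding_word n m =
    concat (map (\<lambda>k. map (\<lambda>i. (i, True)) (rev [k..<m + k])) [1..<n + 1])"

text \<open>An arrow \<open>(n, x)\<close> is \<open>x\<close> regarded as an endomorphism of the object \<open>n\<close>.\<close>

definition PS :: "(nat, nat \<times> braid_word set set) braided_category"
  where "PS =
    \<lparr>Obj = UNIV,
     Arr = {(n, x). x \<in> carrier (PS_group n)},
     Dom = fst,
     Cod = fst,
     Ident = (\<lambda>n. (n, \<one>\<^bsub>PS_group n\<^esub>)),
     Comp = (\<lambda>(n, x) (m, y). (n, x \<otimes>\<^bsub>PS_group n\<^esub> y)),
     Tens = (+),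
     tens = (\<lambda>(m, x) (n, y). (m + n, PS_tensor m n x y)),
     Unit = 0,
     assoc = (\<lambda>k m n. (k + m + n, \<one>\<^bsub>PS_group (k + m + n)\<^esub>)),
     lunit = (\<lambda>n. (n, \<one>\<^bsub>PS_group n\<^esub>)),
     runit = (\<lambda>n. (n, \<one>\<^bsub>PS_group n\<^esub>)),
     braid = (\<lambda>n m. (n + m, PS_proj (n + m) (braid_class (n + m) (braiding_word n m))))\<rparr>"

definition Theta ::
    "((nat, 'a, 'p, 'b) monoidal_functor,
      (nat, 'a, 'p, 'b) monoidal_functor \<times> (nat, 'a, 'p, 'b) monoidal_functor \<times> (nat \<Rightarrow> 'b),
      'p, 'b) functor"
  where "Theta = \<lparr>on_Obj = (\<lambda>G. on_Obj G 1), on_Arr = (\<lambda>(F, G, \<eta>). \<eta> 1)\<rparr>"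

end

theory Submission
  imports Defs
begin

text \<open>
  Let \<open>\<C>\<close> be pseudosymmetric. The functor \<open>G \<mapsto> G(1)\<close> is shown to be full, faithful and essentially
  surjective.

  Fullness and faithfulness hold because everything in \<open>PS\<close> is generated by the object \<open>1\<close>. Since
  \<open>n + 1 = n \<otimes> 1\<close>, a monoidal transformation is determined by its component at \<open>1\<close>, and every arrow
  \<open>F(1) \<rightarrow> G(1)\<close> extends to a family of arrows \<open>F(n) \<rightarrow> G(n)\<close> that is compatible with the tensor
  products (\<open>extend\<close>). It is natural, because a generator \<open>\<sigma>\<^sub>i\<close> of \<open>PS\<^sub>n\<close> is the braiding
  \<open>c\<^sub>1\<^sub>,\<^sub>1\<close> tensored with identities on both sides, and braided functors preserve both operations
  (\<open>braided_functor_on_Arr\<close>, \<open>\<eta>_act\<close>).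

  For essential surjectivity let \<open>X\<close> be an object of \<open>\<C>\<close>. Its tensor powers form a strong monoidal
  functor from the discrete category of natural numbers (\<open>monoidal_family_tensor_power\<close>). Along its
  structure maps the tensor product of \<open>\<C>\<close> becomes strictly associative on endomorphisms of the
  powers, and the braiding of \<open>\<C>\<close> gives a representation of \<open>B\<^sub>n\<close> on the \<open>n\<close>-th power
  (\<open>braid_rep_gen\<close>). What remains is to show that it factors through \<open>PS\<^sub>n\<close>, that is, that pure
  braids act by commuting automorphisms. This is a statement about groups. For elements \<open>x, y\<close> that
  satisfy the braid relation, the relation \<open>x y\<^sup>-\<^sup>1 x = y x\<^sup>-\<^sup>1 y\<close> imposed by pseudosymmetry implies that
  \<open>x\<^sup>2\<close> and \<open>y\<^sup>2\<close> commute (\<open>pseudosymmetric_imp_squares_commute\<close>). If the squares of adjacent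
  generators commute, then conjugation by \<open>\<sigma>\<^sub>k\<close> and by \<open>\<sigma>\<^sub>k\<^sup>-\<^sup>1\<close> permute the standard generators
  \<open>A\<^sub>i\<^sub>j\<close> of the pure braid group in the same way, namely by transposing the indices \<open>k\<close> and \<open>k + 1\<close>.
  So the squares \<open>\<sigma>\<^sub>i\<^sup>2\<close>, which are among the \<open>A\<^sub>i\<^sub>j\<close>, commute with all pure braids. Modulo these squares
  only the trivial element is pure, by Coxeter's presentation of the symmetric group
  (\<open>pure_word_trivial_if_involutive\<close>), and so any two pure braids commute (\<open>pure_words_commute\<close>).

  That \<open>PS\<close> is a braided category at all rests on the well-definedness of its tensor product, which
  holds because juxtaposition with a trivial braid preserves pure braids, and on the naturality of
  the braiding and the hexagons, which are computations in the braid groups.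
\<close>


section \<open>Categories and equivalences\<close>

lemma Hom_iff: "f \<in> Hom C X Y \<longleftrightarrow> f \<in> Arr C \<and> Dom C f = X \<and> Cod C f = Y"
  by (auto simp: Hom_def)

lemma is_isoI: "inverse_arrows C f g \<Longrightarrow> is_iso C f"
  by (auto simp: is_iso_def)

context category
begin

lemmas Dom_Cod_Obj [simp] = Dom_Obj Cod_Obj

lemma Ident_simps [simp]:
  assumes "X \<in> Obj C"
  shows "Ident C X \<in> Arr C" "Dom C (Ident C X) = X" "Cod C (Ident C X) = X"
  using Ident_Hom[OF assms] by (auto simp: Hom_iff)

lemma Comp_simps [simp]:
  assumes "f \<in> Arr C" "g \<in> Arr C" "Cod C f = Dom C g"
  shows "g \<cdot> f \<in> Arr C" "Dom C (g \<cdot> f) = Dom C f" "Cod C (g \<cdot> f) = Cod C g"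
  using Comp_Hom[of f "Dom C f" "Dom C g" g "Cod C g"] assms by (auto simp: Hom_iff)

lemma Comp_Ident [simp]:
  assumes "f \<in> Arr C"
  shows "Dom C f = X \<Longrightarrow> f \<cdot> Ident C X = f" "Cod C f = X \<Longrightarrow> Ident C X \<cdot> f = f"
  using assms by (auto intro!: Comp_Ident_left Comp_Ident_right simp: Hom_iff)

lemma Comp_assoc_simp [simp]:
  assumes "f \<in> Arr C" "g \<in> Arr C" "h \<in> Arr C" "Cod C f = Dom C g" "Cod C g = Dom C h"
  shows "(h \<cdot> g) \<cdot> f = h \<cdot> g \<cdot> f"
  by (rule Comp_assoc) (use assms in \<open>auto simp: Hom_iff\<close>)

lemma inverse_arrows_unique:
  assumes "inverse_arrows C f g" "inverse_arrows C f h"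
  shows "g = h"
proof -
  have fg: "f \<in> Arr C" "g \<in> Arr C" "h \<in> Arr C"
    "Dom C g = Cod C f" "Cod C g = Dom C f" "Dom C h = Cod C f" "Cod C h = Dom C f"
    "g \<cdot> f = Ident C (Dom C f)" "f \<cdot> h = Ident C (Cod C f)"
    using assms by (auto simp: inverse_arrows_def Hom_iff)
  have "g = g \<cdot> (f \<cdot> h)" using fg(1-7) unfolding fg(9) by simp
  also have "\<dots> = (g \<cdot> f) \<cdot> h" using fg(1-7) by simp
  also have "\<dots> = h" using fg(1-7) unfolding fg(8) by simp
  finally show ?thesis .
qed

lemma inverse_arrows_Inverse: "is_iso C f \<Longrightarrow> inverse_arrows C f (Inverse C f)"
  unfolding is_iso_def Inverse_def by (rule theI') (auto intro: inverse_arrows_unique)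

lemma Inverse_eqI: "inverse_arrows C f g \<Longrightarrow> Inverse C f = g"
  by (rule inverse_arrows_unique[OF inverse_arrows_Inverse[OF is_isoI]])

lemma iso_Arr [simp]: "is_iso C f \<Longrightarrow> f \<in> Arr C"
  by (auto simp: is_iso_def inverse_arrows_def)

lemma Inverse_simps [simp]:
  assumes "is_iso C f"
  shows "Inverse C f \<in> Arr C" "Dom C (Inverse C f) = Cod C f" "Cod C (Inverse C f) = Dom C f"
    "Inverse C f \<cdot> f = Ident C (Dom C f)" "f \<cdot> Inverse C f = Ident C (Cod C f)"
  using inverse_arrows_Inverse[OF assms] by (auto simp: inverse_arrows_def Hom_iff)

lemma Inverse_cancel [simp]:
  assumes "is_iso C f" "g \<in> Arr C"
  shows "Cod C g = Dom C f \<Longrightarrow> Inverse C f \<cdot> f \<cdot> g = g"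
    "Cod C g = Cod C f \<Longrightarrow> f \<cdot> Inverse C f \<cdot> g = g"
  using assms by (simp_all flip: Comp_assoc_simp)

lemma iso_Inverse [simp]: "is_iso C f \<Longrightarrow> is_iso C (Inverse C f)"
  by (rule is_isoI[of _ _ f]) (simp add: inverse_arrows_def Hom_iff)

lemma inverse_arrows_Ident: "X \<in> Obj C \<Longrightarrow> inverse_arrows C (Ident C X) (Ident C X)"
  by (auto simp: inverse_arrows_def Hom_iff)

lemma iso_Ident [simp]: "X \<in> Obj C \<Longrightarrow> is_iso C (Ident C X)"
  by (rule is_isoI[OF inverse_arrows_Ident])

lemma Inverse_Ident [simp]: "X \<in> Obj C \<Longrightarrow> Inverse C (Ident C X) = Ident C X"
  by (intro Inverse_eqI inverse_arrows_Ident)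

lemma inverse_arrows_Comp:
  assumes "is_iso C f" "is_iso C g" "Cod C f = Dom C g"
  shows "inverse_arrows C (g \<cdot> f) (Inverse C f \<cdot> Inverse C g)"
  using assms by (auto simp: inverse_arrows_def Hom_iff)

lemma iso_Comp [simp]: "is_iso C f \<Longrightarrow> is_iso C g \<Longrightarrow> Cod C f = Dom C g \<Longrightarrow> is_iso C (g \<cdot> f)"
  by (rule is_isoI[OF inverse_arrows_Comp])

lemma iso_cancel_left:
  assumes "f \<cdot> g = f \<cdot> h" "is_iso C f" "g \<in> Arr C" "h \<in> Arr C"
    "Cod C g = Dom C f" "Cod C h = Dom C f"
  shows "g = h"
  using arg_cong[OF assms(1), of "\<lambda>x. Inverse C f \<cdot> x"] assms(2-) by simp

lemma iso_cancel_right: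
  assumes "g \<cdot> f = h \<cdot> f" "is_iso C f" "g \<in> Arr C" "h \<in> Arr C"
    "Dom C g = Cod C f" "Dom C h = Cod C f"
  shows "g = h"
  using arg_cong[OF assms(1), of "\<lambda>x. x \<cdot> Inverse C f"] assms(2-) by simp

end

context "functor"
begin

lemma functor_simps [simp]:
  "X \<in> Obj A \<Longrightarrow> on_Obj F X \<in> Obj C"
  "X \<in> Obj A \<Longrightarrow> on_Arr F (Ident A X) = Ident C (on_Obj F X)"
  by (auto simp: on_Obj_Obj on_Arr_Ident)

lemma on_Arr_simps [simp]:
  assumes "f \<in> Arr A"
  shows "on_Arr F f \<in> Arr C" "Dom C (on_Arr F f) = on_Obj F (Dom A f)"
    "Cod C (on_Arr F f) = on_Obj F (Cod A f)"
  using on_Arr_Hom[of f "Dom A f" "Cod A f"] assms by (auto simp: Hom_iff)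

lemma on_Arr_Comp_simp [simp]:
  "f \<in> Arr A \<Longrightarrow> g \<in> Arr A \<Longrightarrow> Cod A f = Dom A g \<Longrightarrow>
    on_Arr F (g \<cdot>\<^bsub>A\<^esub> f) = on_Arr F g \<cdot>\<^bsub>C\<^esub> on_Arr F f"
  using on_Arr_Comp[of f "Dom A f" "Dom A g" g "Cod A g"] by (auto simp: Hom_iff)

lemma on_Arr_Inverse:
  assumes "is_iso A f"
  shows "inverse_arrows C (on_Arr F f) (on_Arr F (Inverse A f))"
proof -
  have f: "f \<in> Arr A" using assms A.iso_Arr by blast
  show ?thesis
    using assms f on_Arr_Comp_simp[of f "Inverse A f"] on_Arr_Comp_simp[of "Inverse A f" f]
    by (simp add: inverse_arrows_def Hom_iff del: on_Arr_Comp_simp)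
qed

end

text \<open>
  A quasi-inverse is obtained by choosing, for each object \<open>Y\<close>, an object that the functor sends
  to an isomorphic copy of \<open>Y\<close>; fullness and faithfulness then force its values on arrows.
\<close>

lemma fully_faithful_essentially_surjective_equivalence:
  fixes A :: "('o, 'a, 'x) category_scheme" and C :: "('p, 'b, 'y) category_scheme"
    and F :: "('o, 'a, 'p, 'b, 'z) functor_scheme"
  assumes "functor A C F"
    and full: "\<And>X Y g. \<lbrakk>X \<in> Obj A; Y \<in> Obj A; g \<in> Hom C (on_Obj F X) (on_Obj F Y)\<rbrakk>
      \<Longrightarrow> \<exists>f\<in>Hom A X Y. on_Arr F f = g"
    and faithful: "\<And>X Y f f'. \<lbrakk>f \<in> Hom A X Y; f' \<in> Hom A X Y; on_Arr F f = on_Arr F f'\<rbrakk> \<Longrightarrow> f = f'"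
    and surj: "\<And>Y. Y \<in> Obj C \<Longrightarrow> \<exists>X\<in>Obj A. \<exists>e. is_iso C e \<and> e \<in> Hom C (on_Obj F X) Y"
  shows "equivalence_of_categories A C F"
proof -
  interpret "functor" A C F by fact
  have "\<forall>Y. \<exists>X e. Y \<in> Obj C \<longrightarrow>
      X \<in> Obj A \<and> is_iso C e \<and> Dom C e = on_Obj F X \<and> Cod C e = Y"
    using surj unfolding Hom_iff by blast
  then obtain P e where Pe: "\<And>Y. Y \<in> Obj C \<longrightarrow>
      P Y \<in> Obj A \<and> is_iso C (e Y) \<and> Dom C (e Y) = on_Obj F (P Y) \<and> Cod C (e Y) = Y"
    unfolding choice_iff by blast
  then have P: "\<And>Y. Y \<in> Obj C \<Longrightarrow> P Y \<in> Obj A"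
    and e: "\<And>Y. Y \<in> Obj C \<Longrightarrow> is_iso C (e Y)"
      "\<And>Y. Y \<in> Obj C \<Longrightarrow> Dom C (e Y) = on_Obj F (P Y)" "\<And>Y. Y \<in> Obj C \<Longrightarrow> Cod C (e Y) = Y"
    by auto
  have e_Arr [simp]: "Y \<in> Obj C \<Longrightarrow> e Y \<in> Arr C" for Y using e(1) by simp
  note [simp] = e P
  define lift where "lift X Y g = (THE f. f \<in> Hom A X Y \<and> on_Arr F f = g)" for X Y g
  have lift: "lift X Y g \<in> Arr A \<and> Dom A (lift X Y g) = X \<and> Cod A (lift X Y g) = Y
      \<and> on_Arr F (lift X Y g) = g"
    if "X \<in> Obj A" "Y \<in> Obj A" "g \<in> Arr C" "Dom C g = on_Obj F X" "Cod C g = on_Obj F Y" for X Y g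
  proof -
    have "\<exists>!f. f \<in> Hom A X Y \<and> on_Arr F f = g"
      using full[of X Y g] faithful[of _ X Y] that by (auto simp: Hom_iff)
    from theI'[OF this] show ?thesis by (auto simp: lift_def Hom_iff)
  qed
  define G :: "('p, 'b, 'o, 'a) functor" where "G = \<lparr>on_Obj = P,
    on_Arr = (\<lambda>g. lift (P (Dom C g)) (P (Cod C g)) (Inverse C (e (Cod C g)) \<cdot>\<^bsub>C\<^esub> g \<cdot>\<^bsub>C\<^esub> e (Dom C g)))\<rparr>"
  have G_Obj [simp]: "on_Obj G = P" by (simp add: G_def)
  have G_Arr: "on_Arr G g \<in> Arr A \<and> Dom A (on_Arr G g) = P (Dom C g)
      \<and> Cod A (on_Arr G g) = P (Cod C g)
      \<and> on_Arr F (on_Arr G g) = Inverse C (e (Cod C g)) \<cdot>\<^bsub>C\<^esub> g \<cdot>\<^bsub>C\<^esub> e (Dom C g)"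
    if "g \<in> Arr C" for g
    unfolding G_def functor.simps by (rule lift) (use that in auto)
  note [simp] = G_Arr[THEN conjunct1] G_Arr[THEN conjunct2, THEN conjunct1]
    G_Arr[THEN conjunct2, THEN conjunct2, THEN conjunct1]
    G_Arr[THEN conjunct2, THEN conjunct2, THEN conjunct2]
  have eq: "f = f'" if "f \<in> Arr A" "f' \<in> Arr A" "Dom A f = Dom A f'" "Cod A f = Cod A f'"
    "on_Arr F f = on_Arr F f'" for f f'
    using faithful[of f "Dom A f'" "Cod A f'" f'] that by (simp add: Hom_iff)
  have G_Ident: "on_Arr G (Ident C Y) = Ident A (P Y)" if "Y \<in> Obj C" for Y
    by (rule eq) (use that in simp_all)
  have G_Comp: "on_Arr G (h \<cdot>\<^bsub>C\<^esub> g) = on_Arr G h \<cdot>\<^bsub>A\<^esub> on_Arr G g"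
    if "g \<in> Arr C" "h \<in> Arr C" "Cod C g = Dom C h" for g h
    by (rule eq) (use that in simp_all)
  have G: "functor C A G"
    by unfold_locales (auto simp: Hom_iff G_Ident G_Comp)
  interpret G: "functor" C A G by fact
  define \<eta> where "\<eta> X = lift X (P (on_Obj F X)) (Inverse C (e (on_Obj F X)))" for X
  have \<eta>: "\<eta> X \<in> Arr A \<and> Dom A (\<eta> X) = X \<and> Cod A (\<eta> X) = P (on_Obj F X)
      \<and> on_Arr F (\<eta> X) = Inverse C (e (on_Obj F X))" if "X \<in> Obj A" for X
    unfolding \<eta>_def by (rule lift) (use that in auto)
  define \<theta> where "\<theta> X = lift (P (on_Obj F X)) X (e (on_Obj F X))" for X
  have \<theta>: "\<theta> X \<in> Arr A \<and> Cod A (\<theta> X) = X \<and> Dom A (\<theta> X) = P (on_Obj F X)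
      \<and> on_Arr F (\<theta> X) = e (on_Obj F X)" if "X \<in> Obj A" for X
    using lift[of "P (on_Obj F X)" X "e (on_Obj F X)"] that unfolding \<theta>_def by simp
  have \<theta>\<eta>: "\<theta> X \<cdot>\<^bsub>A\<^esub> \<eta> X = Ident A X" "\<eta> X \<cdot>\<^bsub>A\<^esub> \<theta> X = Ident A (P (on_Obj F X))"
    if "X \<in> Obj A" for X
    by (rule eq; use \<eta>[OF that] \<theta>[OF that] that in simp)+
  have \<eta>\<theta>: "inverse_arrows A (\<eta> X) (\<theta> X)" if "X \<in> Obj A" for X
    using \<eta>[OF that] \<theta>[OF that] \<theta>\<eta>[OF that] by (simp add: inverse_arrows_def Hom_iff)
  have nat: "\<eta> (Cod A f) \<cdot>\<^bsub>A\<^esub> f = on_Arr G (on_Arr F f) \<cdot>\<^bsub>A\<^esub> \<eta> (Dom A f)" if "f \<in> Arr A" for f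
    by (rule eq) (use \<eta>[of "Dom A f"] \<eta>[of "Cod A f"] that in simp_all)
  have "natural_isomorphism A A id_functor (comp_functor G F) \<eta>"
    using \<eta> \<eta>\<theta> nat
    by unfold_locales (auto simp: id_functor_def comp_functor_def Hom_iff is_iso_def)
  moreover have "natural_isomorphism C C (comp_functor F G) id_functor e"
    by unfold_locales (auto simp: id_functor_def comp_functor_def Hom_iff)
  ultimately show ?thesis
    unfolding equivalence_of_categories_def using assms(1) G by blast
qed


section \<open>Braid words and representations of braid groups\<close>

lemma braid_words_iff [simp]:
  "[] \<in> braid_words n"
  "x # w \<in> braid_words n \<longleftrightarrow> 1 \<le> fst x \<and> fst x < n \<and> w \<in> braid_words n"
  "u @ v \<in> braid_words n \<longleftrightarrow> u \<in> braid_words n \<and> v \<in> braid_words n"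
  by (auto simp: braid_words_def mem_Times_iff)

lemma braid_words_mono: "m \<le> n \<Longrightarrow> w \<in> braid_words m \<Longrightarrow> w \<in> braid_words n"
  by (auto simp: braid_words_def mem_Times_iff lists_eq_set subset_iff)

definition shift_word :: "nat \<Rightarrow> braid_word \<Rightarrow> braid_word"
  where "shift_word m = map (\<lambda>(i, e). (m + i, e))"

lemma juxtapose_eq: "juxtapose m u v = u @ shift_word m v"
  by (simp add: juxtapose_def shift_word_def)

lemma shift_word_simps [simp]:
  "shift_word m [] = []"
  "shift_word m (x # w) = (m + fst x, snd x) # shift_word m w"
  "shift_word m (u @ v) = shift_word m u @ shift_word m v"
  "shift_word 0 w = w"
  "shift_word m (shift_word k w) = shift_word (m + k) w"
  by (auto simp: shift_word_def split_beta)

lemma shift_word_in [simp]: "w \<in> braid_words n \<Longrightarrow> shift_word m w \<in> braid_words (m + n)"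
  by (induction w) auto

text \<open>
  A single strand crossing \<open>q - p\<close> neighbours. The blocks of the braiding word have this form, and
  so do the coset representatives in the normal form of permutations below.
\<close>

definition desc :: "nat \<Rightarrow> nat \<Rightarrow> braid_word"
  where "desc p q = map (\<lambda>i. (i, True)) (rev [p..<q])"

lemma desc_simps [simp]:
  "desc p p = []"
  "p \<le> q \<Longrightarrow> desc p (Suc q) = (q, True) # desc p q"
  by (auto simp: desc_def)

lemma desc_rec_right: "p < q \<Longrightarrow> desc p q = desc (Suc p) q @ [(p, True)]"
  by (simp add: desc_def upt_conv_Cons)

lemma desc_append: "\<lbrakk>p \<le> q; q \<le> r\<rbrakk> \<Longrightarrow> desc p r = desc q r @ desc p q"
  unfolding desc_def by (metis map_append rev_append le_add_diff_inverse upt_add_eq_append)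

lemma desc_in [simp]: "1 \<le> p \<Longrightarrow> q \<le> n \<Longrightarrow> desc p q \<in> braid_words n"
  by (auto simp: desc_def braid_words_def)

lemma shift_word_desc: "shift_word m (desc p q) = desc (m + p) (m + q)"
proof -
  have "map ((+) m) [p..<q] = [m + p..<m + q]"
    by (rule nth_equalityI) auto
  then have "map (\<lambda>i. (i, True)) (rev (map ((+) m) [p..<q])) = desc (m + p) (m + q)"
    by (simp only: desc_def)
  then show ?thesis
    by (simp add: shift_word_def desc_def rev_map o_def)
qed

lemma braiding_word_eq: "braiding_word n m = concat (map (\<lambda>k. desc k (m + k)) [1..<n + 1])"
  by (simp add: braiding_word_def desc_def)

lemma braiding_word_0 [simp]: "braiding_word 0 m = []" "braiding_word n 0 = []"
  by (auto simp: braiding_word_eq)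

lemma braiding_word_Suc:
  "braiding_word (Suc m) n = braiding_word m n @ desc (Suc m) (n + Suc m)"
  by (simp add: braiding_word_eq)

lemma braiding_word_add:
  "braiding_word (m + n) k = braiding_word m k @ shift_word m (braiding_word n k)"
  by (induction n) (auto simp: braiding_word_Suc shift_word_desc ac_simps)

lemma braiding_word_in [simp]: "braiding_word m n \<in> braid_words (m + n)"
proof (induction m)
  case (Suc m)
  then show ?case by (auto simp: braiding_word_Suc intro: braid_words_mono[of "m + n"])
qed simp

text \<open>
  Homomorphisms from the braid group are described by the images of the generators. Computations
  with braids take place in the target group, where inverses are available, and not with equivalence
  of words; with \<open>PS\<^sub>n\<close> or \<open>B\<^sub>n\<close> as the target they yield identities of braids.
\<close>

definition weval :: "('a, 'x) monoid_scheme \<Rightarrow> (nat \<Rightarrow> 'a) \<Rightarrow> braid_word \<Rightarrow> 'a"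
  where "weval G s w =
    foldr (\<lambda>(i, e) x. (if e then s i else inv\<^bsub>G\<^esub> s i) \<otimes>\<^bsub>G\<^esub> x) w \<one>\<^bsub>G\<^esub>"

lemma weval_simps [simp]:
  "weval G s [] = \<one>\<^bsub>G\<^esub>"
  "weval G s (x # w) = (if snd x then s (fst x) else inv\<^bsub>G\<^esub> s (fst x)) \<otimes>\<^bsub>G\<^esub> weval G s w"
  by (auto simp: weval_def split_beta)

locale braid_rep = group G for G :: "('a, 'x) monoid_scheme" (structure) +
  fixes n :: nat and s :: "nat \<Rightarrow> 'a"
  assumes gen_closed: "\<lbrakk>1 \<le> i; i < n\<rbrakk> \<Longrightarrow> s i \<in> carrier G"
    and far: "\<lbrakk>1 \<le> i; i + 2 \<le> j; j < n\<rbrakk> \<Longrightarrow> s i \<otimes> s j = s j \<otimes> s i"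
    and near: "\<lbrakk>1 \<le> i; Suc i < n\<rbrakk> \<Longrightarrow> s i \<otimes> (s (Suc i) \<otimes> s i) = s (Suc i) \<otimes> (s i \<otimes> s (Suc i))"

context group
begin

lemma inv_mult_cancel [simp]:
  "\<lbrakk>x \<in> carrier G; y \<in> carrier G\<rbrakk> \<Longrightarrow> inv x \<otimes> (x \<otimes> y) = y"
  "\<lbrakk>x \<in> carrier G; y \<in> carrier G\<rbrakk> \<Longrightarrow> x \<otimes> (inv x \<otimes> y) = y"
  by (simp_all flip: m_assoc)

definition commutes :: "'a \<Rightarrow> 'a \<Rightarrow> bool"
  where "commutes x y \<longleftrightarrow> x \<otimes> y = y \<otimes> x"

lemma commutes_sym: "commutes x y \<Longrightarrow> commutes y x"
  by (simp add: commutes_def)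

lemma commutes_assoc:
  "\<lbrakk>commutes x y; x \<in> carrier G; y \<in> carrier G; z \<in> carrier G\<rbrakk> \<Longrightarrow> x \<otimes> (y \<otimes> z) = y \<otimes> (x \<otimes> z)"
  by (simp add: commutes_def flip: m_assoc)

lemma commutes_one [simp]:
  "x \<in> carrier G \<Longrightarrow> commutes x \<one>" "x \<in> carrier G \<Longrightarrow> commutes \<one> x"
  by (auto simp: commutes_def)

lemma commutes_mult:
  assumes "commutes x y" "commutes x z" "x \<in> carrier G" "y \<in> carrier G" "z \<in> carrier G"
  shows "commutes x (y \<otimes> z)"
  using assms commutes_assoc[of x y z] by (simp add: commutes_def m_assoc)

lemma commutes_iff_conj:
  assumes "x \<in> carrier G" "y \<in> carrier G"
  shows "commutes x y \<longleftrightarrow> x \<otimes> y \<otimes> inv x = y"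
  using assms inv_solve_right[of y "x \<otimes> y" x] by (auto simp: commutes_def)

lemma commutes_inv:
  assumes "commutes x y" "x \<in> carrier G" "y \<in> carrier G"
  shows "commutes x (inv y)"
proof -
  have "y \<otimes> (inv y \<otimes> x) = y \<otimes> (x \<otimes> inv y)"
    using assms commutes_assoc[of x y "inv y"] by (simp add: r_inv)
  then have "inv y \<otimes> x = x \<otimes> inv y"
    using Units_l_cancel[of y "inv y \<otimes> x" "x \<otimes> inv y"] assms by (simp add: Units_eq)
  then show ?thesis by (simp add: commutes_def)
qed

end

context braid_rep
begin

abbreviation ev :: "braid_word \<Rightarrow> 'a" where "ev \<equiv> weval G s"

lemma ev_closed [simp]: "w \<in> braid_words n \<Longrightarrow> ev w \<in> carrier G"
  by (induction w) (auto simp: gen_closed)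

lemma ev_append [simp]:
  "u \<in> braid_words n \<Longrightarrow> v \<in> braid_words n \<Longrightarrow> ev (u @ v) = ev u \<otimes> ev v"
  by (induction u) (auto simp: gen_closed m_assoc)

lemma near_assoc:
  "\<lbrakk>1 \<le> i; Suc i < n; x \<in> carrier G\<rbrakk> \<Longrightarrow>
    s i \<otimes> (s (Suc i) \<otimes> (s i \<otimes> x)) = s (Suc i) \<otimes> (s i \<otimes> (s (Suc i) \<otimes> x))"
  using near[of i] by (simp add: gen_closed flip: m_assoc)

lemma ev_braid_equiv:
  assumes "braid_equiv n u v"
  shows "u \<in> braid_words n \<and> v \<in> braid_words n \<and> ev u = ev v"
  using assms
proof induction
  case (far u v i j)
  then have "commutes (s i) (s j)" and [simp]: "s i \<in> carrier G" "s j \<in> carrier G"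
    using braid_rep.far[OF braid_rep_axioms, of i j] by (auto simp: commutes_def gen_closed)
  with far show ?case using commutes_assoc[of "s i" "s j" "ev v"] by simp
next
  case (near u v i)
  then show ?case using near_assoc[of i "ev v"] by (simp add: gen_closed)
next
  case (cancel u v i e)
  then show ?case by (cases e) (auto simp: gen_closed)
qed auto

lemma commutes_gen_ev:
  assumes "x \<in> carrier G" "w \<in> braid_words n" "\<And>i. i \<in> fst ` set w \<Longrightarrow> commutes x (s i)"
  shows "commutes x (ev w)"
  using assms(2-) by (induction w) (auto simp: assms(1) gen_closed intro!: commutes_mult commutes_inv)

lemma commutes_gen: "\<lbrakk>1 \<le> i; i < n; 1 \<le> j; j < n; i + 2 \<le> j \<or> j + 2 \<le> i\<rbrakk> \<Longrightarrow> commutes (s i) (s j)"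
  using far[of i j] far[of j i] by (auto simp: commutes_def)

lemma commutes_gen_desc:
  assumes "1 \<le> p" "q \<le> n" "1 \<le> i" "i < n" "q < i \<or> i + 2 \<le> p"
  shows "commutes (s i) (ev (desc p q))"
proof (rule commutes_gen_ev)
  show "commutes (s i) (s j)" if "j \<in> fst ` set (desc p q)" for j
    using that assms by (intro commutes_gen) (auto simp: desc_def)
qed (use assms in \<open>auto simp: gen_closed\<close>)

text \<open>
  A crossing between two of the neighbours can be slid through the strand that crosses all of them;
  it moves by one place, because that strand leaves the places on one side and arrives on the other.
\<close>

lemma desc_slide:
  assumes "1 \<le> p" "p < j" "j < q" "q \<le> n"
  shows "ev (desc p q) \<otimes> s j = s (j - 1) \<otimes> ev (desc p q)"
  using assms(3,4)
proof (induction q)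
  case (Suc q)
  note [simp] = gen_closed m_assoc
  show ?case
  proof (cases "j = q")
    case True
    then obtain r where r: "q = Suc r" using assms by (cases q) auto
    have c: "commutes (s q) (ev (desc p r))"
      by (rule commutes_gen_desc) (use assms Suc r in auto)
    then have "ev (desc p r) \<otimes> s q = s q \<otimes> ev (desc p r)" by (simp add: commutes_def)
    then show ?thesis
      using assms Suc r True near_assoc[of r "ev (desc p r)"] by simp
  next
    case False
    then have "ev (desc p q) \<otimes> s j = s (j - 1) \<otimes> ev (desc p q)" using Suc by simp
    moreover have "commutes (s q) (s (j - 1))"
      by (rule commutes_gen) (use assms Suc False in auto)
    ultimately show ?thesis
      using assms Suc False commutes_assoc[of "s q" "s (j - 1)" "ev (desc p q)"] by simp
  qed
qed simp

text \<open>
  Dually, a crossing between two parallel strands can be slid along both of them, past everything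
  that they cross.
\<close>

lemma desc_desc_slide:
  assumes "1 \<le> p" "p \<le> q" "q < n"
  shows "ev (desc p q) \<otimes> (ev (desc (Suc p) (Suc q)) \<otimes> s p)
    = s q \<otimes> (ev (desc p q) \<otimes> ev (desc (Suc p) (Suc q)))"
  using assms(2,3)
proof (induction q rule: dec_induct)
  case base
  then show ?case using assms by (simp add: gen_closed)
next
  case (step q)
  note [simp] = gen_closed m_assoc
  define d d' where "d = ev (desc p q)" and "d' = ev (desc (Suc p) (Suc q))"
  have [simp]: "d \<in> carrier G" "d' \<in> carrier G" using assms step by (auto simp: d_def d'_def)
  have "commutes (s (Suc q)) d"
    unfolding d_def by (rule commutes_gen_desc) (use assms step in auto)
  then have c: "d \<otimes> (s (Suc q) \<otimes> x) = s (Suc q) \<otimes> (d \<otimes> x)" if "x \<in> carrier G" for x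
    using commutes_assoc[of "s (Suc q)" d x] that assms step by simp
  have "s q \<otimes> (s (Suc q) \<otimes> (s q \<otimes> (d \<otimes> d'))) = s (Suc q) \<otimes> (s q \<otimes> (s (Suc q) \<otimes> (d \<otimes> d')))"
    using near_assoc[of q "d \<otimes> d'"] assms step by simp
  moreover have "d \<otimes> (d' \<otimes> s p) = s q \<otimes> (d \<otimes> d')"
    using step by (simp add: d_def d'_def)
  ultimately show ?case
    using assms step c by (simp flip: d_def d'_def)
qed

lemma mono: "m \<le> n \<Longrightarrow> braid_rep G m s"
  by unfold_locales (auto intro: far near gen_closed)

end


section \<open>Braid groups, pure braids, and their representations\<close>

lemma braid_equiv_in:
  assumes "braid_equiv n u v"
  shows "u \<in> braid_words n" "v \<in> braid_words n"
  using assms by induction auto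

lemma braid_equiv_append_left:
  assumes "braid_equiv n u v" "w \<in> braid_words n"
  shows "braid_equiv n (w @ u) (w @ v)"
  using assms(1)
proof induction
  case (refl u)
  then show ?case using assms(2) by (simp add: braid_equiv.refl)
next
  case (cancel u v i e)
  then show ?case using braid_equiv.cancel[of "w @ u" n v i e] assms(2) by simp
next
  case (far u v i j)
  then show ?case using braid_equiv.far[of "w @ u" n v i j] assms(2) by simp
next
  case (near u v i)
  then show ?case using braid_equiv.near[of "w @ u" n v i] assms(2) by simp
qed (blast intro: braid_equiv.sym braid_equiv.trans)+

lemma braid_equiv_append_right:
  assumes "braid_equiv n u v" "w \<in> braid_words n"
  shows "braid_equiv n (u @ w) (v @ w)"
  using assms(1)
proof induction
  case (refl u)
  then show ?case using assms(2) by (simp add: braid_equiv.refl)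
next
  case (cancel u v i e)
  then show ?case using braid_equiv.cancel[of u n "v @ w" i e] assms(2) by simp
next
  case (far u v i j)
  then show ?case using braid_equiv.far[of u n "v @ w" i j] assms(2) by simp
next
  case (near u v i)
  then show ?case using braid_equiv.near[of u n "v @ w" i] assms(2) by simp
qed (blast intro: braid_equiv.sym braid_equiv.trans)+

lemma braid_equiv_append:
  "\<lbrakk>braid_equiv n u u'; braid_equiv n v v'\<rbrakk> \<Longrightarrow> braid_equiv n (u @ v) (u' @ v')"
  by (meson braid_equiv.trans braid_equiv_append_left braid_equiv_append_right braid_equiv_in)

lemma braid_class_eq_iff:
  "u \<in> braid_words n \<Longrightarrow> braid_class n u = braid_class n v \<longleftrightarrow> braid_equiv n u v"
  unfolding braid_class_def by (blast intro: braid_equiv.refl braid_equiv.sym braid_equiv.trans)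

lemma braid_class_self: "w \<in> braid_words n \<Longrightarrow> w \<in> braid_class n w"
  by (simp add: braid_class_def braid_equiv.refl)

definition winv :: "braid_word \<Rightarrow> braid_word"
  where "winv w = rev (map (\<lambda>(i, e). (i, \<not> e)) w)"

lemma winv_simps [simp]: "winv [] = []" "winv (x # w) = winv w @ [(fst x, \<not> snd x)]"
  by (auto simp: winv_def split_beta)

lemma winv_in [simp]: "w \<in> braid_words n \<Longrightarrow> winv w \<in> braid_words n"
  by (induction w) auto

lemma winv_cancel: "w \<in> braid_words n \<Longrightarrow> braid_equiv n (winv w @ w) []"
proof (induction w)
  case (Cons x w)
  have "braid_equiv n (winv w @ [(fst x, \<not> snd x), (fst x, \<not> \<not> snd x)] @ w) (winv w @ w)"
    by (rule braid_equiv.cancel) (use Cons in auto)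
  then show ?case using Cons by (auto intro: braid_equiv.trans)
qed (simp add: braid_equiv.refl)

lemma carrier_braid_group: "carrier (braid_group n) = braid_class n ` braid_words n"
  by (simp add: braid_group_def)

lemma braid_class_closed [simp]: "w \<in> braid_words n \<Longrightarrow> braid_class n w \<in> carrier (braid_group n)"
  by (simp add: carrier_braid_group)

lemma one_braid_group: "\<one>\<^bsub>braid_group n\<^esub> = braid_class n []"
  by (simp add: braid_group_def)

lemma mult_braid_class:
  assumes "u \<in> braid_words n" "v \<in> braid_words n"
  shows "braid_class n u \<otimes>\<^bsub>braid_group n\<^esub> braid_class n v = braid_class n (u @ v)"
proof -
  have "braid_class n (u' @ v') = braid_class n (u @ v)"
    if "u' \<in> braid_class n u" "v' \<in> braid_class n v" for u' v'
  proof -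
    have "braid_equiv n u u'" "braid_equiv n v v'" using that by (auto simp: braid_class_def)
    then have "braid_equiv n (u @ v) (u' @ v')" by (rule braid_equiv_append)
    then show ?thesis using assms by (simp add: braid_class_eq_iff flip: braid_class_eq_iff)
  qed
  then have "{braid_class n (u' @ v') |u' v'. u' \<in> braid_class n u \<and> v' \<in> braid_class n v}
      = {braid_class n (u @ v)}"
    using braid_class_self[OF assms(1)] braid_class_self[OF assms(2)] by blast
  then show ?thesis by (simp add: braid_group_def)
qed

lemma group_braid_group: "group (braid_group n)"
proof (rule groupI)
  fix x y z assume "x \<in> carrier (braid_group n)" "y \<in> carrier (braid_group n)"
    "z \<in> carrier (braid_group n)"
  then show "x \<otimes>\<^bsub>braid_group n\<^esub> y \<otimes>\<^bsub>braid_group n\<^esub> z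
      = x \<otimes>\<^bsub>braid_group n\<^esub> (y \<otimes>\<^bsub>braid_group n\<^esub> z)"
    by (auto simp: carrier_braid_group mult_braid_class)
next
  fix x assume "x \<in> carrier (braid_group n)"
  then obtain w where w: "w \<in> braid_words n" "x = braid_class n w"
    by (auto simp: carrier_braid_group)
  then have "braid_class n (winv w) \<otimes>\<^bsub>braid_group n\<^esub> x = \<one>\<^bsub>braid_group n\<^esub>"
    by (simp add: one_braid_group mult_braid_class braid_class_eq_iff winv_cancel)
  then show "\<exists>y\<in>carrier (braid_group n). y \<otimes>\<^bsub>braid_group n\<^esub> x = \<one>\<^bsub>braid_group n\<^esub>"
    using w winv_in braid_class_closed by blast
qed (auto simp: carrier_braid_group mult_braid_class one_braid_group)

interpretation braid: group "braid_group n" for n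
  by (rule group_braid_group)

lemma inv_braid_class:
  "w \<in> braid_words n \<Longrightarrow> inv\<^bsub>braid_group n\<^esub> braid_class n w = braid_class n (winv w)"
  by (rule braid.inv_equality)
    (simp_all add: one_braid_group mult_braid_class braid_class_eq_iff winv_cancel)

text \<open>
  Homomorphic images of the braid group and representations are the same thing; this lemma and
  \<open>braid_rep.group_hom_rep_hom\<close> are the two directions of the universal property of the
  presentation.
\<close>

lemma braid_rep_of_hom:
  assumes "group_hom (braid_group n) H h"
  shows "braid_rep H n (\<lambda>i. h (braid_class n [(i, True)]))"
    and "w \<in> braid_words n \<Longrightarrow> weval H (\<lambda>i. h (braid_class n [(i, True)])) w = h (braid_class n w)"
proof -
  interpret group_hom "braid_group n" H h by fact
  have m: "h (braid_class n u) \<otimes>\<^bsub>H\<^esub> h (braid_class n v) = h (braid_class n (u @ v))"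
    if "u \<in> braid_words n" "v \<in> braid_words n" for u v
    using that by (simp flip: hom_mult add: mult_braid_class)
  show "braid_rep H n (\<lambda>i. h (braid_class n [(i, True)]))"
  proof
    fix i j assume "1 \<le> i" "i + 2 \<le> j" "j < n"
    then show "h (braid_class n [(i, True)]) \<otimes>\<^bsub>H\<^esub> h (braid_class n [(j, True)])
        = h (braid_class n [(j, True)]) \<otimes>\<^bsub>H\<^esub> h (braid_class n [(i, True)])"
      using braid_equiv.far[of "[]" n "[]" i j] by (simp add: m flip: braid_class_eq_iff)
  next
    fix i assume "1 \<le> i" "Suc i < n"
    then show "h (braid_class n [(i, True)]) \<otimes>\<^bsub>H\<^esub> (h (braid_class n [(Suc i, True)]) \<otimes>\<^bsub>H\<^esub> h (braid_class n [(i, True)]))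
      = h (braid_class n [(Suc i, True)]) \<otimes>\<^bsub>H\<^esub> (h (braid_class n [(i, True)]) \<otimes>\<^bsub>H\<^esub> h (braid_class n [(Suc i, True)]))"
      using braid_equiv.near[of "[]" n "[]" i] by (simp add: m flip: braid_class_eq_iff)
  qed simp
  show "weval H (\<lambda>i. h (braid_class n [(i, True)])) w = h (braid_class n w)" if "w \<in> braid_words n"
    using that
  proof (induction w)
    case Nil
    then show ?case by (metis hom_one one_braid_group weval_simps(1))
  next
    case (Cons x w)
    have x: "[x] \<in> braid_words n" using Cons.prems by auto
    have "(if snd x then h (braid_class n [(fst x, True)]) else inv\<^bsub>H\<^esub> h (braid_class n [(fst x, True)]))
        = h (braid_class n [x])"
    proof (cases "snd x")
      case False
      then have "[(fst x, False)] = [x]" by (simp add: prod_eq_iff)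
      then have "inv\<^bsub>braid_group n\<^esub> braid_class n [(fst x, True)] = braid_class n [x]"
        using x by (simp add: inv_braid_class)
      then show ?thesis using False x by (simp flip: hom_inv)
    next
      case True
      then have "[(fst x, True)] = [x]" by (simp add: prod_eq_iff)
      then show ?thesis using True by simp
    qed
    then show ?case using Cons m[OF x, of w] by simp
  qed
qed

context braid_rep
begin

definition rep_hom :: "braid_word set \<Rightarrow> 'a"
  where "rep_hom b = the_elem (ev ` b)"

lemma rep_hom_braid_class [simp]: "w \<in> braid_words n \<Longrightarrow> rep_hom (braid_class n w) = ev w"
  unfolding rep_hom_def
  by (rule the_elem_image_unique) (use braid_class_self ev_braid_equiv in \<open>auto simp: braid_class_def\<close>)

lemma group_hom_rep_hom: "group_hom (braid_group n) G rep_hom"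
  by unfold_locales (auto simp: hom_def carrier_braid_group mult_braid_class)

end

lemma word_perm_simps [simp]:
  "word_perm [] = id"
  "word_perm (x # w) = transpose (fst x) (Suc (fst x)) \<circ> word_perm w"
  by (auto simp: word_perm_def split_beta)

lemma word_perm_append: "word_perm (u @ v) = word_perm u \<circ> word_perm v"
  by (induction u) auto

lemma word_perm_permutes: "w \<in> braid_words n \<Longrightarrow> word_perm w permutes {1..n}"
  by (induction w) (auto intro!: permutes_compose permutes_swap_id permutes_id simp del: permutes_id)

interpretation sym: group "sym_group n" for n
  by (rule sym_group_is_group)

lemma braid_rep_sym_group: "braid_rep (sym_group n) n (\<lambda>i. transpose i (Suc i))"
  by unfold_locales
    (auto simp: sym_group_def fun_eq_iff transpose_def intro!: permutes_swap_id)

lemma weval_sym_group: "w \<in> braid_words n \<Longrightarrow> weval (sym_group n) (\<lambda>i. transpose i (Suc i)) w = word_perm w"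
proof (induction w)
  case (Cons x w)
  then have "transpose (fst x) (Suc (fst x)) \<in> carrier (sym_group n)"
    by (auto simp: sym_group_def intro!: permutes_swap_id)
  then have "inv\<^bsub>sym_group n\<^esub> (transpose (fst x) (Suc (fst x))) = transpose (fst x) (Suc (fst x))"
    by simp
  with Cons show ?case by (simp add: sym_group_def)
qed (simp add: sym_group_def)

lemma braid_equiv_word_perm: "braid_equiv n u v \<Longrightarrow> word_perm u = word_perm v"
  using braid_rep.ev_braid_equiv[OF braid_rep_sym_group] weval_sym_group by metis

lemma braid_perm_class [simp]: "w \<in> braid_words n \<Longrightarrow> braid_perm (braid_class n w) = word_perm w"
  unfolding braid_perm_def
  by (rule the_elem_image_unique)
    (use braid_class_self braid_equiv_word_perm in \<open>auto simp: braid_class_def\<close>)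

lemma group_hom_braid_perm: "group_hom (braid_group n) (sym_group n) braid_perm"
  by unfold_locales
    (auto simp: hom_def carrier_braid_group mult_braid_class word_perm_append sym_group_mult
      sym_group_carrier word_perm_permutes simp del: One_nat_def)

lemma pure_braids_eq: "pure_braids n = braid_class n ` {w \<in> braid_words n. word_perm w = id}"
  by (auto simp: pure_braids_def kernel_def carrier_braid_group sym_group_one)

lemma normal_pure_braids: "pure_braids n \<lhd> braid_group n"
  unfolding pure_braids_def by (rule group_hom.normal_kernel[OF group_hom_braid_perm])

lemma normal_derived_pure_braids: "derived (braid_group n) (pure_braids n) \<lhd> braid_group n"
  by (rule braid.derived_is_normal[OF normal_pure_braids])

interpretation PSG: group "PS_group n" for n
  unfolding PS_group_def by (rule normal.factorgroup_is_group[OF normal_derived_pure_braids])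

definition PS_class :: "nat \<Rightarrow> braid_word \<Rightarrow> braid_word set set"
  where "PS_class n w = PS_proj n (braid_class n w)"

lemma group_hom_PS_proj: "group_hom (braid_group n) (PS_group n) (PS_proj n)"
  using normal.r_coset_hom_Mod[OF normal_derived_pure_braids, of n]
  unfolding PS_proj_def[abs_def] PS_group_def[symmetric]
  by (simp add: group_hom_def group_hom_axioms_def group_braid_group PSG.is_group)

lemma carrier_PS_group: "carrier (PS_group n) = PS_class n ` braid_words n"
  by (simp add: PS_group_def carrier_FactGroup carrier_braid_group PS_class_def[abs_def]
      PS_proj_def image_image)

lemma PS_class_closed [simp]: "w \<in> braid_words n \<Longrightarrow> PS_class n w \<in> carrier (PS_group n)"
  by (simp add: carrier_PS_group)

lemma mult_PS_class [simp]:
  "u \<in> braid_words n \<Longrightarrow> v \<in> braid_words n \<Longrightarrow>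
    PS_class n u \<otimes>\<^bsub>PS_group n\<^esub> PS_class n v = PS_class n (u @ v)"
  using group_hom.hom_mult[OF group_hom_PS_proj, of "braid_class n u" n "braid_class n v"]
  by (simp add: PS_class_def mult_braid_class)

lemma one_PS_group: "\<one>\<^bsub>PS_group n\<^esub> = PS_class n []"
  using group_hom.hom_one[OF group_hom_PS_proj, of n] by (simp add: PS_class_def one_braid_group)

lemma braid_rep_PS: "braid_rep (PS_group n) n (\<lambda>i. PS_class n [(i, True)])"
  and weval_PS: "w \<in> braid_words n \<Longrightarrow> weval (PS_group n) (\<lambda>i. PS_class n [(i, True)]) w = PS_class n w"
  using braid_rep_of_hom[OF group_hom_PS_proj[of n]] by (simp_all add: PS_class_def)

text \<open>
  The kernel contains all commutators of pure braids, and these generate the subgroup by which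
  \<open>PS\<^sub>n\<close> is a quotient. All maps out of \<open>PS\<^sub>n\<close> are obtained in this way: the two halves of the tensor
  product of \<open>PS\<close>, and the action on the objects of a pseudosymmetric category.
\<close>

lemma (in braid_rep) PS_class_eq_imp_ev_eq:
  assumes pure: "\<And>p q. \<lbrakk>p \<in> braid_words n; word_perm p = id; q \<in> braid_words n; word_perm q = id\<rbrakk>
      \<Longrightarrow> commutes (ev p) (ev q)"
    and eq: "PS_class n u = PS_class n v" and uv: "u \<in> braid_words n" "v \<in> braid_words n"
  shows "ev u = ev v"
proof -
  interpret h: group_hom "braid_group n" G rep_hom by (rule group_hom_rep_hom)
  let ?D = "derived (braid_group n) (pure_braids n)"
  have "?D \<subseteq> kernel (braid_group n) G rep_hom"
    unfolding derived_def
  proof (rule braid.generate_subgroup_incl[OF _ h.subgroup_kernel], safe)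
    fix a b assume "a \<in> pure_braids n" "b \<in> pure_braids n"
    then have c: "a \<in> carrier (braid_group n)" "b \<in> carrier (braid_group n)"
      "commutes (rep_hom a) (rep_hom b)"
      using pure by (auto simp: pure_braids_eq)
    then have "rep_hom (a \<otimes>\<^bsub>braid_group n\<^esub> b \<otimes>\<^bsub>braid_group n\<^esub> inv\<^bsub>braid_group n\<^esub> a \<otimes>\<^bsub>braid_group n\<^esub> inv\<^bsub>braid_group n\<^esub> b) = \<one>"
      by (simp add: commutes_iff_conj)
    then show "a \<otimes>\<^bsub>braid_group n\<^esub> b \<otimes>\<^bsub>braid_group n\<^esub> inv\<^bsub>braid_group n\<^esub> a \<otimes>\<^bsub>braid_group n\<^esub> inv\<^bsub>braid_group n\<^esub> b
        \<in> kernel (braid_group n) G rep_hom"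
      using c by (simp add: kernel_def)
  qed
  moreover have "braid_class n u \<in> ?D #>\<^bsub>braid_group n\<^esub> braid_class n v"
    using eq braid.rcos_self[of "braid_class n u" n ?D] normal_derived_pure_braids[of n] uv
    by (simp add: PS_class_def PS_proj_def normal_imp_subgroup)
  then obtain d where "d \<in> ?D" "braid_class n u = d \<otimes>\<^bsub>braid_group n\<^esub> braid_class n v"
    by (auto simp: r_coset_def)
  ultimately have "rep_hom (braid_class n u) = rep_hom (braid_class n v)"
    using uv by (auto simp: kernel_def)
  then show ?thesis using uv by simp
qed


section \<open>Pure braids are products of conjugates of squares\<close>

lemma word_perm_desc: "p \<le> q \<Longrightarrow> word_perm (desc p q) p = q"
  by (induction q rule: dec_induct) auto

text \<open>
  If the generators square to one, multiplying \<open>w' \<sigma>\<^sub>m \<dots> \<sigma>\<^sub>k\<close> by a further letter on the right either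
  moves \<open>k\<close> by one, or the letter passes to the left of the descending word.
\<close>

lemma (in braid_rep) involutive_normal_form:
  assumes sq: "\<And>i. \<lbrakk>1 \<le> i; i < n\<rbrakk> \<Longrightarrow> s i \<otimes> s i = \<one>"
    and m: "Suc m \<le> n" and w: "w \<in> braid_words (Suc m)"
  shows "\<exists>w' k. w' \<in> braid_words m \<and> 1 \<le> k \<and> k \<le> Suc m \<and> ev w = ev w' \<otimes> ev (desc k (Suc m))"
  using w
proof (induction w rule: rev_induct)
  case Nil
  then show ?case by (intro exI[of _ "[]"] exI[of _ "Suc m"]) auto
next
  case (snoc x w)
  then obtain w' k where w': "w' \<in> braid_words m" and k: "1 \<le> k" "k \<le> Suc m"
    and w: "ev w = ev w' \<otimes> ev (desc k (Suc m))" by auto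
  define j where "j = fst x"
  have j: "1 \<le> j" "j \<le> m" using snoc.prems by (auto simp: j_def)
  have [simp]: "s j \<in> carrier G" "s (fst x) \<in> carrier G" using gen_closed j m by (simp_all add: j_def)
  have words: "w \<in> braid_words n" "w' \<in> braid_words n" "desc k (Suc m) \<in> braid_words n"
    using snoc.prems w' k m braid_words_mono[of "Suc m" n] braid_words_mono[of m n] by auto
  have "inv s j = s j" using sq[of j] j m inv_equality[of "s j" "s j"] by simp
  then have wx: "ev (w @ [x]) = ev w' \<otimes> (ev (desc k (Suc m)) \<otimes> s j)"
    using words w snoc.prems m j braid_words_mono[of "Suc m" n] by (simp add: j_def m_assoc)
  consider "j + 2 \<le> k" | "k = Suc j" | "k = j" | "k < j" by linarith
  then show ?case
  proof cases
    case 1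
    then have "commutes (s j) (ev (desc k (Suc m)))"
      using j m k by (intro commutes_gen_desc) auto
    then have "ev (w @ [x]) = ev (w' @ [(j, True)]) \<otimes> ev (desc k (Suc m))"
      using wx words j m by (simp add: commutes_def m_assoc)
    moreover have "w' @ [(j, True)] \<in> braid_words m" using w' 1 j k by auto
    ultimately show ?thesis using k by blast
  next
    case 2
    then have "ev (w @ [x]) = ev w' \<otimes> ev (desc j (Suc m))"
      using wx words j m by (subst desc_rec_right) (auto simp: m_assoc)
    then show ?thesis using w' j by (intro exI[of _ w'] exI[of _ j]) auto
  next
    case 3
    have "ev (desc k (Suc m)) \<otimes> s j = ev (desc (Suc j) (Suc m))"
      using 3 j m sq[of j] by (subst desc_rec_right) (auto simp: m_assoc)
    then show ?thesis using wx w' j by (intro exI[of _ w'] exI[of _ "Suc j"]) auto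
  next
    case 4
    then have "ev (desc k (Suc m)) \<otimes> s j = s (j - 1) \<otimes> ev (desc k (Suc m))"
      using j m k by (intro desc_slide) auto
    moreover have "s (j - 1) \<in> carrier G" "[(j - 1, True)] \<in> braid_words n"
      using 4 j k m gen_closed by auto
    ultimately have "ev (w @ [x]) = ev (w' @ [(j - 1, True)]) \<otimes> ev (desc k (Suc m))"
      using wx words by (simp add: m_assoc)
    moreover have "w' @ [(j - 1, True)] \<in> braid_words m" using w' 4 j k by auto
    ultimately show ?thesis using k by blast
  qed
qed

text \<open>
  This is the faithfulness of Coxeter's presentation of the symmetric group: the permutation of
  \<open>w' \<sigma>\<^sub>m \<dots> \<sigma>\<^sub>k\<close> sends \<open>k\<close> to \<open>m + 1\<close>, so it can be trivial only if \<open>k = m + 1\<close>, that is, if the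
  descending word is empty, and then one fewer strand is involved. The hypothesis \<open>sep\<close> lets the
  permutation of a word be read off its value; it holds in quotients of \<open>B\<^sub>n\<close> by pure subgroups.
\<close>

lemma (in braid_rep) pure_word_trivial_if_involutive:
  assumes sq: "\<And>i. \<lbrakk>1 \<le> i; i < n\<rbrakk> \<Longrightarrow> s i \<otimes> s i = \<one>"
    and sep: "\<And>u v. \<lbrakk>u \<in> braid_words n; v \<in> braid_words n; ev u = ev v\<rbrakk> \<Longrightarrow> word_perm u = word_perm v"
    and "m \<le> n" "w \<in> braid_words m" "word_perm w = id"
  shows "ev w = \<one>"
  using assms(3-)
proof (induction m arbitrary: w)
  case 0
  then have "w = []" by (cases w) auto
  then show ?case by simp
next
  case (Suc m)
  obtain w' k where w': "w' \<in> braid_words m" and k: "1 \<le> k" "k \<le> Suc m"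
    and w: "ev w = ev w' \<otimes> ev (desc k (Suc m))"
    using involutive_normal_form[OF sq Suc.prems(1,2)] by blast
  have words: "w \<in> braid_words n" "w' \<in> braid_words n" "desc k (Suc m) \<in> braid_words n"
    using Suc.prems w' k braid_words_mono[of "Suc m" n] braid_words_mono[of m n] by auto
  have "word_perm w = word_perm (w' @ desc k (Suc m))"
    by (rule sep) (use w words in auto)
  then have id: "word_perm w' \<circ> word_perm (desc k (Suc m)) = id"
    using Suc.prems(3) by (simp only: word_perm_append)
  then have "k = word_perm w' (word_perm (desc k (Suc m)) k)"
    by (metis comp_apply id_apply)
  also have "\<dots> = Suc m"
    using word_perm_desc[OF k(2)] word_perm_permutes[OF w'] by (auto simp: permutes_def)
  finally have "k = Suc m" .
  then have "word_perm w' = id" using id by simp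
  then have "ev w' = \<one>" using Suc.IH[OF _ w'] Suc.prems(1) by simp
  then show ?case using w \<open>k = Suc m\<close> by simp
qed


section \<open>Representations in which squares of adjacent generators commute\<close>

context group
begin

definition conj_by :: "'a \<Rightarrow> 'a \<Rightarrow> 'a"
  where "conj_by g x = g \<otimes> x \<otimes> inv g"

lemma conj_by_closed [simp]: "g \<in> carrier G \<Longrightarrow> x \<in> carrier G \<Longrightarrow> conj_by g x \<in> carrier G"
  by (simp add: conj_by_def)

lemma conj_by_mult:
  "\<lbrakk>g \<in> carrier G; h \<in> carrier G; x \<in> carrier G\<rbrakk> \<Longrightarrow> conj_by (g \<otimes> h) x = conj_by g (conj_by h x)"
  by (simp add: conj_by_def m_assoc inv_mult_group)

lemma conj_by_one [simp]: "x \<in> carrier G \<Longrightarrow> conj_by \<one> x = x"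
  by (simp add: conj_by_def)

lemma conj_by_inv_eq:
  "\<lbrakk>conj_by g x = y; g \<in> carrier G; x \<in> carrier G\<rbrakk> \<Longrightarrow> conj_by (inv g) y = x"
  by (auto simp flip: conj_by_mult)

lemma commutes_if_commutator_one:
  assumes "x \<otimes> y \<otimes> inv x \<otimes> inv y = \<one>" "x \<in> carrier G" "y \<in> carrier G"
  shows "commutes x y"
  using arg_cong[OF assms(1), of "\<lambda>t. t \<otimes> y"] assms(2,3)
  by (simp add: commutes_iff_conj m_assoc)

lemma commutes_iff_conj_by:
  "x \<in> carrier G \<Longrightarrow> y \<in> carrier G \<Longrightarrow> commutes x y \<longleftrightarrow> conj_by x y = y"
  by (simp add: commutes_iff_conj conj_by_def)

lemma commutes_conj_by:
  "\<lbrakk>commutes x g; commutes x y; x \<in> carrier G; g \<in> carrier G; y \<in> carrier G\<rbrakk> \<Longrightarrow> commutes x (conj_by g y)"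
  unfolding conj_by_def by (intro commutes_mult commutes_inv) auto

lemma conj_by_commutes:
  "\<lbrakk>commutes g h; g \<in> carrier G; h \<in> carrier G; x \<in> carrier G\<rbrakk> \<Longrightarrow>
    conj_by g (conj_by h x) = conj_by h (conj_by g x)"
  by (metis commutes_def conj_by_mult)

text \<open>
  The product of the left-hand sides of the two relations is \<open>y\<^sup>2 x\<^sup>2\<close>, and that of their right-hand
  sides is \<open>x\<^sup>2 y\<^sup>2\<close>.
\<close>

lemma pseudosymmetric_imp_squares_commute:
  assumes xy: "x \<in> carrier G" "y \<in> carrier G"
    and braid: "x \<otimes> (y \<otimes> x) = y \<otimes> (x \<otimes> y)"
    and pseudo: "x \<otimes> (inv y \<otimes> x) = y \<otimes> (inv x \<otimes> y)"
  shows "commutes (x \<otimes> x) (y \<otimes> y)"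
proof -
  have b: "x \<otimes> (y \<otimes> (x \<otimes> z)) = y \<otimes> (x \<otimes> (y \<otimes> z))" if "z \<in> carrier G" for z
    using arg_cong[OF braid, of "\<lambda>t. t \<otimes> z"] that xy by (simp add: m_assoc)
  have "(x \<otimes> (y \<otimes> x)) \<otimes> (x \<otimes> (inv y \<otimes> x)) = (y \<otimes> (x \<otimes> y)) \<otimes> (y \<otimes> (inv x \<otimes> y))"
    by (simp only: braid pseudo)
  moreover have "(x \<otimes> (y \<otimes> x)) \<otimes> (x \<otimes> (inv y \<otimes> x)) = y \<otimes> (y \<otimes> (x \<otimes> x))"
    using xy b[of "x \<otimes> (inv y \<otimes> x)"] b[of "inv y \<otimes> x"] by (simp add: m_assoc)
  moreover have "(y \<otimes> (x \<otimes> y)) \<otimes> (y \<otimes> (inv x \<otimes> y)) = x \<otimes> (x \<otimes> (y \<otimes> y))"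
    using xy b[of "y \<otimes> (inv x \<otimes> y)"] b[of "inv x \<otimes> y"] by (simp add: m_assoc flip: b)
  ultimately show ?thesis using xy by (simp add: commutes_def m_assoc)
qed

text \<open>
  By the braid relation alone \<open>y x\<^sup>2 y\<^sup>-\<^sup>1 = x\<^sup>-\<^sup>1 y\<^sup>2 x\<close>. Conjugation by \<open>x\<^sup>-\<^sup>1\<close> and by \<open>x\<close> agree on \<open>y\<^sup>2\<close>,
  because \<open>x\<^sup>2\<close> commutes with it.
\<close>

lemma braid_squares_conj:
  assumes xy: "x \<in> carrier G" "y \<in> carrier G"
    and braid: "x \<otimes> (y \<otimes> x) = y \<otimes> (x \<otimes> y)"
    and sq: "commutes (x \<otimes> x) (y \<otimes> y)"
  shows "conj_by y (x \<otimes> x) = conj_by x (y \<otimes> y)"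
proof -
  have b: "x \<otimes> (y \<otimes> (x \<otimes> z)) = y \<otimes> (x \<otimes> (y \<otimes> z))" if "z \<in> carrier G" for z
    using arg_cong[OF braid, of "\<lambda>t. t \<otimes> z"] that xy by (simp add: m_assoc)
  have c: "x \<otimes> (x \<otimes> (y \<otimes> (y \<otimes> z))) = y \<otimes> (y \<otimes> (x \<otimes> (x \<otimes> z)))" if "z \<in> carrier G" for z
    using commutes_assoc[OF sq, of z] that xy by (simp add: m_assoc)
  have "x \<otimes> (y \<otimes> (x \<otimes> x)) = y \<otimes> (y \<otimes> (x \<otimes> y))"
    using xy b[of x] braid by simp
  also have "\<dots> = x \<otimes> (x \<otimes> (y \<otimes> (y \<otimes> (inv x \<otimes> y))))"
    using xy c[of "inv x \<otimes> y"] by simp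
  finally have "y \<otimes> (x \<otimes> x) = x \<otimes> (y \<otimes> (y \<otimes> (inv x \<otimes> y)))"
    using xy by (simp add: Units_eq)
  then have "y \<otimes> (x \<otimes> x) \<otimes> inv y = x \<otimes> (y \<otimes> (y \<otimes> (inv x \<otimes> y))) \<otimes> inv y"
    by simp
  then show ?thesis using xy by (simp add: conj_by_def m_assoc)
qed

end

locale pseudosymmetric_braid_rep = braid_rep +
  assumes squares_commute: "\<lbrakk>1 \<le> i; Suc i < n\<rbrakk> \<Longrightarrow> commutes (s i \<otimes> s i) (s (Suc i) \<otimes> s (Suc i))"
begin

text \<open>
  The image of the standard generator \<open>A\<^sub>i\<^sub>j\<close> of the pure braid group, extended symmetrically to all
  pairs of distinct indices. The point of the next lemmas is that conjugation by a generator of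
  the braid group permutes these elements in the way in which its transposition permutes indices.
\<close>

definition pure_gen :: "nat \<Rightarrow> nat \<Rightarrow> 'a"
  where "pure_gen i j = conj_by (ev (desc (Suc (min i j)) (max i j))) (s (min i j) \<otimes> s (min i j))"

lemma pure_gen_sym: "pure_gen i j = pure_gen j i"
  by (simp add: pure_gen_def min.commute max.commute)

lemma pure_gen_less:
  "i < j \<Longrightarrow> pure_gen i j = conj_by (ev (desc (Suc i) j)) (s i \<otimes> s i)"
  by (simp add: pure_gen_def)

lemma pure_gen_closed_less: "\<lbrakk>1 \<le> i; i < j; j \<le> n\<rbrakk> \<Longrightarrow> pure_gen i j \<in> carrier G"
  by (simp add: pure_gen_less gen_closed)

lemma pure_gen_closed:
  assumes "i \<in> {1..n}" "j \<in> {1..n}" "i \<noteq> j"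
  shows "pure_gen i j \<in> carrier G"
  using assms pure_gen_closed_less[of i j] pure_gen_closed_less[of j i]
  by (auto simp: pure_gen_sym[of j i] neq_iff)

lemma pure_gen_adjacent: "\<lbrakk>1 \<le> i; i < n\<rbrakk> \<Longrightarrow> pure_gen i (Suc i) = s i \<otimes> s i"
  by (simp add: pure_gen_less gen_closed)

lemma pure_gen_Suc_right:
  "\<lbrakk>1 \<le> i; i < j; j < n\<rbrakk> \<Longrightarrow> pure_gen i (Suc j) = conj_by (s j) (pure_gen i j)"
  by (simp add: pure_gen_less gen_closed conj_by_mult)

lemma pure_gen_Suc_left:
  assumes "1 \<le> i" "Suc i < j" "j \<le> n"
  shows "pure_gen i j = conj_by (s i) (pure_gen (Suc i) j)"
proof -
  let ?D = "ev (desc (Suc (Suc i)) j)"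
  note [simp] = gen_closed
  have c: "commutes (s i) ?D"
    by (rule commutes_gen_desc) (use assms in auto)
  have "pure_gen i j = conj_by ?D (conj_by (s (Suc i)) (s i \<otimes> s i))"
    using assms by (simp add: pure_gen_less desc_rec_right[of "Suc i"] conj_by_mult)
  also have "conj_by (s (Suc i)) (s i \<otimes> s i) = conj_by (s i) (s (Suc i) \<otimes> s (Suc i))"
    by (rule braid_squares_conj) (use assms near squares_commute in auto)
  also have "conj_by ?D \<dots> = conj_by (s i) (conj_by ?D (s (Suc i) \<otimes> s (Suc i)))"
    using assms by (intro conj_by_commutes commutes_sym[OF c]) auto
  finally show ?thesis using assms by (simp add: pure_gen_less)
qed

lemma commutes_pure_gen:
  assumes "1 \<le> i" "i < j" "j \<le> n" "1 \<le> k" "k < n" "j < k \<or> k + 2 \<le> i"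
  shows "commutes (s k) (pure_gen i j)"
  unfolding pure_gen_less[OF assms(2)]
  by (intro commutes_conj_by commutes_gen_desc commutes_mult commutes_gen)
    (use assms in \<open>auto simp: gen_closed\<close>)

text \<open>
  The strand of \<open>\<sigma>\<^sub>j\<^sub>-\<^sub>1 \<dots> \<sigma>\<^sub>i\<^sub>+\<^sub>1\<close> turns \<open>\<sigma>\<^sub>k\<close> into \<open>\<sigma>\<^sub>k\<^sub>+\<^sub>1\<close>, which is far from \<open>\<sigma>\<^sub>i\<close>.
\<close>

lemma commutes_pure_gen_between:
  assumes "1 \<le> i" "i < k" "Suc k < j" "j \<le> n"
  shows "commutes (s k) (pure_gen i j)"
proof -
  let ?D = "ev (desc (Suc i) j)"
  note [simp] = gen_closed
  have slide: "?D \<otimes> s (Suc k) = s k \<otimes> ?D"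
    using desc_slide[of "Suc i" "Suc k" j] assms by simp
  have c: "commutes (s (Suc k)) (s i \<otimes> s i)"
    by (intro commutes_mult commutes_gen) (use assms in auto)
  have "conj_by (s k) (pure_gen i j) = conj_by (s k \<otimes> ?D) (s i \<otimes> s i)"
    using assms by (simp add: pure_gen_less conj_by_mult)
  also have "\<dots> = conj_by ?D (conj_by (s (Suc k)) (s i \<otimes> s i))"
    using assms by (simp add: conj_by_mult flip: slide)
  also have "\<dots> = pure_gen i j"
    using c assms by (simp add: commutes_iff_conj_by pure_gen_less)
  finally show ?thesis
    using assms by (simp add: commutes_iff_conj_by pure_gen_closed_less)
qed

text \<open>
  The rules above describe only conjugations that enlarge the difference of the indices. That
  squares of generators commute with \<open>A\<^sub>i\<^sub>j\<close> means that the opposite conjugations have the expected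
  effect as well.
\<close>

lemma square_commutes_pure_gen_right:
  assumes "1 \<le> i" "i < j" "j < n"
  shows "commutes (s j \<otimes> s j) (pure_gen i j)"
  using assms(1,2)
proof (induction i rule: measure_induct_rule[of "\<lambda>i. j - i"])
  case (less i)
  note [simp] = gen_closed
  show ?case
  proof (cases "j = Suc i")
    case True
    then show ?thesis
      using squares_commute[of i] less assms by (auto simp: pure_gen_adjacent intro: commutes_sym)
  next
    case False
    have "commutes (s j \<otimes> s j) (s i)"
      by (intro commutes_sym[OF commutes_mult] commutes_gen) (use assms less False in auto)
    moreover have "commutes (s j \<otimes> s j) (pure_gen (Suc i) j)"
      by (rule less.IH) (use less False in auto)
    ultimately show ?thesis
      using less assms False
      by (subst pure_gen_Suc_left) (auto intro!: commutes_conj_by pure_gen_closed_less)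
  qed
qed

lemma square_commutes_pure_gen_left:
  assumes "1 \<le> i" "Suc i < j" "j \<le> n"
  shows "commutes (s i \<otimes> s i) (pure_gen (Suc i) j)"
proof -
  note [simp] = gen_closed
  have "commutes (s i) (ev (desc (Suc (Suc i)) j))"
    by (rule commutes_gen_desc) (use assms in auto)
  then have "commutes (s i \<otimes> s i) (ev (desc (Suc (Suc i)) j))"
    using assms by (intro commutes_sym[OF commutes_mult] commutes_sym[of "s i"]) auto
  then show ?thesis
    using assms squares_commute by (simp add: pure_gen_less commutes_conj_by)
qed

lemma conj_by_pure_gen_less:
  assumes "1 \<le> i" "i < j" "j \<le> n" "1 \<le> k" "k < n"
  shows "conj_by (s k) (pure_gen i j) = pure_gen (transpose k (Suc k) i) (transpose k (Suc k) j)"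
proof -
  note [simp] = gen_closed pure_gen_closed_less
  \<comment> \<open>So \<open>y = conj_by (s k) x\<close> implies \<open>conj_by (s k) y = x\<close>, which reverses the rules above.\<close>
  have twice: "conj_by (s k) (conj_by (s k) x) = x"
    if "commutes (s k \<otimes> s k) x" "x \<in> carrier G" for x
    using that assms by (simp add: commutes_iff_conj_by conj_by_mult)
  consider "k + 2 \<le> i" | "i = Suc k" | "k = i" "j = Suc i" | "k = i" "Suc i < j"
    | "i < k" "Suc k < j" | "i < k" "j = Suc k" | "j = k" | "j < k"
    using assms by linarith
  then show ?thesis
  proof cases
    case 2
    then show ?thesis using assms pure_gen_Suc_left[of k j] by simp
  next
    case 3
    then show ?thesis
      using assms pure_gen_sym[of "Suc i" i]
      by (simp add: pure_gen_adjacent conj_by_def m_assoc)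
  next
    case 4
    then show ?thesis
      using assms pure_gen_Suc_left[of i j] square_commutes_pure_gen_left[of i j] twice by simp
  next
    case 6
    then show ?thesis
      using assms pure_gen_Suc_right[of i k] square_commutes_pure_gen_right[of i k] twice by simp
  next
    case 7
    then show ?thesis using assms pure_gen_Suc_right[of i j] by simp
  next
    case 5
    then show ?thesis
      using assms commutes_pure_gen_between[of i k j] by (simp add: commutes_iff_conj_by)
  qed (use assms commutes_pure_gen[of i j k] in \<open>simp_all add: commutes_iff_conj_by\<close>)
qed

lemma conj_by_pure_gen:
  assumes "i \<in> {1..n}" "j \<in> {1..n}" "i \<noteq> j" "1 \<le> k" "k < n"
  shows "conj_by (s k) (pure_gen i j) = pure_gen (transpose k (Suc k) i) (transpose k (Suc k) j)"
  using assms conj_by_pure_gen_less[of i j k] conj_by_pure_gen_less[of j i k]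
    pure_gen_sym[of i j] pure_gen_sym[of "transpose k (Suc k) i"]
  by (cases "i < j") auto

lemma conj_by_ev_pure_gen:
  assumes "w \<in> braid_words n" "i \<in> {1..n}" "j \<in> {1..n}" "i \<noteq> j"
  shows "conj_by (ev w) (pure_gen i j) = pure_gen (word_perm w i) (word_perm w j)"
  using assms(1)
proof (induction w)
  case Nil
  then show ?case using assms by (simp add: pure_gen_closed)
next
  case (Cons x w)
  define k where "k = fst x"
  have k: "1 \<le> k" "k < n" and w: "w \<in> braid_words n" using Cons.prems by (auto simp: k_def)
  note p = word_perm_permutes[OF w]
  have ij: "word_perm w i \<in> {1..n}" "word_perm w j \<in> {1..n}" "word_perm w i \<noteq> word_perm w j"
    using assms permutes_in_image[OF p] inj_eq[OF permutes_inj[OF p]] by (simp_all del: One_nat_def)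
  define t where "t = transpose k (Suc k)"
  have tt: "t permutes {1..n}" unfolding t_def using k by (intro permutes_swap_id) auto
  have t: "t (word_perm w i) \<in> {1..n}" "t (word_perm w j) \<in> {1..n}" "t (word_perm w i) \<noteq> t (word_perm w j)"
    using ij permutes_in_image[OF tt] inj_eq[OF permutes_inj[OF tt]] by (simp_all del: One_nat_def)
  have tid: "t (t a) = a" for a by (simp add: t_def)
  have c1: "conj_by (s k) (pure_gen (word_perm w i) (word_perm w j)) = pure_gen (t (word_perm w i)) (t (word_perm w j))"
    unfolding t_def by (rule conj_by_pure_gen[OF ij k])
  have c2: "conj_by (s k) (pure_gen (t (word_perm w i)) (t (word_perm w j))) = pure_gen (word_perm w i) (word_perm w j)"
    using conj_by_pure_gen[OF t k] tid by (simp flip: t_def)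
  have c3: "conj_by (inv s k) (pure_gen (word_perm w i) (word_perm w j)) = pure_gen (t (word_perm w i)) (t (word_perm w j))"
    by (rule conj_by_inv_eq[OF c2]) (use k t pure_gen_closed gen_closed in auto)
  have "conj_by (if snd x then s k else inv s k) (conj_by (ev w) (pure_gen i j))
      = pure_gen (t (word_perm w i)) (t (word_perm w j))"
    using Cons.IH[OF w] c1 c3 by simp
  then show ?case
    using w assms k
    by (cases "snd x") (simp_all add: conj_by_mult gen_closed pure_gen_closed flip: k_def t_def)
qed

text \<open>
  A pure braid permutes no indices, so it commutes with all squares of generators. The pure braids
  that commute with all other pure braids thus form a normal subgroup containing these squares;
  modulo this subgroup generators are involutions, and so every pure braid belongs to it.
\<close>

theorem pure_words_commute:
  assumes "p \<in> braid_words n" "word_perm p = id" "q \<in> braid_words n" "word_perm q = id"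
  shows "commutes (ev p) (ev q)"
proof -
  interpret h: group_hom "braid_group n" G rep_hom by (rule group_hom_rep_hom)
  interpret P: normal "pure_braids n" "braid_group n" by (rule normal_pure_braids)
  define N where "N = {b \<in> pure_braids n. \<forall>c \<in> pure_braids n. commutes (rep_hom b) (rep_hom c)}"
  have N_sub: "N \<subseteq> pure_braids n" by (auto simp: N_def)
  have "subgroup N (braid_group n)"
  proof
    fix x y assume "x \<in> N" "y \<in> N"
    then show "x \<otimes>\<^bsub>braid_group n\<^esub> y \<in> N"
      by (auto simp: N_def intro!: commutes_sym[OF commutes_mult] dest: commutes_sym)
  next
    fix x assume "x \<in> N"
    then show "inv\<^bsub>braid_group n\<^esub> x \<in> N"
      by (auto simp: N_def intro!: commutes_sym[OF commutes_inv] dest: commutes_sym)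
  qed (auto simp: N_def)
  moreover have "g \<otimes>\<^bsub>braid_group n\<^esub> b \<otimes>\<^bsub>braid_group n\<^esub> inv\<^bsub>braid_group n\<^esub> g \<in> N"
    if "g \<in> carrier (braid_group n)" "b \<in> N" for g b
  proof -
    have b: "b \<in> pure_braids n" "b \<in> carrier (braid_group n)" using that by (auto simp: N_def)
    have "commutes (conj_by (rep_hom g) (rep_hom b)) (rep_hom c)" if c: "c \<in> pure_braids n" for c
    proof -
      have c': "c \<in> carrier (braid_group n)" using c by auto
      let ?d = "inv\<^bsub>braid_group n\<^esub> g \<otimes>\<^bsub>braid_group n\<^esub> c \<otimes>\<^bsub>braid_group n\<^esub> g"
      have "?d \<in> pure_braids n"
        using P.inv_op_closed1[of g c] c \<open>g \<in> _\<close> by simp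
      then have "conj_by (rep_hom b) (rep_hom ?d) = rep_hom ?d"
        using \<open>b \<in> N\<close> b by (auto simp: N_def commutes_iff_conj_by)
      then have "conj_by (rep_hom g) (conj_by (rep_hom b) (rep_hom ?d)) = conj_by (rep_hom g) (rep_hom ?d)"
        by simp
      then have "conj_by (conj_by (rep_hom g) (rep_hom b)) (rep_hom c) = rep_hom c"
        using c' b \<open>g \<in> _\<close> by (simp add: conj_by_def m_assoc inv_mult_group)
      then show ?thesis using c' b \<open>g \<in> _\<close> by (simp add: commutes_iff_conj_by)
    qed
    then show ?thesis
      using that b P.inv_op_closed2[of g b] by (simp add: N_def conj_by_def)
  qed
  ultimately have N: "N \<lhd> braid_group n"
    by (simp add: braid.normal_inv_iff)
  let ?Q = "braid_group n Mod N" and ?t = "\<lambda>i. N #>\<^bsub>braid_group n\<^esub> braid_class n [(i, True)]"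
  have hom: "group_hom (braid_group n) ?Q (\<lambda>b. N #>\<^bsub>braid_group n\<^esub> b)"
    using normal.r_coset_hom_Mod[OF N] normal.factorgroup_is_group[OF N]
    by (simp add: group_hom_def group_hom_axioms_def group_braid_group)
  interpret Q: braid_rep ?Q n ?t
    by (rule braid_rep_of_hom(1)[OF hom])
  have Q_ev: "Q.ev w = N #>\<^bsub>braid_group n\<^esub> braid_class n w" if "w \<in> braid_words n" for w
    using that by (rule braid_rep_of_hom(2)[OF hom])
  have Q_trivial: "Q.ev w = \<one>\<^bsub>?Q\<^esub> \<longleftrightarrow> braid_class n w \<in> N" if "w \<in> braid_words n" for w
    using that Q_ev braid.coset_join1[of n N "braid_class n w"] braid.coset_join2[of "braid_class n w" n N]
      normal_imp_subgroup[OF N] by auto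
  have "Q.ev p = \<one>\<^bsub>?Q\<^esub>"
  proof (rule Q.pure_word_trivial_if_involutive[where m = n])
    fix i assume i: "1 \<le> i" "i < n"
    have "commutes (s i \<otimes> s i) (ev w)" if "w \<in> braid_words n" "word_perm w = id" for w
      using conj_by_ev_pure_gen[of w i "Suc i"] that i
      by (intro commutes_sym[of "ev w"]) (simp add: pure_gen_adjacent commutes_iff_conj_by gen_closed)
    moreover have "[(i, True), (i, True)] \<in> braid_words n" "word_perm [(i, True), (i, True)] = id"
      using i by auto
    ultimately have "braid_class n [(i, True), (i, True)] \<in> N"
      using i unfolding N_def pure_braids_eq by (auto simp: gen_closed)
    then have "Q.ev [(i, True), (i, True)] = \<one>\<^bsub>?Q\<^esub>"
      using i Q_trivial[of "[(i, True), (i, True)]"] by (simp del: weval_simps)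
    then show "?t i \<otimes>\<^bsub>?Q\<^esub> ?t i = \<one>\<^bsub>?Q\<^esub>"
      using i Q.gen_closed[of i] by (simp del: one_FactGroup mult_FactGroup)
  next
    fix u v assume uv: "u \<in> braid_words n" "v \<in> braid_words n" and eq: "Q.ev u = Q.ev v"
    then have "braid_class n u \<in> N #>\<^bsub>braid_group n\<^esub> braid_class n v"
      using Q_ev braid.rcos_self[of "braid_class n u" n N] normal_imp_subgroup[OF N] by simp
    then obtain d where d: "d \<in> N" "braid_class n u = d \<otimes>\<^bsub>braid_group n\<^esub> braid_class n v"
      by (auto simp: r_coset_def)
    then obtain x where x: "x \<in> braid_words n" "word_perm x = id" "d = braid_class n x"
      using N_sub by (auto simp: pure_braids_eq)
    then have "word_perm u = word_perm (x @ v)"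
      using d uv by (simp add: mult_braid_class braid_class_eq_iff braid_equiv_word_perm)
    then show "word_perm u = word_perm v" using x by (simp add: word_perm_append)
  qed (use assms in auto)
  then have "braid_class n p \<in> N" using Q_trivial assms by simp
  moreover have "braid_class n q \<in> pure_braids n" using assms by (auto simp: pure_braids_eq)
  ultimately show ?thesis using assms by (auto simp: N_def)
qed

corollary ev_eq_if_PS_class_eq:
  "\<lbrakk>PS_class n u = PS_class n v; u \<in> braid_words n; v \<in> braid_words n\<rbrakk> \<Longrightarrow> ev u = ev v"
  using PS_class_eq_imp_ev_eq pure_words_commute by blast

end


section \<open>The braiding words\<close>

lemma weval_shift_word: "weval G s (shift_word m w) = weval G (\<lambda>i. s (m + i)) w"
  by (induction w) auto

lemma (in group) weval_intertwine:
  assumes "c \<in> carrier G"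
    and "\<And>i. \<lbrakk>1 \<le> i; i < m\<rbrakk> \<Longrightarrow> s i \<in> carrier G \<and> t i \<in> carrier G \<and> c \<otimes> s i = t i \<otimes> c"
    and "w \<in> braid_words m"
  shows "weval G s w \<in> carrier G \<and> weval G t w \<in> carrier G \<and> c \<otimes> weval G s w = weval G t w \<otimes> c"
  using assms(3)
proof (induction w)
  case Nil
  then show ?case using assms(1) by simp
next
  case (Cons x w)
  define y z where "y = (if snd x then s (fst x) else inv (s (fst x)))"
    and "z = (if snd x then t (fst x) else inv (t (fst x)))"
  have x: "s (fst x) \<in> carrier G" "t (fst x) \<in> carrier G" "c \<otimes> s (fst x) = t (fst x) \<otimes> c"
    using assms(2)[of "fst x"] Cons.prems by auto
  have "t (fst x) \<otimes> (c \<otimes> inv s (fst x)) = t (fst x) \<otimes> (inv t (fst x) \<otimes> c)"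
    using x assms(1) by (simp flip: m_assoc x(3)) (simp add: m_assoc)
  then have "c \<otimes> inv s (fst x) = inv t (fst x) \<otimes> c"
    using Units_l_cancel[of "t (fst x)" "c \<otimes> inv s (fst x)" "inv t (fst x) \<otimes> c"] x assms(1)
    by (simp add: Units_eq)
  then have yz: "y \<in> carrier G" "z \<in> carrier G" "c \<otimes> y = z \<otimes> c"
    using x by (auto simp: y_def z_def)
  have IH: "weval G s w \<in> carrier G" "weval G t w \<in> carrier G" "c \<otimes> weval G s w = weval G t w \<otimes> c"
    using Cons by auto
  have "c \<otimes> (y \<otimes> weval G s w) = z \<otimes> (c \<otimes> weval G s w)"
    using yz IH(1) assms(1) by (simp flip: m_assoc)
  also have "\<dots> = z \<otimes> weval G t w \<otimes> c"
    using yz IH assms(1) by (simp add: m_assoc)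
  finally show ?case using yz IH by (simp add: y_def z_def)
qed

context braid_rep
begin

lemma shift: "m + k \<le> n \<Longrightarrow> braid_rep G k (\<lambda>i. s (m + i))"
proof
  fix i assume "m + k \<le> n" "1 \<le> i" "Suc i < k"
  then show "s (m + i) \<otimes> (s (m + Suc i) \<otimes> s (m + i)) = s (m + Suc i) \<otimes> (s (m + i) \<otimes> s (m + Suc i))"
    using near[of "m + i"] by simp
qed (auto intro: far gen_closed)

lemma commutes_ev_ev:
  assumes "u \<in> braid_words n" "v \<in> braid_words n"
    and "\<And>i j. \<lbrakk>i \<in> fst ` set u; j \<in> fst ` set v\<rbrakk> \<Longrightarrow> i + 2 \<le> j \<or> j + 2 \<le> i"
  shows "commutes (ev u) (ev v)"
proof (rule commutes_gen_ev)
  fix j assume j: "j \<in> fst ` set v"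
  then have jn: "1 \<le> j" "j < n" using assms(2) by (auto simp: braid_words_def)
  show "commutes (ev u) (s j)"
  proof (intro commutes_sym[of "s j"] commutes_gen_ev commutes_gen)
    fix i assume i: "i \<in> fst ` set u"
    then show "1 \<le> i" "i < n" using assms(1) by (auto simp: braid_words_def)
    show "j + 2 \<le> i \<or> i + 2 \<le> j" using assms(3)[OF i j] by auto
  qed (use jn assms in \<open>auto simp: gen_closed\<close>)
qed (use assms in auto)

lemma commutes_juxtaposed:
  assumes "u \<in> braid_words m" "v \<in> braid_words k" "m + k \<le> n"
  shows "commutes (ev u) (ev (shift_word m v))"
proof (rule commutes_ev_ev)
  fix i j assume "i \<in> fst ` set u" "j \<in> fst ` set (shift_word m v)"
  then have "i < m" "Suc m \<le> j"
    using assms by (auto simp: braid_words_def shift_word_def)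
  then show "i + 2 \<le> j \<or> j + 2 \<le> i" by auto
qed (use assms braid_words_mono[of "m + k" n] braid_words_mono[of m n] in auto)

lemma braiding_word_in_n: "m + k \<le> n \<Longrightarrow> braiding_word m k \<in> braid_words n"
  using braid_words_mono[of "m + k" n] by simp

lemma ev_braiding_word_Suc:
  "Suc m + k \<le> n \<Longrightarrow>
    ev (braiding_word (Suc m) k) = ev (braiding_word m k) \<otimes> ev (desc (Suc m) (k + Suc m))"
  by (simp add: braiding_word_Suc braiding_word_in_n)

text \<open>
  The braiding \<open>c\<^sub>m\<^sub>,\<^sub>k\<close> passes two groups of \<open>m\<close> and \<open>k\<close> parallel strands across each other, so a crossing
  within either group can be slid through it. Splitting off the last block of the braiding word reduces
  this to the two slides of single strands.
\<close>

lemma braiding_slide_right: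
  assumes "1 \<le> j" "j < k" "m + k \<le> n"
  shows "ev (braiding_word m k) \<otimes> s (m + j) = s j \<otimes> ev (braiding_word m k)"
  using assms(3)
proof (induction m)
  case 0
  then show ?case using assms by (simp add: gen_closed)
next
  case (Suc m)
  note [simp] = gen_closed m_assoc braiding_word_in_n ev_braiding_word_Suc
  have "ev (desc (Suc m) (k + Suc m)) \<otimes> s (Suc m + j) = s (m + j) \<otimes> ev (desc (Suc m) (k + Suc m))"
    using desc_slide[of "Suc m" "Suc m + j" "k + Suc m"] assms Suc.prems by simp
  then have "ev (braiding_word (Suc m) k) \<otimes> s (Suc m + j)
      = (ev (braiding_word m k) \<otimes> s (m + j)) \<otimes> ev (desc (Suc m) (k + Suc m))"
    using assms Suc.prems by (simp del: desc_simps)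
  then show ?case
    using assms Suc by (simp del: desc_simps)
qed

lemma braiding_slide_left:
  assumes "1 \<le> i" "i < m" "m + k \<le> n"
  shows "ev (braiding_word m k) \<otimes> s i = s (k + i) \<otimes> ev (braiding_word m k)"
  using assms(2,3)
proof (induction m)
  case 0
  then show ?case by simp
next
  case (Suc m)
  note [simp] = gen_closed m_assoc braiding_word_in_n ev_braiding_word_Suc
  show ?case
  proof (cases "i = m")
    case False
    have "commutes (s i) (ev (desc (Suc m) (k + Suc m)))"
      by (rule commutes_gen_desc) (use assms Suc.prems False in auto)
    then have "ev (braiding_word (Suc m) k) \<otimes> s i
        = (ev (braiding_word m k) \<otimes> s i) \<otimes> ev (desc (Suc m) (k + Suc m))"
      using assms Suc.prems False by (simp add: commutes_def del: desc_simps)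
    then show ?thesis
      using assms Suc False by (simp del: desc_simps)
  next
    case True
    then obtain l where l: "m = Suc l" using assms by (cases m) auto
    have c: "commutes (s (k + m)) (ev (braiding_word l k))"
    proof (rule commutes_gen_ev)
      fix j assume "j \<in> fst ` set (braiding_word l k)"
      then have "1 \<le> j" "j < l + k"
        using braiding_word_in[of l k] by (auto simp: braid_words_def simp del: braiding_word_in)
      then show "commutes (s (k + m)) (s j)"
        using Suc.prems l by (intro commutes_gen) auto
    qed (use Suc.prems l in auto)
    have "ev (desc m (k + m)) \<otimes> (ev (desc (Suc m) (Suc (k + m))) \<otimes> s m)
        = s (k + m) \<otimes> (ev (desc m (k + m)) \<otimes> ev (desc (Suc m) (Suc (k + m))))"
      by (rule desc_desc_slide) (use assms Suc.prems True in auto)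
    moreover have "ev (braiding_word (Suc m) k)
        = ev (braiding_word l k) \<otimes> (ev (desc m (k + m)) \<otimes> ev (desc (Suc m) (Suc (k + m))))"
      using Suc.prems l by (simp del: desc_simps)
    ultimately show ?thesis
      using Suc.prems l True assms
        commutes_assoc[OF c, of "ev (desc m (k + m)) \<otimes> ev (desc (Suc m) (Suc (k + m)))"]
      by (simp del: desc_simps)
  qed
qed

lemma braiding_natural:
  assumes "u \<in> braid_words m" "v \<in> braid_words k" "m + k \<le> n"
  shows "ev (braiding_word m k) \<otimes> (ev u \<otimes> ev (shift_word m v))
    = ev v \<otimes> (ev (shift_word k u) \<otimes> ev (braiding_word m k))"
proof -
  let ?c = "ev (braiding_word m k)"
  have c: "?c \<in> carrier G" using assms by (simp add: braiding_word_in_n)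
  have u: "ev u \<in> carrier G" "ev (shift_word k u) \<in> carrier G" "?c \<otimes> ev u = ev (shift_word k u) \<otimes> ?c"
    using weval_intertwine[OF c _ assms(1), of s "\<lambda>i. s (k + i)"] braiding_slide_left[of _ m k] assms(3)
    by (auto simp: weval_shift_word gen_closed)
  have v: "ev v \<in> carrier G" "ev (shift_word m v) \<in> carrier G" "?c \<otimes> ev (shift_word m v) = ev v \<otimes> ?c"
    using weval_intertwine[OF c _ assms(2), of "\<lambda>i. s (m + i)" s] braiding_slide_right[of _ k m] assms(3)
    by (auto simp: weval_shift_word gen_closed)
  have uv: "ev (shift_word k u) \<otimes> ev v = ev v \<otimes> ev (shift_word k u)"
    using commutes_juxtaposed[OF assms(2,1)] assms(3) by (simp add: commutes_def add.commute)
  have "?c \<otimes> (ev u \<otimes> ev (shift_word m v)) = (?c \<otimes> ev u) \<otimes> ev (shift_word m v)"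
    by (rule m_assoc[OF c u(1) v(2), symmetric])
  also have "\<dots> = ev (shift_word k u) \<otimes> (?c \<otimes> ev (shift_word m v))"
    by (simp only: u(3) m_assoc[OF u(2) c v(2)])
  also have "\<dots> = (ev (shift_word k u) \<otimes> ev v) \<otimes> ?c"
    by (simp only: v(3) m_assoc[OF u(2) v(1) c])
  also have "\<dots> = ev v \<otimes> (ev (shift_word k u) \<otimes> ?c)"
    by (simp only: uv m_assoc[OF v(1) u(2) c])
  finally show ?thesis .
qed

text \<open>
  Each block of the word for \<open>c\<^sub>m\<^sub>,\<^sub>a\<^sub>+\<^sub>k\<close> is a block for \<open>c\<^sub>m\<^sub>,\<^sub>k\<close>, shifted by \<open>a\<close>, followed by one for
  \<open>c\<^sub>m\<^sub>,\<^sub>a\<close>. The blocks of the second kind are far from the later blocks of the first kind, so all of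
  the former can be collected at the end.
\<close>

lemma braiding_hexagon:
  assumes "m + (a + k) \<le> n"
  shows "ev (braiding_word m (a + k)) = ev (shift_word a (braiding_word m k)) \<otimes> ev (braiding_word m a)"
  using assms
proof (induction m)
  case (Suc m)
  note [simp] = m_assoc braiding_word_in_n ev_braiding_word_Suc
  have s: "shift_word a (braiding_word m k) \<in> braid_words n"
    using shift_word_in[OF braiding_word_in, of a m k] braid_words_mono[of "a + (m + k)" n] Suc.prems
    by simp
  have c: "commutes (ev (braiding_word m a)) (ev (desc (a + Suc m) (a + k + Suc m)))"
  proof (rule commutes_ev_ev)
    fix i j assume "i \<in> fst ` set (braiding_word m a)" "j \<in> fst ` set (desc (a + Suc m) (a + k + Suc m))"
    then have "i < m + a" "a + Suc m \<le> j"
      using braiding_word_in[of m a]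
      by (auto simp: braid_words_def desc_def simp del: braiding_word_in)
    then show "i + 2 \<le> j \<or> j + 2 \<le> i" by auto
  qed (use Suc.prems in auto)
  have "desc (Suc m) (a + k + Suc m) = desc (a + Suc m) (a + k + Suc m) @ desc (Suc m) (a + Suc m)"
    by (rule desc_append) auto
  then have "ev (desc (Suc m) (a + k + Suc m))
      = ev (desc (a + Suc m) (a + k + Suc m)) \<otimes> ev (desc (Suc m) (a + Suc m))"
    using Suc.prems by (simp del: desc_simps)
  moreover have "shift_word a (braiding_word (Suc m) k)
      = shift_word a (braiding_word m k) @ desc (a + Suc m) (a + k + Suc m)"
    by (simp add: braiding_word_Suc shift_word_desc add.assoc del: desc_simps)
  ultimately show ?case
    using Suc s commutes_assoc[OF c, of "ev (desc (Suc m) (a + Suc m))"]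
    by (simp del: desc_simps)
qed simp

end


section \<open>The braided category \<open>PS\<close>\<close>

lemma braid_rep_braid_group: "braid_rep (braid_group n) n (\<lambda>i. braid_class n [(i, True)])"
  and weval_braid_group:
    "w \<in> braid_words n \<Longrightarrow> weval (braid_group n) (\<lambda>i. braid_class n [(i, True)]) w = braid_class n w"
proof -
  have "group_hom (braid_group n) (braid_group n) (\<lambda>b. b)"
    by unfold_locales (simp add: hom_def)
  from braid_rep_of_hom[OF this]
  show "braid_rep (braid_group n) n (\<lambda>i. braid_class n [(i, True)])"
    "w \<in> braid_words n \<Longrightarrow> weval (braid_group n) (\<lambda>i. braid_class n [(i, True)]) w = braid_class n w"
    by auto
qed

lemma braid_tensor_class:
  assumes "u \<in> braid_words m" "v \<in> braid_words n"
  shows "braid_tensor m n (braid_class m u) (braid_class n v) = braid_class (m + n) (juxtapose m u v)"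
proof -
  interpret B: braid_rep "braid_group (m + n)" "m + n" "\<lambda>i. braid_class (m + n) [(i, True)]"
    by (rule braid_rep_braid_group)
  interpret Bm: braid_rep "braid_group (m + n)" m "\<lambda>i. braid_class (m + n) [(i, True)]"
    by (rule B.mono) simp
  interpret Bn: braid_rep "braid_group (m + n)" n "\<lambda>i. braid_class (m + n) [(m + i, True)]"
    by (rule B.shift) simp
  have mono: "w \<in> braid_words (m + n)" if "w \<in> braid_words m" for w
    using that braid_words_mono[of m "m + n"] by simp
  have "braid_class (m + n) (juxtapose m u' v') = braid_class (m + n) (juxtapose m u v)"
    if "u' \<in> braid_class m u" "v' \<in> braid_class n v" for u' v'
  proof -
    have eq: "braid_equiv m u u'" "braid_equiv n v v'" using that by (auto simp: braid_class_def)
    then have in_words: "u' \<in> braid_words m" "v' \<in> braid_words n" using braid_equiv_in by blast+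
    have "Bm.ev u = Bm.ev u'" "Bn.ev v = Bn.ev v'"
      using Bm.ev_braid_equiv[OF eq(1)] Bn.ev_braid_equiv[OF eq(2)] by blast+
    then have "braid_class (m + n) u = braid_class (m + n) u'"
      using assms in_words by (simp add: weval_braid_group mono)
    moreover have "braid_class (m + n) (shift_word m v) = braid_class (m + n) (shift_word m v')"
      using \<open>Bn.ev v = Bn.ev v'\<close> assms in_words
      by (simp add: weval_braid_group flip: weval_shift_word[of _ "\<lambda>i. braid_class (m + n) [(i, True)]"])
    ultimately show ?thesis
      using assms in_words by (simp add: juxtapose_eq mono flip: mult_braid_class)
  qed
  then have "{braid_class (m + n) (juxtapose m u' v') |u' v'. u' \<in> braid_class m u \<and> v' \<in> braid_class n v}
      = {braid_class (m + n) (juxtapose m u v)}"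
    using braid_class_self[OF assms(1)] braid_class_self[OF assms(2)] by blast
  then show ?thesis by (simp add: braid_tensor_def)
qed

lemma word_perm_shift_word:
  "word_perm (shift_word m w) x = (if x < m then x else m + word_perm w (x - m))"
proof (induction w)
  case (Cons a w)
  then show ?case by (auto simp: transpose_def)
qed simp

lemma PS_class_pure_commute:
  assumes "p \<in> braid_words n" "word_perm p = id" "q \<in> braid_words n" "word_perm q = id"
  shows "group.commutes (PS_group n) (PS_class n p) (PS_class n q)"
proof -
  interpret h: group_hom "braid_group n" "PS_group n" "PS_proj n" by (rule group_hom_PS_proj)
  let ?a = "braid_class n p" and ?b = "braid_class n q" and ?D = "derived (braid_group n) (pure_braids n)"
  let ?c = "?a \<otimes>\<^bsub>braid_group n\<^esub> ?b \<otimes>\<^bsub>braid_group n\<^esub> inv\<^bsub>braid_group n\<^esub> ?a \<otimes>\<^bsub>braid_group n\<^esub> inv\<^bsub>braid_group n\<^esub> ?b"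
  have "?c \<in> ?D"
    unfolding derived_def by (rule generate.incl) (use assms in \<open>auto simp: pure_braids_eq\<close>)
  then have "PS_proj n ?c = ?D"
    unfolding PS_proj_def using normal_imp_subgroup[OF normal_derived_pure_braids[of n]] assms
    by (intro braid.coset_join2) auto
  then have "PS_proj n ?c = \<one>\<^bsub>PS_group n\<^esub>" by (simp add: PS_group_def)
  then have "PS_class n p \<otimes>\<^bsub>PS_group n\<^esub> PS_class n q \<otimes>\<^bsub>PS_group n\<^esub> inv\<^bsub>PS_group n\<^esub> PS_class n p
      \<otimes>\<^bsub>PS_group n\<^esub> inv\<^bsub>PS_group n\<^esub> PS_class n q = \<one>\<^bsub>PS_group n\<^esub>"
    using assms by (simp add: PS_class_def)
  then show ?thesis
    using assms by (intro PSG.commutes_if_commutator_one) auto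
qed

text \<open>
  Both inclusions, of \<open>B\<^sub>m\<close> and of \<open>B\<^sub>n\<close> into \<open>B\<^sub>m\<^sub>+\<^sub>n\<close>, take pure braids to pure braids, whose classes
  commute. This is what makes the tensor product of \<open>PS\<close> independent of representatives.
\<close>

lemma PS_class_mono:
  assumes "PS_class m u = PS_class m u'" "u \<in> braid_words m" "u' \<in> braid_words m" "m \<le> n"
  shows "PS_class n u = PS_class n u'"
proof -
  interpret B: braid_rep "PS_group n" n "\<lambda>i. PS_class n [(i, True)]"
    by (rule braid_rep_PS)
  interpret Bm: braid_rep "PS_group n" m "\<lambda>i. PS_class n [(i, True)]"
    by (rule B.mono) fact
  have words: "w \<in> braid_words n" if "w \<in> braid_words m" for w
    using that assms(4) braid_words_mono by blast
  have "Bm.ev u = Bm.ev u'"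
    by (rule Bm.PS_class_eq_imp_ev_eq[OF _ assms(1)])
      (use assms words in \<open>auto simp: weval_PS intro: PS_class_pure_commute\<close>)
  then show ?thesis using assms words by (simp add: weval_PS)
qed

lemma PS_class_shift:
  assumes "PS_class n v = PS_class n v'" "v \<in> braid_words n" "v' \<in> braid_words n"
  shows "PS_class (m + n) (shift_word m v) = PS_class (m + n) (shift_word m v')"
proof -
  interpret B: braid_rep "PS_group (m + n)" "m + n" "\<lambda>i. PS_class (m + n) [(i, True)]"
    by (rule braid_rep_PS)
  interpret Bn: braid_rep "PS_group (m + n)" n "\<lambda>i. PS_class (m + n) [(m + i, True)]"
    by (rule B.shift) simp
  have ev: "Bn.ev w = PS_class (m + n) (shift_word m w)" if "w \<in> braid_words n" for w
    using that by (simp add: weval_PS flip: weval_shift_word[of _ "\<lambda>i. PS_class (m + n) [(i, True)]"])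
  have perm: "word_perm (shift_word m w) = id" if "word_perm w = id" for w
    using that by (simp add: fun_eq_iff word_perm_shift_word)
  have "Bn.ev v = Bn.ev v'"
    by (rule Bn.PS_class_eq_imp_ev_eq[OF _ assms(1)])
      (use assms perm in \<open>auto simp: ev intro: PS_class_pure_commute\<close>)
  then show ?thesis using assms by (simp add: ev)
qed

lemma PS_class_mem:
  assumes "w \<in> braid_words n"
  shows "braid_class n w \<in> PS_class n w"
    and "b \<in> PS_class n w \<Longrightarrow> \<exists>w' \<in> braid_words n. b = braid_class n w' \<and> PS_class n w' = PS_class n w"
proof -
  let ?D = "derived (braid_group n) (pure_braids n)"
  have D: "subgroup ?D (braid_group n)"
    by (rule normal_imp_subgroup[OF normal_derived_pure_braids])
  show "braid_class n w \<in> PS_class n w"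
    unfolding PS_class_def PS_proj_def using D assms by (intro braid.rcos_self) auto
  assume b: "b \<in> PS_class n w"
  then have "?D #>\<^bsub>braid_group n\<^esub> braid_class n w = ?D #>\<^bsub>braid_group n\<^esub> b"
    unfolding PS_class_def PS_proj_def using D assms by (intro braid.repr_independence) auto
  moreover have "b \<in> carrier (braid_group n)"
    using b D assms by (auto simp: PS_class_def PS_proj_def r_coset_def dest: subgroup.mem_carrier)
  ultimately show "\<exists>w' \<in> braid_words n. b = braid_class n w' \<and> PS_class n w' = PS_class n w"
    by (auto simp: carrier_braid_group PS_class_def PS_proj_def)
qed

lemma PS_tensor_class:
  assumes "u \<in> braid_words m" "v \<in> braid_words n"
  shows "PS_tensor m n (PS_class m u) (PS_class n v) = PS_class (m + n) (u @ shift_word m v)"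
proof -
  have mono: "w \<in> braid_words (m + n)" if "w \<in> braid_words m" for w
    using that braid_words_mono[of m "m + n"] by simp
  have "PS_proj (m + n) (braid_tensor m n b b') = PS_class (m + n) (u @ shift_word m v)"
    if b: "b \<in> PS_class m u" "b' \<in> PS_class n v" for b b'
  proof -
    obtain u' where u': "u' \<in> braid_words m" "b = braid_class m u'" "PS_class m u' = PS_class m u"
      using PS_class_mem(2)[OF assms(1) b(1)] by blast
    obtain v' where v': "v' \<in> braid_words n" "b' = braid_class n v'" "PS_class n v' = PS_class n v"
      using PS_class_mem(2)[OF assms(2) b(2)] by blast
    have "PS_class (m + n) u' = PS_class (m + n) u"
      "PS_class (m + n) (shift_word m v') = PS_class (m + n) (shift_word m v)"
      using PS_class_mono[OF u'(3,1) assms(1), of "m + n"] PS_class_shift[OF v'(3,1) assms(2)]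
      by auto
    then have "PS_class (m + n) (u' @ shift_word m v') = PS_class (m + n) (u @ shift_word m v)"
      using u' v' assms by (simp add: mono flip: mult_PS_class)
    then show ?thesis
      using u' v' by (simp add: braid_tensor_class juxtapose_eq PS_class_def)
  qed
  then have "{PS_proj (m + n) (braid_tensor m n b b') |b b'. b \<in> PS_class m u \<and> b' \<in> PS_class n v}
      = {PS_class (m + n) (u @ shift_word m v)}"
    using PS_class_mem(1)[OF assms(1)] PS_class_mem(1)[OF assms(2)] by blast
  then show ?thesis by (simp add: PS_tensor_def)
qed

definition PS_arrow :: "nat \<Rightarrow> braid_word \<Rightarrow> nat \<times> braid_word set set"
  where "PS_arrow n w = (n, PS_class n w)"

lemma PS_simps [simp]:
  "Obj PS = UNIV" "Unit PS = 0" "m \<boxdot>\<^bsub>PS\<^esub> n = m + n"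
  "Ident PS n = PS_arrow n []"
  "assoc PS k m n = PS_arrow (k + m + n) []" "lunit PS n = PS_arrow n []" "runit PS n = PS_arrow n []"
  "braid PS m n = PS_arrow (m + n) (braiding_word m n)"
  "Dom PS (PS_arrow n w) = n" "Cod PS (PS_arrow n w) = n"
  by (auto simp: PS_def PS_arrow_def one_PS_group PS_class_def)

lemma PS_arrow_Arr [simp]: "w \<in> braid_words n \<Longrightarrow> PS_arrow n w \<in> Arr PS"
  by (simp add: PS_def PS_arrow_def)

lemma PS_Comp [simp]:
  "\<lbrakk>u \<in> braid_words n; v \<in> braid_words n\<rbrakk> \<Longrightarrow> PS_arrow n u \<cdot>\<^bsub>PS\<^esub> PS_arrow n v = PS_arrow n (u @ v)"
  by (simp add: PS_def PS_arrow_def)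

lemma PS_tens [simp]:
  "\<lbrakk>u \<in> braid_words m; v \<in> braid_words n\<rbrakk> \<Longrightarrow>
    PS_arrow m u \<boxtimes>\<^bsub>PS\<^esub> PS_arrow n v = PS_arrow (m + n) (u @ shift_word m v)"
  by (simp add: PS_def PS_arrow_def PS_tensor_class)

lemma PS_Arr_cases:
  assumes "f \<in> Arr PS"
  obtains n w where "w \<in> braid_words n" "f = PS_arrow n w"
  using assms by (auto simp: PS_def carrier_PS_group PS_arrow_def)

lemma PS_Hom_cases:
  assumes "f \<in> Hom PS m n"
  obtains w where "w \<in> braid_words n" "f = PS_arrow n w" "m = n"
  using assms by (auto simp: Hom_iff elim!: PS_Arr_cases)

lemma PS_arrow_eq_iff: "PS_arrow m u = PS_arrow n v \<longleftrightarrow> m = n \<and> PS_class n u = PS_class n v"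
  by (auto simp: PS_arrow_def)

lemma PS_Hom_arrow [simp]: "w \<in> braid_words n \<Longrightarrow> PS_arrow n w \<in> Hom PS n n"
  by (simp add: Hom_iff)

interpretation PS: category PS
  by unfold_locales (auto elim!: PS_Arr_cases PS_Hom_cases simp: Hom_iff)

lemma PS_winv: "w \<in> braid_words n \<Longrightarrow> PS_class n (winv w @ w) = PS_class n []"
  "w \<in> braid_words n \<Longrightarrow> PS_class n (w @ winv w) = PS_class n []"
proof -
  assume w: "w \<in> braid_words n"
  then show "PS_class n (winv w @ w) = PS_class n []"
    using winv_cancel[OF w] by (simp add: PS_class_def flip: braid_class_eq_iff)
  have "braid_class n (w @ winv w) = \<one>\<^bsub>braid_group n\<^esub>"
    using w by (simp flip: mult_braid_class inv_braid_class)
  then show "PS_class n (w @ winv w) = PS_class n []"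
    by (simp add: PS_class_def one_braid_group)
qed

lemma PS_inverse_arrows: "w \<in> braid_words n \<Longrightarrow> inverse_arrows PS (PS_arrow n w) (PS_arrow n (winv w))"
  by (auto simp: inverse_arrows_def PS_winv PS_arrow_eq_iff Hom_iff)

lemma PS_iso: "w \<in> braid_words n \<Longrightarrow> is_iso PS (PS_arrow n w)"
  by (rule is_isoI[OF PS_inverse_arrows])

lemma PS_Inverse_one [simp]: "Inverse PS (PS_arrow n []) = PS_arrow n []"
  using PS.Inverse_Ident[of n] by simp

theorem braided_category_PS: "braided_category PS"
proof unfold_locales
  fix f g f' g' X Y Z X' Y' Z'
  assume "f \<in> Hom PS X Y" "g \<in> Hom PS Y Z" "f' \<in> Hom PS X' Y'" "g' \<in> Hom PS Y' Z'"
  then obtain u v u' v' where [simp]: "X = Z" "Y = Z" "X' = Z'" "Y' = Z'"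
    "f = PS_arrow Z u" "g = PS_arrow Z v" "f' = PS_arrow Z' u'" "g' = PS_arrow Z' v'"
    and w: "u \<in> braid_words Z" "v \<in> braid_words Z" "u' \<in> braid_words Z'" "v' \<in> braid_words Z'"
    by (auto elim!: PS_Hom_cases)
  interpret B: braid_rep "PS_group (Z + Z')" "Z + Z'" "\<lambda>i. PS_class (Z + Z') [(i, True)]"
    by (rule braid_rep_PS)
  have m: "w \<in> braid_words (Z + Z')" if "w \<in> braid_words Z" for w
    using that braid_words_mono[of Z "Z + Z'"] by simp
  have "PS_class (Z + Z') (u @ shift_word Z v') = PS_class (Z + Z') (shift_word Z v' @ u)"
    using B.commutes_juxtaposed[OF w(1,4)] w m by (simp add: PSG.commutes_def weval_PS)
  then have "PS_class (Z + Z') v \<otimes>\<^bsub>PS_group (Z + Z')\<^esub> PS_class (Z + Z') (u @ shift_word Z v') \<otimes>\<^bsub>PS_group (Z + Z')\<^esub> PS_class (Z + Z') (shift_word Z u')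
     = PS_class (Z + Z') v \<otimes>\<^bsub>PS_group (Z + Z')\<^esub> PS_class (Z + Z') (shift_word Z v' @ u) \<otimes>\<^bsub>PS_group (Z + Z')\<^esub> PS_class (Z + Z') (shift_word Z u')"
    by simp
  then show "(g \<cdot>\<^bsub>PS\<^esub> f) \<boxtimes>\<^bsub>PS\<^esub> (g' \<cdot>\<^bsub>PS\<^esub> f') = (g \<boxtimes>\<^bsub>PS\<^esub> g') \<cdot>\<^bsub>PS\<^esub> (f \<boxtimes>\<^bsub>PS\<^esub> f')"
    using w m by (simp add: PS_arrow_eq_iff)
next
  fix f g X X' Y Y' assume "f \<in> Hom PS X X'" "g \<in> Hom PS Y Y'"
  then obtain u v where [simp]: "X = X'" "Y = Y'" "f = PS_arrow X' u" "g = PS_arrow Y' v"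
    and w: "u \<in> braid_words X'" "v \<in> braid_words Y'"
    by (auto elim!: PS_Hom_cases)
  interpret B: braid_rep "PS_group (X' + Y')" "X' + Y'" "\<lambda>i. PS_class (X' + Y') [(i, True)]"
    by (rule braid_rep_PS)
  have m: "u \<in> braid_words (X' + Y')" "v \<in> braid_words (X' + Y')"
    "shift_word Y' u \<in> braid_words (X' + Y')"
    using w braid_words_mono[of X' "X' + Y'"] braid_words_mono[of Y' "X' + Y'"]
      shift_word_in[of u X' Y'] by (simp_all add: add.commute)
  show "braid PS X' Y' \<cdot>\<^bsub>PS\<^esub> (f \<boxtimes>\<^bsub>PS\<^esub> g) = (g \<boxtimes>\<^bsub>PS\<^esub> f) \<cdot>\<^bsub>PS\<^esub> braid PS X Y"
    using B.braiding_natural[OF w] w m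
    by (simp add: PS_arrow_eq_iff weval_PS add.commute[of Y' X'])
next
  fix U V W
  interpret B: braid_rep "PS_group (U + (V + W))" "U + (V + W)" "\<lambda>i. PS_class (U + (V + W)) [(i, True)]"
    by (rule braid_rep_PS)
  have m: "braiding_word U V \<in> braid_words (U + (V + W))" "braiding_word U W \<in> braid_words (U + W)"
    "shift_word V (braiding_word U W) \<in> braid_words (U + (V + W))"
    using braid_words_mono[of "U + V" "U + (V + W)"] shift_word_in[OF braiding_word_in, of V U W]
    by (simp_all add: ac_simps)
  show "assoc PS V W U \<cdot>\<^bsub>PS\<^esub> braid PS U (V \<boxdot>\<^bsub>PS\<^esub> W) \<cdot>\<^bsub>PS\<^esub> assoc PS U V W
      = (Ident PS V \<boxtimes>\<^bsub>PS\<^esub> braid PS U W) \<cdot>\<^bsub>PS\<^esub> assoc PS V U W \<cdot>\<^bsub>PS\<^esub> (braid PS U V \<boxtimes>\<^bsub>PS\<^esub> Ident PS W)"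
    using B.braiding_hexagon[of U V W] m by (simp add: PS_arrow_eq_iff weval_PS ac_simps)
  have m': "braiding_word U W \<in> braid_words (U + (V + W))" "braiding_word V W \<in> braid_words (V + W)"
    "shift_word U (braiding_word V W) \<in> braid_words (U + (V + W))"
    using braid_words_mono[of "U + W" "U + (V + W)"] shift_word_in[OF braiding_word_in, of U V W]
    by (simp_all add: ac_simps)
  show "Inverse PS (assoc PS W U V) \<cdot>\<^bsub>PS\<^esub> braid PS (U \<boxdot>\<^bsub>PS\<^esub> V) W \<cdot>\<^bsub>PS\<^esub> Inverse PS (assoc PS U V W)
      = (braid PS U W \<boxtimes>\<^bsub>PS\<^esub> Ident PS V) \<cdot>\<^bsub>PS\<^esub> Inverse PS (assoc PS U W V) \<cdot>\<^bsub>PS\<^esub> (Ident PS U \<boxtimes>\<^bsub>PS\<^esub> braid PS V W)"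
    using braiding_word_add[of U V W] m' by (simp add: PS_arrow_eq_iff ac_simps)
next
  fix f g h X X' Y Y' Z Z' assume "f \<in> Hom PS X X'" "g \<in> Hom PS Y Y'" "h \<in> Hom PS Z Z'"
  then obtain u v w where [simp]: "X = X'" "Y = Y'" "Z = Z'"
    "f = PS_arrow X' u" "g = PS_arrow Y' v" "h = PS_arrow Z' w"
    and words: "u \<in> braid_words X'" "v \<in> braid_words Y'" "w \<in> braid_words Z'"
    by (auto elim!: PS_Hom_cases)
  have "u \<in> braid_words (X' + Y')" "v \<in> braid_words (Y' + Z')"
    "u \<in> braid_words (X' + Y' + Z')" "shift_word X' v \<in> braid_words (X' + Y' + Z')"
    using words braid_words_mono[of X' "X' + Y'" u] braid_words_mono[of Y' "Y' + Z'" v]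
      braid_words_mono[of X' "X' + Y' + Z'" u] braid_words_mono[of "X' + Y'" "X' + Y' + Z'" "shift_word X' v"]
    by auto
  then show "assoc PS X' Y' Z' \<cdot>\<^bsub>PS\<^esub> ((f \<boxtimes>\<^bsub>PS\<^esub> g) \<boxtimes>\<^bsub>PS\<^esub> h) = (f \<boxtimes>\<^bsub>PS\<^esub> (g \<boxtimes>\<^bsub>PS\<^esub> h)) \<cdot>\<^bsub>PS\<^esub> assoc PS X Y Z"
    using words by (simp add: add.assoc[symmetric])
next
  fix f g X Y X' Y' assume "f \<in> Hom PS X Y" "g \<in> Hom PS X' Y'"
  then show "f \<boxtimes>\<^bsub>PS\<^esub> g \<in> Hom PS (X \<boxdot>\<^bsub>PS\<^esub> X') (Y \<boxdot>\<^bsub>PS\<^esub> Y')"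
    using braid_words_mono[of Y "Y + Y'"] by (auto elim!: PS_Hom_cases)
qed (auto elim!: PS_Hom_cases intro!: PS_iso PS_Hom_arrow simp: PS_arrow_eq_iff ac_simps)


section \<open>Monoidal categories\<close>

context monoidal_category
begin

lemma Unit_Tens_Obj [simp]: "Unit C \<in> Obj C" "X \<in> Obj C \<Longrightarrow> Y \<in> Obj C \<Longrightarrow> X \<boxdot> Y \<in> Obj C"
  by (auto intro: Unit_Obj Tens_Obj)

lemma tens_simps [simp]:
  assumes "f \<in> Arr C" "g \<in> Arr C"
  shows "f \<boxtimes> g \<in> Arr C" "Dom C (f \<boxtimes> g) = Dom C f \<boxdot> Dom C g" "Cod C (f \<boxtimes> g) = Cod C f \<boxdot> Cod C g"
  using tens_Hom[of f "Dom C f" "Cod C f" g "Dom C g" "Cod C g"] assms by (auto simp: Hom_iff)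

declare tens_Ident [simp]

lemma assoc_simps [simp]:
  assumes "X \<in> Obj C" "Y \<in> Obj C" "Z \<in> Obj C"
  shows "assoc C X Y Z \<in> Arr C" "Dom C (assoc C X Y Z) = (X \<boxdot> Y) \<boxdot> Z"
    "Cod C (assoc C X Y Z) = X \<boxdot> (Y \<boxdot> Z)" "is_iso C (assoc C X Y Z)"
  using assoc_Hom[OF assms] assoc_iso[OF assms] by (auto simp: Hom_iff)

lemma unit_simps [simp]:
  assumes "X \<in> Obj C"
  shows "lunit C X \<in> Arr C" "Dom C (lunit C X) = Unit C \<boxdot> X" "Cod C (lunit C X) = X" "is_iso C (lunit C X)"
    "runit C X \<in> Arr C" "Dom C (runit C X) = X \<boxdot> Unit C" "Cod C (runit C X) = X" "is_iso C (runit C X)"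
  using lunit_Hom[OF assms] lunit_iso[OF assms] runit_Hom[OF assms] runit_iso[OF assms]
  by (auto simp: Hom_iff)

lemma interchange:
  assumes "f \<in> Arr C" "g \<in> Arr C" "f' \<in> Arr C" "g' \<in> Arr C"
    "Cod C f = Dom C g" "Cod C f' = Dom C g'"
  shows "(g \<boxtimes> g') \<cdot> (f \<boxtimes> f') = (g \<cdot> f) \<boxtimes> (g' \<cdot> f')"
  using tens_Comp[of f "Dom C f" "Dom C g" g "Cod C g" f' "Dom C f'" "Dom C g'" g' "Cod C g'"] assms
  by (simp add: Hom_iff)

lemma interchange_assoc:
  assumes "f \<in> Arr C" "g \<in> Arr C" "f' \<in> Arr C" "g' \<in> Arr C" "h \<in> Arr C"
    "Cod C f = Dom C g" "Cod C f' = Dom C g'" "Cod C h = Dom C f \<boxdot> Dom C f'"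
  shows "(g \<boxtimes> g') \<cdot> (f \<boxtimes> f') \<cdot> h = ((g \<cdot> f) \<boxtimes> (g' \<cdot> f')) \<cdot> h"
  using assms by (simp flip: interchange)

lemma inverse_arrows_tens:
  "is_iso C f \<Longrightarrow> is_iso C g \<Longrightarrow> inverse_arrows C (f \<boxtimes> g) (Inverse C f \<boxtimes> Inverse C g)"
  by (simp add: inverse_arrows_def Hom_iff interchange)

lemma iso_tens [simp]: "is_iso C f \<Longrightarrow> is_iso C g \<Longrightarrow> is_iso C (f \<boxtimes> g)"
  by (rule is_isoI[OF inverse_arrows_tens])

lemma assoc_natural':
  assumes "f \<in> Arr C" "g \<in> Arr C" "h \<in> Arr C"
    "Cod C f = X" "Cod C g = Y" "Cod C h = Z"
  shows "assoc C X Y Z \<cdot> ((f \<boxtimes> g) \<boxtimes> h)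
    = (f \<boxtimes> (g \<boxtimes> h)) \<cdot> assoc C (Dom C f) (Dom C g) (Dom C h)"
  by (rule assoc_natural) (use assms in \<open>auto simp: Hom_iff\<close>)

lemma tens_Unit_cancel_right:
  assumes "f \<boxtimes> Ident C (Unit C) = g \<boxtimes> Ident C (Unit C)" "f \<in> Hom C X Y" "g \<in> Hom C X Y"
  shows "f = g"
proof (rule iso_cancel_right)
  show "f \<cdot> runit C X = g \<cdot> runit C X"
    using assms runit_natural[OF assms(2)] runit_natural[OF assms(3)] by simp
  have "X \<in> Obj C" using assms by (auto simp: Hom_iff)
  then show "is_iso C (runit C X)" "f \<in> Arr C" "g \<in> Arr C"
    "Dom C f = Cod C (runit C X)" "Dom C g = Cod C (runit C X)"
    using assms by (auto simp: Hom_iff)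
qed

lemma tens_Unit_cancel_left:
  assumes "Ident C (Unit C) \<boxtimes> f = Ident C (Unit C) \<boxtimes> g" "f \<in> Hom C X Y" "g \<in> Hom C X Y"
  shows "f = g"
proof (rule iso_cancel_right)
  show "f \<cdot> lunit C X = g \<cdot> lunit C X"
    using assms lunit_natural[OF assms(2)] lunit_natural[OF assms(3)] by simp
  have "X \<in> Obj C" using assms by (auto simp: Hom_iff)
  then show "is_iso C (lunit C X)" "f \<in> Arr C" "g \<in> Arr C"
    "Dom C f = Cod C (lunit C X)" "Dom C g = Cod C (lunit C X)"
    using assms by (auto simp: Hom_iff)
qed

text \<open>
  Kelly's observation that this coherence follows from the pentagon and the triangle: after
  tensoring with the unit on the right, both sides become composites in the pentagon for
  \<open>X, Y, I, I\<close>.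
\<close>

lemma runit_Tens:
  assumes XY: "X \<in> Obj C" "Y \<in> Obj C"
  shows "(Ident C X \<boxtimes> runit C Y) \<cdot> assoc C X Y (Unit C) = runit C (X \<boxdot> Y)"
proof -
  let ?I = "Unit C" and ?i = "Ident C"
  let ?k = "(?i X \<boxtimes> runit C Y) \<cdot> assoc C X Y ?I"
  let ?t = "?i X \<boxtimes> (?i Y \<boxtimes> lunit C ?I)"
  note [simp] = XY
  have "assoc C X Y ?I \<cdot> (runit C (X \<boxdot> Y) \<boxtimes> ?i ?I)
      = assoc C X Y ?I \<cdot> (?i (X \<boxdot> Y) \<boxtimes> lunit C ?I) \<cdot> assoc C (X \<boxdot> Y) ?I ?I"
    by (simp add: triangle)
  also have "\<dots> = ?t \<cdot> assoc C X Y (?I \<boxdot> ?I) \<cdot> assoc C (X \<boxdot> Y) ?I ?I"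
    using assoc_natural'[of "?i X" "?i Y" "lunit C ?I" X Y ?I]
    by (simp flip: Comp_assoc_simp)
  also have "\<dots> = ?t \<cdot> (?i X \<boxtimes> assoc C Y ?I ?I) \<cdot> assoc C X (Y \<boxdot> ?I) ?I \<cdot> (assoc C X Y ?I \<boxtimes> ?i ?I)"
    by (simp add: pentagon)
  also have "\<dots> = (?i X \<boxtimes> (runit C Y \<boxtimes> ?i ?I)) \<cdot> assoc C X (Y \<boxdot> ?I) ?I \<cdot> (assoc C X Y ?I \<boxtimes> ?i ?I)"
    by (simp add: interchange_assoc triangle)
  also have "\<dots> = assoc C X Y ?I \<cdot> ((?i X \<boxtimes> runit C Y) \<boxtimes> ?i ?I) \<cdot> (assoc C X Y ?I \<boxtimes> ?i ?I)"
    using assoc_natural'[of "?i X" "runit C Y" "?i ?I" X Y ?I]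
    by (simp flip: Comp_assoc_simp)
  also have "\<dots> = assoc C X Y ?I \<cdot> (?k \<boxtimes> ?i ?I)"
    by (simp add: interchange)
  finally have "runit C (X \<boxdot> Y) \<boxtimes> ?i ?I = ?k \<boxtimes> ?i ?I"
    by (rule iso_cancel_left) simp_all
  then show ?thesis
    using tens_Unit_cancel_right[of "runit C (X \<boxdot> Y)" ?k "(X \<boxdot> Y) \<boxdot> ?I" "X \<boxdot> Y"]
    by (simp add: Hom_iff)
qed

end

definition Aut :: "('o, 'a, 'x) category_scheme \<Rightarrow> 'o \<Rightarrow> 'a monoid"
  where "Aut C X = \<lparr>carrier = {f \<in> Hom C X X. is_iso C f}, mult = Comp C, one = Ident C X\<rparr>"

lemma Aut_simps [simp]:
  "mult (Aut C X) = Comp C" "one (Aut C X) = Ident C X"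
  by (auto simp: Aut_def)

lemma Aut_carrier: "f \<in> carrier (Aut C X) \<longleftrightarrow> is_iso C f \<and> f \<in> Arr C \<and> Dom C f = X \<and> Cod C f = X"
  by (auto simp: Aut_def Hom_iff)

context category
begin

lemma group_Aut: "X \<in> Obj C \<Longrightarrow> group (Aut C X)"
proof (rule groupI)
  fix f assume "f \<in> carrier (Aut C X)"
  then show "\<exists>g\<in>carrier (Aut C X). g \<otimes>\<^bsub>Aut C X\<^esub> f = \<one>\<^bsub>Aut C X\<^esub>"
    by (intro bexI[of _ "Inverse C f"]) (auto simp: Aut_carrier)
qed (auto simp: Aut_carrier)

lemma inv_Aut:
  assumes "X \<in> Obj C" "f \<in> carrier (Aut C X)"
  shows "inv\<^bsub>Aut C X\<^esub> f = Inverse C f"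
  by (rule group.inv_equality[OF group_Aut]) (use assms in \<open>auto simp: Aut_carrier\<close>)

end


section \<open>Monoidal families\<close>

text \<open>
  A strong monoidal functor from the discrete monoidal category of natural numbers. The tensor powers
  of an object are of this form, and so are the values on objects of a monoidal functor on \<open>PS\<close>.
\<close>

locale monoidal_family = monoidal_category C
  for C :: "('o, 'a, 'x) monoidal_category_scheme" (structure) +
  fixes P :: "nat \<Rightarrow> 'o" and \<phi> :: "nat \<Rightarrow> nat \<Rightarrow> 'a" and \<phi>0 :: 'a
  assumes P_Obj [simp]: "P n \<in> Obj C"
    and \<phi>0_iso [simp]: "is_iso C \<phi>0" and \<phi>0_Hom: "\<phi>0 \<in> Hom C (Unit C) (P 0)"
    and \<phi>_iso [simp]: "is_iso C (\<phi> m n)" and \<phi>_Hom: "\<phi> m n \<in> Hom C (P m \<boxdot> P n) (P (m + n))"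
    and \<phi>_assoc: "\<phi> m (n + k) \<cdot> (Ident C (P m) \<boxtimes> \<phi> n k) \<cdot> assoc C (P m) (P n) (P k)
      = \<phi> (m + n) k \<cdot> (\<phi> m n \<boxtimes> Ident C (P k))"
    and \<phi>_lunit: "\<phi> 0 n \<cdot> (\<phi>0 \<boxtimes> Ident C (P n)) = lunit C (P n)"
    and \<phi>_runit: "\<phi> n 0 \<cdot> (Ident C (P n) \<boxtimes> \<phi>0) = runit C (P n)"
begin

lemma \<phi>_simps [simp]:
  "\<phi> m n \<in> Arr C" "Dom C (\<phi> m n) = P m \<boxdot> P n" "Cod C (\<phi> m n) = P (m + n)"
  "\<phi>0 \<in> Arr C" "Dom C \<phi>0 = Unit C" "Cod C \<phi>0 = P 0"
  using \<phi>_Hom[of m n] \<phi>0_Hom by (auto simp: Hom_iff)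

text \<open>
  Transporting the tensor product along \<open>\<phi>\<close> makes it strictly associative and unital on
  endomorphisms of the objects \<open>P n\<close>.
\<close>

definition T :: "nat \<Rightarrow> nat \<Rightarrow> 'a \<Rightarrow> 'a \<Rightarrow> 'a"
  where "T m n f g = \<phi> m n \<cdot> (f \<boxtimes> g) \<cdot> Inverse C (\<phi> m n)"

abbreviation endo :: "nat \<Rightarrow> 'a \<Rightarrow> bool"
  where "endo n f \<equiv> f \<in> Arr C \<and> Dom C f = P n \<and> Cod C f = P n"

lemma T_simps [simp]:
  assumes "endo m f" "endo n g"
  shows "T m n f g \<in> Arr C" "Dom C (T m n f g) = P (m + n)" "Cod C (T m n f g) = P (m + n)"
    "is_iso C f \<Longrightarrow> is_iso C g \<Longrightarrow> is_iso C (T m n f g)"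
  using assms by (auto simp: T_def)

lemma T_\<phi>: "endo m f \<Longrightarrow> endo n g \<Longrightarrow> T m n f g \<cdot> \<phi> m n = \<phi> m n \<cdot> (f \<boxtimes> g)"
  by (simp add: T_def)

lemma T_unique:
  assumes "x \<cdot> \<phi> m n = \<phi> m n \<cdot> (f \<boxtimes> g)" "endo m f" "endo n g" "endo (m + n) x"
  shows "x = T m n f g"
proof (rule iso_cancel_right)
  show "x \<cdot> \<phi> m n = T m n f g \<cdot> \<phi> m n" using assms by (simp add: T_\<phi>)
qed (use assms in simp_all)

lemma T_Ident: "T m n (Ident C (P m)) (Ident C (P n)) = Ident C (P (m + n))"
  by (rule T_unique[symmetric]) simp_all

lemma T_Comp:
  assumes "endo m f" "endo m g" "endo n f'" "endo n g'"
  shows "T m n (g \<cdot> f) (g' \<cdot> f') = T m n g g' \<cdot> T m n f f'"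
  using assms by (simp add: T_def interchange_assoc)

text \<open>
  The two comparison maps for threefold tensor products. An identity between transported arrows
  follows from the corresponding identity in \<open>C\<close> by composing with either of them; as they differ
  by an associator, the associators of \<open>C\<close> are absorbed.
\<close>

definition \<Phi> :: "nat \<Rightarrow> nat \<Rightarrow> nat \<Rightarrow> 'a"
  where "\<Phi> m n k = \<phi> (m + n) k \<cdot> (\<phi> m n \<boxtimes> Ident C (P k))"

definition \<Phi>' :: "nat \<Rightarrow> nat \<Rightarrow> nat \<Rightarrow> 'a"
  where "\<Phi>' m n k = \<phi> m (n + k) \<cdot> (Ident C (P m) \<boxtimes> \<phi> n k)"

lemma \<Phi>_simps [simp]:
  "\<Phi> m n k \<in> Arr C" "Dom C (\<Phi> m n k) = (P m \<boxdot> P n) \<boxdot> P k" "Cod C (\<Phi> m n k) = P (m + n + k)"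
  "is_iso C (\<Phi> m n k)"
  "\<Phi>' m n k \<in> Arr C" "Dom C (\<Phi>' m n k) = P m \<boxdot> (P n \<boxdot> P k)" "Cod C (\<Phi>' m n k) = P (m + n + k)"
  "is_iso C (\<Phi>' m n k)"
  by (simp_all add: \<Phi>_def \<Phi>'_def add.assoc)

lemma \<Phi>'_assoc: "\<Phi>' m n k \<cdot> assoc C (P m) (P n) (P k) = \<Phi> m n k"
  using \<phi>_assoc by (simp add: \<Phi>_def \<Phi>'_def add.assoc)

lemma T_left_\<Phi>:
  assumes "endo m f" "endo n g" "endo k h"
  shows "T (m + n) k (T m n f g) h \<cdot> \<Phi> m n k = \<Phi> m n k \<cdot> ((f \<boxtimes> g) \<boxtimes> h)"
proof -
  have "T (m + n) k (T m n f g) h \<cdot> \<Phi> m n k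
      = (T (m + n) k (T m n f g) h \<cdot> \<phi> (m + n) k) \<cdot> (\<phi> m n \<boxtimes> Ident C (P k))"
    using assms unfolding \<Phi>_def by (subst Comp_assoc_simp) simp_all
  also have "\<dots> = \<phi> (m + n) k \<cdot> ((T m n f g \<cdot> \<phi> m n) \<boxtimes> h)"
    using assms by (simp add: T_\<phi> interchange)
  also have "\<dots> = \<Phi> m n k \<cdot> ((f \<boxtimes> g) \<boxtimes> h)"
    using assms by (simp add: \<Phi>_def T_\<phi> interchange)
  finally show ?thesis .
qed

lemma T_right_\<Phi>':
  assumes "endo m f" "endo n g" "endo k h"
  shows "T m (n + k) f (T n k g h) \<cdot> \<Phi>' m n k = \<Phi>' m n k \<cdot> (f \<boxtimes> (g \<boxtimes> h))"
proof -
  have "T m (n + k) f (T n k g h) \<cdot> \<Phi>' m n k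
      = (T m (n + k) f (T n k g h) \<cdot> \<phi> m (n + k)) \<cdot> (Ident C (P m) \<boxtimes> \<phi> n k)"
    using assms unfolding \<Phi>'_def by (subst Comp_assoc_simp) simp_all
  also have "\<dots> = \<phi> m (n + k) \<cdot> (f \<boxtimes> (T n k g h \<cdot> \<phi> n k))"
    using assms by (simp add: T_\<phi> interchange)
  also have "\<dots> = \<Phi>' m n k \<cdot> (f \<boxtimes> (g \<boxtimes> h))"
    using assms by (simp add: \<Phi>'_def T_\<phi> interchange)
  finally show ?thesis .
qed

lemma T_assoc:
  assumes "endo m f" "endo n g" "endo k h"
  shows "T (m + n) k (T m n f g) h = T m (n + k) f (T n k g h)"
proof (rule iso_cancel_right)
  have "T m (n + k) f (T n k g h) \<cdot> \<Phi> m n k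
      = (T m (n + k) f (T n k g h) \<cdot> \<Phi>' m n k) \<cdot> assoc C (P m) (P n) (P k)"
    using assms by (simp add: add.assoc flip: \<Phi>'_assoc)
  also have "\<dots> = \<Phi>' m n k \<cdot> assoc C (P m) (P n) (P k) \<cdot> ((f \<boxtimes> g) \<boxtimes> h)"
    using assms by (simp add: T_right_\<Phi>' assoc_natural')
  also have "\<dots> = (\<Phi>' m n k \<cdot> assoc C (P m) (P n) (P k)) \<cdot> ((f \<boxtimes> g) \<boxtimes> h)"
    using assms by (subst Comp_assoc_simp) simp_all
  also have "\<dots> = T (m + n) k (T m n f g) h \<cdot> \<Phi> m n k"
    using assms by (simp add: \<Phi>'_assoc T_left_\<Phi>)
  finally show "T (m + n) k (T m n f g) h \<cdot> \<Phi> m n k = T m (n + k) f (T n k g h) \<cdot> \<Phi> m n k" ..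
qed (use assms in \<open>simp_all add: add.assoc\<close>)

lemma T_unit_left:
  assumes "endo n f"
  shows "T 0 n (Ident C (P 0)) f = f"
proof (rule T_unique[symmetric])
  show "f \<cdot> \<phi> 0 n = \<phi> 0 n \<cdot> (Ident C (P 0) \<boxtimes> f)"
  proof (rule iso_cancel_right)
    have "(\<phi> 0 n \<cdot> (Ident C (P 0) \<boxtimes> f)) \<cdot> (\<phi>0 \<boxtimes> Ident C (P n))
        = (\<phi> 0 n \<cdot> (\<phi>0 \<boxtimes> Ident C (P n))) \<cdot> (Ident C (Unit C) \<boxtimes> f)"
      using assms by (simp add: interchange)
    also have "\<dots> = f \<cdot> lunit C (P n)"
      using assms by (simp only: \<phi>_lunit) (rule lunit_natural, simp add: Hom_iff)
    also have "\<dots> = (f \<cdot> \<phi> 0 n) \<cdot> (\<phi>0 \<boxtimes> Ident C (P n))"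
      using assms by (simp add: \<phi>_lunit)
    finally show "(f \<cdot> \<phi> 0 n) \<cdot> (\<phi>0 \<boxtimes> Ident C (P n)) = (\<phi> 0 n \<cdot> (Ident C (P 0) \<boxtimes> f)) \<cdot> (\<phi>0 \<boxtimes> Ident C (P n))" ..
  qed (use assms in simp_all)
qed (use assms in simp_all)

lemma T_unit_right:
  assumes "endo n f"
  shows "T n 0 f (Ident C (P 0)) = f"
proof (rule T_unique[symmetric])
  show "f \<cdot> \<phi> n 0 = \<phi> n 0 \<cdot> (f \<boxtimes> Ident C (P 0))"
  proof (rule iso_cancel_right)
    have "(\<phi> n 0 \<cdot> (f \<boxtimes> Ident C (P 0))) \<cdot> (Ident C (P n) \<boxtimes> \<phi>0)
        = (\<phi> n 0 \<cdot> (Ident C (P n) \<boxtimes> \<phi>0)) \<cdot> (f \<boxtimes> Ident C (Unit C))"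
      using assms by (simp add: interchange)
    also have "\<dots> = f \<cdot> runit C (P n)"
      using assms by (simp only: \<phi>_runit) (rule runit_natural, simp add: Hom_iff)
    also have "\<dots> = (f \<cdot> \<phi> n 0) \<cdot> (Ident C (P n) \<boxtimes> \<phi>0)"
      using assms by (simp add: \<phi>_runit)
    finally show "(f \<cdot> \<phi> n 0) \<cdot> (Ident C (P n) \<boxtimes> \<phi>0) = (\<phi> n 0 \<cdot> (f \<boxtimes> Ident C (P 0))) \<cdot> (Ident C (P n) \<boxtimes> \<phi>0)" ..
  qed (use assms in simp_all)
qed (use assms in simp_all)

end


section \<open>Braid group representations in braided categories\<close>

context braided_category
begin

lemma braid_simps [simp]:
  assumes "X \<in> Obj C" "Y \<in> Obj C"
  shows "braid C X Y \<in> Arr C" "Dom C (braid C X Y) = X \<boxdot> Y" "Cod C (braid C X Y) = Y \<boxdot> X"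
    "is_iso C (braid C X Y)"
  using braid_Hom[OF assms] braid_iso[OF assms] by (auto simp: Hom_iff)

lemma braid_natural':
  assumes "f \<in> Arr C" "g \<in> Arr C" "Cod C f = X" "Cod C g = Y"
  shows "braid C X Y \<cdot> (f \<boxtimes> g) = (g \<boxtimes> f) \<cdot> braid C (Dom C f) (Dom C g)"
  by (rule braid_natural) (use assms in \<open>auto simp: Hom_iff\<close>)

end

locale braided_family = monoidal_family C P \<phi> \<phi>0 + braided_category C
  for C :: "('o, 'a, 'x) braided_category_scheme" (structure)
    and P :: "nat \<Rightarrow> 'o" and \<phi> :: "nat \<Rightarrow> nat \<Rightarrow> 'a" and \<phi>0 :: 'a
begin

definition B :: "nat \<Rightarrow> nat \<Rightarrow> 'a"
  where "B m n = \<phi> n m \<cdot> braid C (P m) (P n) \<cdot> Inverse C (\<phi> m n)"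

lemma B_simps [simp]:
  "B m n \<in> Arr C" "Dom C (B m n) = P (m + n)" "Cod C (B m n) = P (m + n)" "is_iso C (B m n)"
  by (simp_all add: B_def add.commute)

lemma B_\<phi>: "B m n \<cdot> \<phi> m n = \<phi> n m \<cdot> braid C (P m) (P n)"
  by (simp add: B_def)

lemma B_unique:
  assumes "x \<cdot> \<phi> m n = \<phi> n m \<cdot> braid C (P m) (P n)" "endo (m + n) x"
  shows "x = B m n"
proof (rule iso_cancel_right)
  show "x \<cdot> \<phi> m n = B m n \<cdot> \<phi> m n" using assms by (simp add: B_\<phi>)
qed (use assms in simp_all)

lemma B_natural:
  assumes "endo m f" "endo n g"
  shows "B m n \<cdot> T m n f g = T n m g f \<cdot> B m n"
proof -
  have "B m n \<cdot> T m n f g = \<phi> n m \<cdot> (braid C (P m) (P n) \<cdot> (f \<boxtimes> g)) \<cdot> Inverse C (\<phi> m n)"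
    using assms by (simp add: B_def T_def)
  also have "\<dots> = T n m g f \<cdot> B m n"
    using assms by (simp add: B_def T_def braid_natural')
  finally show ?thesis .
qed

lemma B_left_\<Phi>:
  "T (m + n) k (B m n) (Ident C (P k)) \<cdot> \<Phi> m n k
    = \<Phi> n m k \<cdot> (braid C (P m) (P n) \<boxtimes> Ident C (P k))"
proof -
  have "T (m + n) k (B m n) (Ident C (P k)) \<cdot> \<Phi> m n k
      = (T (m + n) k (B m n) (Ident C (P k)) \<cdot> \<phi> (m + n) k) \<cdot> (\<phi> m n \<boxtimes> Ident C (P k))"
    unfolding \<Phi>_def by (subst Comp_assoc_simp) simp_all
  also have "\<dots> = \<phi> (n + m) k \<cdot> ((B m n \<cdot> \<phi> m n) \<boxtimes> Ident C (P k))"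
    by (simp add: T_\<phi> interchange add.commute[of n m])
  also have "\<dots> = \<Phi> n m k \<cdot> (braid C (P m) (P n) \<boxtimes> Ident C (P k))"
    by (simp add: \<Phi>_def B_\<phi> interchange)
  finally show ?thesis .
qed

lemma B_right_\<Phi>':
  "T m (n + k) (Ident C (P m)) (B n k) \<cdot> \<Phi>' m n k
    = \<Phi>' m k n \<cdot> (Ident C (P m) \<boxtimes> braid C (P n) (P k))"
proof -
  have "T m (n + k) (Ident C (P m)) (B n k) \<cdot> \<Phi>' m n k
      = (T m (n + k) (Ident C (P m)) (B n k) \<cdot> \<phi> m (n + k)) \<cdot> (Ident C (P m) \<boxtimes> \<phi> n k)"
    unfolding \<Phi>'_def by (subst Comp_assoc_simp) simp_all
  also have "\<dots> = \<phi> m (k + n) \<cdot> (Ident C (P m) \<boxtimes> (B n k \<cdot> \<phi> n k))"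
    by (simp add: T_\<phi> interchange add.commute[of k n])
  also have "\<dots> = \<Phi>' m k n \<cdot> (Ident C (P m) \<boxtimes> braid C (P n) (P k))"
    by (simp add: \<Phi>'_def B_\<phi> interchange)
  finally show ?thesis .
qed

lemma \<Phi>_assoc_Inverse: "\<Phi> m n k \<cdot> Inverse C (assoc C (P m) (P n) (P k)) = \<Phi>' m n k"
  by (simp flip: \<Phi>'_assoc)

text \<open>
  Composed with \<open>\<Phi>\<close> or \<open>\<Phi>'\<close>, the two sides of the strict hexagons become those of the hexagons in
  \<open>C\<close>.
\<close>

lemma B_hexagon1:
  "B m (n + k) = T n (m + k) (Ident C (P n)) (B m k) \<cdot> T (m + n) k (B m n) (Ident C (P k))"
proof (rule iso_cancel_right)
  let ?a = "assoc C" and ?c = "braid C" and ?i = "Ident C"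
  have e: "n + (m + k) = m + n + k" "n + k + m = m + (n + k)" by simp_all
  have "(T n (m + k) (?i (P n)) (B m k) \<cdot> T (m + n) k (B m n) (?i (P k))) \<cdot> \<Phi> m n k
      = T n (m + k) (?i (P n)) (B m k) \<cdot> (T (m + n) k (B m n) (?i (P k)) \<cdot> \<Phi> m n k)"
    by (rule Comp_assoc_simp) (simp_all add: e)
  also have "\<dots> = (T n (m + k) (?i (P n)) (B m k) \<cdot> \<Phi>' n m k) \<cdot> ?a (P n) (P m) (P k) \<cdot> (?c (P m) (P n) \<boxtimes> ?i (P k))"
    unfolding B_left_\<Phi> by (simp add: add.assoc flip: \<Phi>'_assoc)
  also have "\<dots> = \<Phi>' n k m \<cdot> (?i (P n) \<boxtimes> ?c (P m) (P k)) \<cdot> ?a (P n) (P m) (P k) \<cdot> (?c (P m) (P n) \<boxtimes> ?i (P k))"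
    unfolding B_right_\<Phi>' by simp
  also have "\<dots> = \<Phi>' n k m \<cdot> ?a (P n) (P k) (P m) \<cdot> ?c (P m) (P n \<boxdot> P k) \<cdot> ?a (P m) (P n) (P k)"
    by (simp only: hexagon1[OF P_Obj P_Obj P_Obj])
  also have "\<dots> = (\<Phi>' n k m \<cdot> ?a (P n) (P k) (P m)) \<cdot> ?c (P m) (P n \<boxdot> P k) \<cdot> ?a (P m) (P n) (P k)"
    by simp
  also have "\<dots> = \<phi> (n + k) m \<cdot> ((\<phi> n k \<boxtimes> ?i (P m)) \<cdot> ?c (P m) (P n \<boxdot> P k)) \<cdot> ?a (P m) (P n) (P k)"
    unfolding \<Phi>'_assoc by (simp add: \<Phi>_def)
  also have "(\<phi> n k \<boxtimes> ?i (P m)) \<cdot> ?c (P m) (P n \<boxdot> P k) = ?c (P m) (P (n + k)) \<cdot> (?i (P m) \<boxtimes> \<phi> n k)"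
    by (simp add: braid_natural')
  also have "\<phi> (n + k) m \<cdot> \<dots> \<cdot> ?a (P m) (P n) (P k)
      = (B m (n + k) \<cdot> \<phi> m (n + k)) \<cdot> (?i (P m) \<boxtimes> \<phi> n k) \<cdot> ?a (P m) (P n) (P k)"
    unfolding B_\<phi> by simp
  also have "\<dots> = B m (n + k) \<cdot> \<Phi> m n k"
    by (simp add: \<Phi>'_def flip: \<Phi>'_assoc)
  finally show "B m (n + k) \<cdot> \<Phi> m n k
    = (T n (m + k) (?i (P n)) (B m k) \<cdot> T (m + n) k (B m n) (?i (P k))) \<cdot> \<Phi> m n k" ..
qed (simp_all add: ac_simps)

lemma B_hexagon2:
  "B (m + n) k = T (m + k) n (B m k) (Ident C (P n)) \<cdot> T m (n + k) (Ident C (P m)) (B n k)"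
proof (rule iso_cancel_right)
  let ?a = "\<lambda>X Y Z. Inverse C (assoc C X Y Z)" and ?c = "braid C" and ?i = "Ident C"
  have "(T (m + k) n (B m k) (?i (P n)) \<cdot> T m (n + k) (?i (P m)) (B n k)) \<cdot> \<Phi>' m n k
      = T (m + k) n (B m k) (?i (P n)) \<cdot> (T m (n + k) (?i (P m)) (B n k) \<cdot> \<Phi>' m n k)"
    by (rule Comp_assoc_simp) (simp_all add: ac_simps)
  also have "\<dots> = (T (m + k) n (B m k) (?i (P n)) \<cdot> \<Phi> m k n) \<cdot> ?a (P m) (P k) (P n) \<cdot> (?i (P m) \<boxtimes> ?c (P n) (P k))"
    unfolding B_right_\<Phi>' by (simp flip: \<Phi>_assoc_Inverse)
  also have "\<dots> = \<Phi> k m n \<cdot> (?c (P m) (P k) \<boxtimes> ?i (P n)) \<cdot> ?a (P m) (P k) (P n) \<cdot> (?i (P m) \<boxtimes> ?c (P n) (P k))"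
    unfolding B_left_\<Phi> by simp
  also have "\<dots> = \<Phi> k m n \<cdot> ?a (P k) (P m) (P n) \<cdot> ?c (P m \<boxdot> P n) (P k) \<cdot> ?a (P m) (P n) (P k)"
    by (simp only: hexagon2[OF P_Obj P_Obj P_Obj])
  also have "\<dots> = (\<Phi> k m n \<cdot> ?a (P k) (P m) (P n)) \<cdot> ?c (P m \<boxdot> P n) (P k) \<cdot> ?a (P m) (P n) (P k)"
    by simp
  also have "\<dots> = \<phi> k (m + n) \<cdot> ((?i (P k) \<boxtimes> \<phi> m n) \<cdot> ?c (P m \<boxdot> P n) (P k)) \<cdot> ?a (P m) (P n) (P k)"
    unfolding \<Phi>_assoc_Inverse by (simp add: \<Phi>'_def)
  also have "(?i (P k) \<boxtimes> \<phi> m n) \<cdot> ?c (P m \<boxdot> P n) (P k) = ?c (P (m + n)) (P k) \<cdot> (\<phi> m n \<boxtimes> ?i (P k))"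
    by (simp add: braid_natural')
  also have "\<phi> k (m + n) \<cdot> \<dots> \<cdot> ?a (P m) (P n) (P k)
      = (B (m + n) k \<cdot> \<phi> (m + n) k) \<cdot> (\<phi> m n \<boxtimes> ?i (P k)) \<cdot> ?a (P m) (P n) (P k)"
    unfolding B_\<phi> by simp
  also have "\<dots> = B (m + n) k \<cdot> \<Phi>' m n k"
    by (simp add: \<Phi>_def flip: \<Phi>_assoc_Inverse)
  finally show "B (m + n) k \<cdot> \<Phi>' m n k
    = (T (m + k) n (B m k) (?i (P n)) \<cdot> T m (n + k) (?i (P m)) (B n k)) \<cdot> \<Phi>' m n k" ..
qed (simp_all add: ac_simps)

lemma iso_idempotent:
  assumes "x = x \<cdot> x" "is_iso C x" "Dom C x = X" "Cod C x = X"
  shows "x = Ident C X"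
proof (rule iso_cancel_left)
  show "x \<cdot> x = x \<cdot> Ident C X" using assms by (simp flip: assms(1))
  have "X \<in> Obj C" using assms(2,3) Dom_Obj[of x] by auto
  then show "Ident C X \<in> Arr C" "Cod C (Ident C X) = Dom C x" using assms by simp_all
qed (use assms in simp_all)

lemma B_zero_right: "B m 0 = Ident C (P m)"
  using B_hexagon1[of m 0 0] iso_idempotent[of "B m 0"]
  by (simp add: T_unit_left T_unit_right)

lemma B_zero_left: "B 0 m = Ident C (P m)"
  using B_hexagon2[of 0 0 m] iso_idempotent[of "B 0 m"]
  by (simp add: T_unit_left T_unit_right)

text \<open>The braiding of \<open>P 1\<close> with itself, acting at the places \<open>i\<close> and \<open>i + 1\<close>.\<close>

definition gen :: "nat \<Rightarrow> nat \<Rightarrow> 'a"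
  where "gen n i =
    T (i + 1) (n - (i + 1)) (T (i - 1) 2 (Ident C (P (i - 1))) (B 1 1)) (Ident C (P (n - (i + 1))))"

lemma gen_simps [simp]:
  assumes "1 \<le> i" "i < n"
  shows "gen n i \<in> Arr C" "Dom C (gen n i) = P n" "Cod C (gen n i) = P n" "is_iso C (gen n i)"
proof -
  have e: "i - 1 + 2 = i + 1" "i + 1 + (n - (i + 1)) = n" "Suc (Suc 0) = 2" using assms by auto
  let ?x = "T (i - 1) 2 (Ident C (P (i - 1))) (B 1 1)"
  have b: "endo 2 (B 1 1)" by (simp add: numeral_2_eq_2)
  have x: "endo (i + 1) ?x" "is_iso C ?x"
    using T_simps[of "Ident C (P (i - 1))" "i - 1" "B 1 1" 2] b unfolding e by simp_all
  show "gen n i \<in> Arr C" "Dom C (gen n i) = P n" "Cod C (gen n i) = P n" "is_iso C (gen n i)"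
    using T_simps[of ?x "i + 1" "Ident C (P (n - (i + 1)))" "n - (i + 1)"] x
    unfolding gen_def e by simp_all
qed

lemma endo_B11: "endo 2 (B 1 1)"
  by (simp add: numeral_2_eq_2)

text \<open>
  Thanks to strict associativity, generators are stable under padding by identities on either side.
  Therefore all relations between them need to be verified only where they first occur, on two or
  three factors.
\<close>

lemma gen_add_right:
  assumes "1 \<le> i" "i < m"
  shows "gen (m + k) i = T m k (gen m i) (Ident C (P k))"
proof -
  obtain r where r: "m = i + 1 + r" using assms by (metis Suc_eq_plus1 Suc_leI le_Suc_ex)
  let ?x = "T (i - 1) 2 (Ident C (P (i - 1))) (B 1 1)"
  have x: "endo (i + 1) ?x"
    using T_simps[of "Ident C (P (i - 1))" "i - 1" "B 1 1" 2] endo_B11 assms by simp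
  have "T (i + 1 + r) k (T (i + 1) r ?x (Ident C (P r))) (Ident C (P k))
      = T (i + 1) (r + k) ?x (T r k (Ident C (P r)) (Ident C (P k)))"
    by (rule T_assoc) (use x in simp_all)
  then show ?thesis by (simp add: gen_def r T_Ident)
qed

lemma gen_add_left:
  assumes "1 \<le> i" "i < k"
  shows "gen (m + k) (m + i) = T m k (Ident C (P m)) (gen k i)"
proof -
  obtain r where r: "k = i + 1 + r" using assms by (metis Suc_eq_plus1 Suc_leI le_Suc_ex)
  obtain j where j: "i = Suc j" using assms by (cases i) auto
  let ?x = "T j 2 (Ident C (P j)) (B 1 1)"
  have x: "endo (j + 2) ?x" using endo_B11 by simp
  have 1: "T (m + j) 2 (T m j (Ident C (P m)) (Ident C (P j))) (B 1 1) = T m (j + 2) (Ident C (P m)) ?x"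
    by (rule T_assoc) (use endo_B11 in simp_all)
  have 2: "T (m + (j + 2)) r (T m (j + 2) (Ident C (P m)) ?x) (Ident C (P r))
      = T m (j + 2 + r) (Ident C (P m)) (T (j + 2) r ?x (Ident C (P r)))"
    by (rule T_assoc) (use x in simp_all)
  show ?thesis using 1 2 by (simp add: gen_def r j T_Ident)
qed

lemma gen_3: "gen 3 1 = T 2 1 (B 1 1) (Ident C (P 1))" "gen 3 2 = T 1 2 (Ident C (P 1)) (B 1 1)"
proof -
  have "endo 3 (T 1 2 (Ident C (P 1)) (B 1 1))"
    using T_simps[of "Ident C (P 1)" 1 "B 1 1" 2] endo_B11
    by (simp add: numeral_2_eq_2 numeral_3_eq_3)
  then show "gen 3 1 = T 2 1 (B 1 1) (Ident C (P 1))" "gen 3 2 = T 1 2 (Ident C (P 1)) (B 1 1)"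
    using endo_B11 by (simp_all add: gen_def T_unit_left T_unit_right numeral_2_eq_2)
qed

lemma gen_pad:
  assumes "j = 1 \<or> j = 2"
  shows "gen (i + (3 + r)) (i + j) = T i (3 + r) (Ident C (P i)) (T 3 r (gen 3 j) (Ident C (P r)))"
proof -
  have "gen (i + (3 + r)) (i + j) = T i (3 + r) (Ident C (P i)) (gen (3 + r) j)"
    by (rule gen_add_left) (use assms in auto)
  also have "gen (3 + r) j = T 3 r (gen 3 j) (Ident C (P r))"
    by (rule gen_add_right) (use assms in auto)
  finally show ?thesis .
qed

lemma pad_Comp:
  assumes "endo 3 x" "endo 3 y"
  shows "T i (3 + r) (Ident C (P i)) (T 3 r (x \<cdot> y) (Ident C (P r)))
    = T i (3 + r) (Ident C (P i)) (T 3 r x (Ident C (P r))) \<cdot> T i (3 + r) (Ident C (P i)) (T 3 r y (Ident C (P r)))"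
  using assms T_Comp[of y 3 x "Ident C (P r)" r "Ident C (P r)"]
    T_Comp[of "Ident C (P i)" i "Ident C (P i)" "T 3 r y (Ident C (P r))" "3 + r" "T 3 r x (Ident C (P r))"]
  by simp

text \<open>
  The first hexagon expresses \<open>c\<^sub>1\<^sub>,\<^sub>2\<close> through the two generators, and the naturality of \<open>c\<^sub>1\<^sub>,\<^sub>2\<close> with
  respect to \<open>c\<^sub>1\<^sub>,\<^sub>1\<close> in the second argument is the braid relation.
\<close>

lemma yang_baxter: "gen 3 1 \<cdot> gen 3 2 \<cdot> gen 3 1 = gen 3 2 \<cdot> gen 3 1 \<cdot> gen 3 2"
proof -
  have b: "B 1 2 = gen 3 2 \<cdot> gen 3 1"
    using B_hexagon1[of 1 1 1] unfolding gen_3 by (simp add: numeral_2_eq_2)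
  have "B 1 2 \<cdot> gen 3 2 = gen 3 1 \<cdot> B 1 2"
    using B_natural[of "Ident C (P 1)" 1 "B 1 1" 2] endo_B11 unfolding gen_3 by simp
  then show ?thesis unfolding b by simp
qed

lemma group_Aut_P: "group (Aut C (P n))"
  by (simp add: group_Aut)

lemma braid_rep_gen: "braid_rep (Aut C (P n)) n (gen n)"
proof (intro braid_rep.intro group_Aut_P braid_rep_axioms.intro)
  fix i assume i: "1 \<le> i" "i < n"
  then show "gen n i \<in> carrier (Aut C (P n))" by (simp add: Aut_carrier)
next
  fix i j assume ij: "1 \<le> i" "i + 2 \<le> j" "j < n"
  define k l where "k = n - (i + 1)" and "l = j - (i + 1)"
  have kl: "n = i + 1 + k" "j = i + 1 + l" "1 \<le> l" "l < k" using ij by (auto simp: k_def l_def)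
  have "gen n i = T (i + 1) k (gen (i + 1) i) (Ident C (P k))"
    unfolding kl(1) by (rule gen_add_right) (use ij in auto)
  moreover have "gen n j = T (i + 1) k (Ident C (P (i + 1))) (gen k l)"
    unfolding kl(1,2) by (rule gen_add_left) (use kl in auto)
  ultimately show "gen n i \<otimes>\<^bsub>Aut C (P n)\<^esub> gen n j = gen n j \<otimes>\<^bsub>Aut C (P n)\<^esub> gen n i"
    using kl ij by (simp flip: T_Comp)
next
  fix i assume i: "1 \<le> i" "Suc i < n"
  define j r where "j = i - 1" and "r = n - (i + 2)"
  have n: "n = j + (3 + r)" "i = j + 1" "Suc i = j + 2" using i by (auto simp: j_def r_def)
  define x y where "x = gen 3 1" and "y = gen 3 2"
  have xy: "endo 3 x" "endo 3 y" by (simp_all add: x_def y_def)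
  let ?pad = "\<lambda>z. T j (3 + r) (Ident C (P j)) (T 3 r z (Ident C (P r)))"
  have g: "gen n i = ?pad x" "gen n (Suc i) = ?pad y"
    using gen_pad[of 1 j r] gen_pad[of 2 j r] unfolding x_def y_def n(1) n(3)
    by (simp_all only: n(2)) simp_all
  have "?pad (x \<cdot> y \<cdot> x) = ?pad (y \<cdot> x \<cdot> y)"
    using yang_baxter by (simp only: x_def y_def)
  then show "gen n i \<otimes>\<^bsub>Aut C (P n)\<^esub> (gen n (Suc i) \<otimes>\<^bsub>Aut C (P n)\<^esub> gen n i)
      = gen n (Suc i) \<otimes>\<^bsub>Aut C (P n)\<^esub> (gen n i \<otimes>\<^bsub>Aut C (P n)\<^esub> gen n (Suc i))"
    using xy by (simp add: g pad_Comp)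
qed

definition act :: "nat \<Rightarrow> braid_word \<Rightarrow> 'a"
  where "act n w = weval (Aut C (P n)) (gen n) w"

lemma act_simps [simp]:
  assumes "w \<in> braid_words n"
  shows "act n w \<in> Arr C" "Dom C (act n w) = P n" "Cod C (act n w) = P n" "is_iso C (act n w)"
  using braid_rep.ev_closed[OF braid_rep_gen assms] by (auto simp: act_def Aut_carrier)

lemma act_Nil [simp]: "act n [] = Ident C (P n)"
  by (simp add: act_def)

lemma act_append:
  "u \<in> braid_words n \<Longrightarrow> v \<in> braid_words n \<Longrightarrow> act n (u @ v) = act n u \<cdot> act n v"
  using braid_rep.ev_append[OF braid_rep_gen, of u n v] by (simp add: act_def)

lemma act_Cons:
  assumes "1 \<le> i" "i < n"
  shows "act n ((i, e) # w) = (if e then gen n i else Inverse C (gen n i)) \<cdot> act n w"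
  using assms by (simp add: act_def inv_Aut Aut_carrier)

lemma T_Inverse:
  assumes "endo m f" "endo n g" "is_iso C f" "is_iso C g"
  shows "T m n (Inverse C f) (Inverse C g) = Inverse C (T m n f g)"
proof (rule Inverse_eqI[symmetric])
  show "inverse_arrows C (T m n f g) (T m n (Inverse C f) (Inverse C g))"
    using assms by (simp add: inverse_arrows_def Hom_iff T_Ident flip: T_Comp)
qed

lemma act_add_right:
  assumes "w \<in> braid_words m"
  shows "act (m + k) w = T m k (act m w) (Ident C (P k))"
  using assms
proof (induction w)
  case Nil
  then show ?case by (simp add: T_Ident)
next
  case (Cons x w)
  obtain i e where x: "x = (i, e)" by (cases x)
  have i: "1 \<le> i" "i < m" and w: "w \<in> braid_words m" using Cons.prems x by auto
  have "(if e then gen (m + k) i else Inverse C (gen (m + k) i))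
      = T m k (if e then gen m i else Inverse C (gen m i)) (Ident C (P k))"
    using T_Inverse[of "gen m i" m "Ident C (P k)" k] i by (simp add: gen_add_right)
  moreover have "endo m (if e then gen m i else Inverse C (gen m i))" using i by simp
  ultimately show ?case
    using Cons.IH[OF w] i w T_Comp[of "act m w" m "if e then gen m i else Inverse C (gen m i)" "Ident C (P k)" k "Ident C (P k)"]
    by (simp add: x act_Cons)
qed

lemma act_add_left:
  assumes "w \<in> braid_words k"
  shows "act (m + k) (shift_word m w) = T m k (Ident C (P m)) (act k w)"
  using assms
proof (induction w)
  case Nil
  then show ?case by (simp add: T_Ident)
next
  case (Cons x w)
  obtain i e where x: "x = (i, e)" by (cases x)
  have i: "1 \<le> i" "i < k" and w: "w \<in> braid_words k" using Cons.prems x by auto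
  have "(if e then gen (m + k) (m + i) else Inverse C (gen (m + k) (m + i)))
      = T m k (Ident C (P m)) (if e then gen k i else Inverse C (gen k i))"
    using T_Inverse[of "Ident C (P m)" m "gen k i" k] i by (simp add: gen_add_left)
  moreover have "endo k (if e then gen k i else Inverse C (gen k i))" using i by simp
  ultimately show ?case
    using Cons.IH[OF w] i w T_Comp[of "Ident C (P m)" m "Ident C (P m)" "act k w" k "if e then gen k i else Inverse C (gen k i)"]
    by (simp add: x act_Cons)
qed

lemma act_juxtapose:
  assumes "u \<in> braid_words m" "v \<in> braid_words k"
  shows "act (m + k) (u @ shift_word m v) = T m k (act m u) (act k v)"
proof -
  have "act (m + k) (u @ shift_word m v) = act (m + k) u \<cdot> act (m + k) (shift_word m v)"
    using assms braid_words_mono[of m "m + k" u] by (simp add: act_append)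
  then show ?thesis
    using assms by (simp add: act_add_right act_add_left flip: T_Comp)
qed

lemma act_desc: "act (1 + k) (desc 1 (k + 1)) = B 1 k"
proof (induction k)
  case 0
  then show ?case by (simp add: B_zero_right)
next
  case (Suc k)
  have s: "desc 1 (Suc k + 1) = (Suc k, True) # desc 1 (k + 1)" by simp
  have g: "gen (k + (1 + 1)) (k + 1) = T k (1 + 1) (Ident C (P k)) (gen 2 1)"
    using gen_add_left[of 1 2 k] by (simp add: numeral_2_eq_2)
  have g2: "gen 2 1 = B 1 1"
    using endo_B11 by (simp add: gen_def T_unit_left T_unit_right numeral_2_eq_2)
  have "act (1 + k + 1) (desc 1 (k + 1)) = T (1 + k) 1 (B 1 k) (Ident C (P 1))"
    using act_add_right[of "desc 1 (k + 1)" "1 + k" 1] Suc.IH by simp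
  then have "act (1 + Suc k) (desc 1 (Suc k + 1)) = T k (1 + 1) (Ident C (P k)) (B 1 1) \<cdot> T (1 + k) 1 (B 1 k) (Ident C (P 1))"
    unfolding s using g g2 by (simp add: act_Cons)
  then show ?case using B_hexagon1[of 1 k 1] by simp
qed

text \<open>
  The braiding words satisfy the same recursion as the braidings, the latter by the hexagons.
\<close>

lemma act_braiding_word: "act (m + k) (braiding_word m k) = B m k"
proof (induction m)
  case 0
  then show ?case by (simp add: B_zero_left)
next
  case (Suc m)
  have s: "braiding_word (Suc m) k = braiding_word m k @ shift_word m (desc 1 (k + 1))"
    by (simp add: braiding_word_Suc shift_word_desc add.commute del: desc_simps)
  have "act (Suc m + k) (braiding_word m k) = T (m + k) 1 (B m k) (Ident C (P 1))"
    using act_add_right[of "braiding_word m k" "m + k" 1] Suc.IH by simp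
  moreover have "act (Suc m + k) (shift_word m (desc 1 (k + 1))) = T m (1 + k) (Ident C (P m)) (B 1 k)"
    using act_add_left[of "desc 1 (k + 1)" "1 + k" m] act_desc[of k] by simp
  moreover have "braiding_word m k \<in> braid_words (Suc m + k)"
    using braid_words_mono[of "m + k" "Suc m + k"] by simp
  moreover have "shift_word m (desc 1 (k + 1)) \<in> braid_words (Suc m + k)"
    using shift_word_in[of "desc 1 (k + 1)" "Suc k" m] by (simp del: desc_simps)
  ultimately show ?case
    using B_hexagon2[of m 1 k] unfolding s by (simp add: act_append del: desc_simps)
qed

end

locale pseudosymmetric_family = braided_family C P \<phi> \<phi>0 + pseudosymmetric_braided_category C
  for C :: "('o, 'a, 'x) braided_category_scheme" (structure)
    and P :: "nat \<Rightarrow> 'o" and \<phi> :: "nat \<Rightarrow> nat \<Rightarrow> 'a" and \<phi>0 :: 'a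
begin

text \<open>
  This is pseudosymmetry for \<open>U = V = W = P 1\<close>, transported along the comparison maps for three
  factors.
\<close>

lemma gen_3_pseudosymmetric:
  "gen 3 1 \<cdot> Inverse C (gen 3 2) \<cdot> gen 3 1 = gen 3 2 \<cdot> Inverse C (gen 3 1) \<cdot> gen 3 2"
proof -
  let ?i = "Ident C (P 1)" and ?c = "braid C (P 1) (P 1)" and ?a = "assoc C (P 1) (P 1) (P 1)"
  define x y f g where "x = gen 3 1" and "y = gen 3 2" and "f = \<Phi> 1 1 1" and "g = \<Phi>' 1 1 1"
  have xy [simp]: "endo 3 x" "endo 3 y" "is_iso C x" "is_iso C y"
    by (simp_all add: x_def y_def)
  have fg [simp]: "is_iso C f" "is_iso C g" "f \<in> Arr C" "g \<in> Arr C" "Cod C f = P 3" "Cod C g = P 3"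
    "Dom C f = (P 1 \<boxdot> P 1) \<boxdot> P 1" "Dom C g = P 1 \<boxdot> (P 1 \<boxdot> P 1)"
    by (simp_all add: f_def g_def numeral_3_eq_3)
  have ga: "g \<cdot> ?a = f" unfolding f_def g_def by (rule \<Phi>'_assoc)
  have fa: "f \<cdot> Inverse C ?a = g" unfolding f_def g_def by (rule \<Phi>_assoc_Inverse)
  have xf: "f \<cdot> (?c \<boxtimes> ?i) = x \<cdot> f"
    using B_left_\<Phi>[of 1 1 1] unfolding x_def f_def gen_3 by (simp add: numeral_2_eq_2)
  have yg: "g \<cdot> (?i \<boxtimes> ?c) = y \<cdot> g"
    using B_right_\<Phi>'[of 1 1 1] unfolding y_def g_def gen_3 by (simp add: numeral_2_eq_2)
  have xf': "f \<cdot> (Inverse C ?c \<boxtimes> ?i) = Inverse C x \<cdot> f"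
  proof (rule iso_cancel_left[of x])
    have "x \<cdot> f \<cdot> (Inverse C ?c \<boxtimes> ?i) = (x \<cdot> f) \<cdot> (Inverse C ?c \<boxtimes> ?i)" by simp
    also have "\<dots> = (f \<cdot> (?c \<boxtimes> ?i)) \<cdot> (Inverse C ?c \<boxtimes> ?i)" by (simp only: xf)
    finally have "x \<cdot> f \<cdot> (Inverse C ?c \<boxtimes> ?i) = (f \<cdot> (?c \<boxtimes> ?i)) \<cdot> (Inverse C ?c \<boxtimes> ?i)" .
    then show "x \<cdot> f \<cdot> (Inverse C ?c \<boxtimes> ?i) = x \<cdot> Inverse C x \<cdot> f"
      by (simp add: interchange)
  qed simp_all
  have yg': "g \<cdot> (?i \<boxtimes> Inverse C ?c) = Inverse C y \<cdot> g"
  proof (rule iso_cancel_left[of y])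
    have "y \<cdot> g \<cdot> (?i \<boxtimes> Inverse C ?c) = (y \<cdot> g) \<cdot> (?i \<boxtimes> Inverse C ?c)" by simp
    also have "\<dots> = (g \<cdot> (?i \<boxtimes> ?c)) \<cdot> (?i \<boxtimes> Inverse C ?c)" by (simp only: yg)
    finally have "y \<cdot> g \<cdot> (?i \<boxtimes> Inverse C ?c) = (g \<cdot> (?i \<boxtimes> ?c)) \<cdot> (?i \<boxtimes> Inverse C ?c)" .
    then show "y \<cdot> g \<cdot> (?i \<boxtimes> Inverse C ?c) = y \<cdot> Inverse C y \<cdot> g"
      by (simp add: interchange)
  qed simp_all
  \<comment> \<open>Each of these moves one factor of the pseudosymmetry equation past the comparison isomorphism.\<close>
  have m: "g \<cdot> ?a \<cdot> h = f \<cdot> h" "f \<cdot> (?c \<boxtimes> ?i) \<cdot> h = x \<cdot> f \<cdot> h"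
    "f \<cdot> (Inverse C ?c \<boxtimes> ?i) \<cdot> h = Inverse C x \<cdot> f \<cdot> h"
    if "h \<in> Arr C" "Cod C h = (P 1 \<boxdot> P 1) \<boxdot> P 1" for h
    using that arg_cong[OF ga, of "\<lambda>t. t \<cdot> h"] arg_cong[OF xf, of "\<lambda>t. t \<cdot> h"]
      arg_cong[OF xf', of "\<lambda>t. t \<cdot> h"]
    by simp_all
  have m': "f \<cdot> Inverse C ?a \<cdot> h = g \<cdot> h" "g \<cdot> (?i \<boxtimes> ?c) \<cdot> h = y \<cdot> g \<cdot> h"
    "g \<cdot> (?i \<boxtimes> Inverse C ?c) \<cdot> h = Inverse C y \<cdot> g \<cdot> h"
    if "h \<in> Arr C" "Cod C h = P 1 \<boxdot> (P 1 \<boxdot> P 1)" for h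
    using that arg_cong[OF fa, of "\<lambda>t. t \<cdot> h"] arg_cong[OF yg, of "\<lambda>t. t \<cdot> h"]
      arg_cong[OF yg', of "\<lambda>t. t \<cdot> h"]
    by simp_all
  have "(x \<cdot> Inverse C y \<cdot> x) \<cdot> f = g \<cdot> ?a \<cdot> (?c \<boxtimes> ?i) \<cdot> Inverse C ?a
      \<cdot> (?i \<boxtimes> Inverse C ?c) \<cdot> ?a \<cdot> (?c \<boxtimes> ?i)"
    by (simp add: m m' xf del: One_nat_def)
  also have "\<dots> = g \<cdot> (?i \<boxtimes> ?c) \<cdot> ?a \<cdot> (Inverse C ?c \<boxtimes> ?i) \<cdot> Inverse C ?a \<cdot> (?i \<boxtimes> ?c) \<cdot> ?a"
    by (simp only: pseudosymmetry[OF P_Obj P_Obj P_Obj])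
  also have "\<dots> = (y \<cdot> Inverse C x \<cdot> y) \<cdot> f"
    by (simp add: m m' ga del: One_nat_def)
  finally have "x \<cdot> Inverse C y \<cdot> x = y \<cdot> Inverse C x \<cdot> y"
    by (rule iso_cancel_right) simp_all
  then show ?thesis by (simp only: x_def y_def)
qed

lemma pseudosymmetric_braid_rep_gen: "pseudosymmetric_braid_rep (Aut C (P n)) n (gen n)"
proof (intro pseudosymmetric_braid_rep.intro braid_rep_gen pseudosymmetric_braid_rep_axioms.intro)
  fix i assume i: "1 \<le> i" "Suc i < n"
  interpret A: group "Aut C (P n)" by (rule group_Aut_P)
  interpret A3: group "Aut C (P 3)" by (rule group_Aut_P)
  define j r where "j = i - 1" and "r = n - (i + 2)"
  have n: "n = j + (3 + r)" "i = j + 1" "Suc i = j + 2" using i by (auto simp: j_def r_def)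
  define x y where "x = gen 3 1" and "y = gen 3 2"
  have xy: "endo 3 x" "endo 3 y" "x \<in> carrier (Aut C (P 3))" "y \<in> carrier (Aut C (P 3))"
    by (simp_all add: x_def y_def Aut_carrier)
  let ?pad = "\<lambda>z. T j (3 + r) (Ident C (P j)) (T 3 r z (Ident C (P r)))"
  have g: "gen n i = ?pad x" "gen n (Suc i) = ?pad y"
    using gen_pad[of 1 j r] gen_pad[of 2 j r] unfolding x_def y_def n(1) n(3)
    by (simp_all only: n(2)) simp_all
  have "A3.commutes (x \<otimes>\<^bsub>Aut C (P 3)\<^esub> x) (y \<otimes>\<^bsub>Aut C (P 3)\<^esub> y)"
    by (rule A3.pseudosymmetric_imp_squares_commute)
      (use xy yang_baxter gen_3_pseudosymmetric in \<open>simp_all add: inv_Aut del: One_nat_def flip: x_def y_def\<close>)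
  then have "?pad ((x \<cdot> x) \<cdot> (y \<cdot> y)) = ?pad ((y \<cdot> y) \<cdot> (x \<cdot> x))"
    by (simp only: A3.commutes_def Aut_simps)
  then show "A.commutes (gen n i \<otimes>\<^bsub>Aut C (P n)\<^esub> gen n i) (gen n (Suc i) \<otimes>\<^bsub>Aut C (P n)\<^esub> gen n (Suc i))"
    using xy by (simp add: g A.commutes_def pad_Comp)
qed

text \<open>
  Here pseudosymmetry takes effect: squares of adjacent generators commute, so commutators of pure
  braids act trivially.
\<close>

theorem act_eq_if_PS_class_eq:
  "\<lbrakk>PS_class n u = PS_class n v; u \<in> braid_words n; v \<in> braid_words n\<rbrakk> \<Longrightarrow> act n u = act n v"
  unfolding act_def
  by (rule pseudosymmetric_braid_rep.ev_eq_if_PS_class_eq[OF pseudosymmetric_braid_rep_gen])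

end


section \<open>Braided functors from \<open>PS\<close> and monoidal families\<close>

interpretation PS: braided_category PS
  by (rule braided_category_PS)

lemma braided_family_of_functor:
  assumes "braided_functor PS C F"
  shows "braided_family C (on_Obj F) (phi2 F) (phi0 F)"
proof -
  interpret braided_functor PS C F by fact
  have [simp]: "on_Arr F (PS_arrow n []) = Ident C (on_Obj F n)" for n
    using on_Arr_Ident[of n] by simp
  have o [simp]: "on_Obj F n \<in> Obj C" for n
    using on_Obj_Obj[of n] by simp
  have p [simp]: "phi2 F m n \<in> Arr C" "Dom C (phi2 F m n) = on_Obj F m \<boxdot>\<^bsub>C\<^esub> on_Obj F n"
    "Cod C (phi2 F m n) = on_Obj F (m + n)" for m n
    using phi2_Hom[of m n] by (simp_all add: Hom_iff)
  have p0 [simp]: "phi0 F \<in> Arr C" "Dom C (phi0 F) = Unit C" "Cod C (phi0 F) = on_Obj F 0"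
    using phi0_Hom by (simp_all add: Hom_iff)
  show ?thesis
  proof unfold_locales
    fix m n k
    show "phi2 F m (n + k) \<cdot>\<^bsub>C\<^esub> (Ident C (on_Obj F m) \<boxtimes>\<^bsub>C\<^esub> phi2 F n k) \<cdot>\<^bsub>C\<^esub> assoc C (on_Obj F m) (on_Obj F n) (on_Obj F k)
      = phi2 F (m + n) k \<cdot>\<^bsub>C\<^esub> (phi2 F m n \<boxtimes>\<^bsub>C\<^esub> Ident C (on_Obj F k))"
      using phi2_assoc[of m n k] by simp
    show "phi2 F 0 n \<cdot>\<^bsub>C\<^esub> (phi0 F \<boxtimes>\<^bsub>C\<^esub> Ident C (on_Obj F n)) = lunit C (on_Obj F n)"
      using phi2_lunit[of n] by simp
    show "phi2 F n 0 \<cdot>\<^bsub>C\<^esub> (Ident C (on_Obj F n) \<boxtimes>\<^bsub>C\<^esub> phi0 F) = runit C (on_Obj F n)"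
      using phi2_runit[of n] by simp
    show "is_iso C (phi2 F m n)" using phi2_iso[of m n] by simp
  qed (simp_all add: phi0_iso Hom_iff)
qed

text \<open>
  A generator of \<open>PS\<^sub>n\<close> is a braiding tensored with identities, so the value of a braided functor on
  it, and hence on every arrow, is forced by its monoidal family.
\<close>

lemma braided_functor_on_Arr:
  assumes "braided_functor PS C F" "w \<in> braid_words n"
  shows "on_Arr F (PS_arrow n w) = braided_family.act C (on_Obj F) (phi2 F) n w"
proof -
  interpret braided_functor PS C F by fact
  interpret fam: braided_family C "on_Obj F" "phi2 F" "phi0 F"
    by (rule braided_family_of_functor) fact
  have id: "on_Arr F (PS_arrow n []) = Ident C (on_Obj F n)" for n
    using on_Arr_Ident[of n] by simp
  have endo: "fam.endo n (on_Arr F (PS_arrow n u))" if "u \<in> braid_words n" for n u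
    using that on_Arr_Hom[of "PS_arrow n u" n n] by (simp add: Hom_iff)
  have tens: "on_Arr F (PS_arrow (m + n) (u @ shift_word m v))
      = fam.T m n (on_Arr F (PS_arrow m u)) (on_Arr F (PS_arrow n v))"
    if uv: "u \<in> braid_words m" "v \<in> braid_words n" for m n u v
  proof (rule fam.T_unique)
    show "on_Arr F (PS_arrow (m + n) (u @ shift_word m v)) \<cdot>\<^bsub>C\<^esub> phi2 F m n
        = phi2 F m n \<cdot>\<^bsub>C\<^esub> (on_Arr F (PS_arrow m u) \<boxtimes>\<^bsub>C\<^esub> on_Arr F (PS_arrow n v))"
      using phi2_natural[of "PS_arrow m u" m m "PS_arrow n v" n n] uv by simp
    have "u @ shift_word m v \<in> braid_words (m + n)"
      using uv braid_words_mono[of m "m + n"] by simp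
    then show "fam.endo (m + n) (on_Arr F (PS_arrow (m + n) (u @ shift_word m v)))"
      by (rule endo)
  qed (use uv endo in simp_all)
  have "braiding_word 1 1 = [(1, True)]" by (simp add: braiding_word_eq)
  then have b: "on_Arr F (PS_arrow 2 [(1, True)]) = fam.B 1 1"
    using on_Arr_braid[of 1 1] endo[of "[(1, True)]" 2]
    by (intro fam.B_unique) (simp_all add: numeral_2_eq_2)
  have gen: "on_Arr F (PS_arrow n [(i, True)]) = fam.gen n i" if i: "1 \<le> i" "i < n" for i
  proof -
    have e: "i - 1 + 2 = i + 1" "i + 1 + (n - (i + 1)) = n" "i - 1 + 1 = i" using i by auto
    have "on_Arr F (PS_arrow (i + 1) [(i, True)]) = fam.T (i - 1) 2 (Ident C (on_Obj F (i - 1))) (fam.B 1 1)"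
      using tens[of "[]" "i - 1" "[(1, True)]" 2] i unfolding e b id by (simp add: id b)
    then show ?thesis
      using tens[of "[(i, True)]" "i + 1" "[]" "n - (i + 1)"] i unfolding e
      by (simp add: id fam.gen_def)
  qed
  show ?thesis using assms(2)
  proof (induction w)
    case Nil
    then show ?case by (simp add: id)
  next
    case (Cons x w)
    obtain i e where x: "x = (i, e)" by (cases x)
    have i: "1 \<le> i" "i < n" and w: "w \<in> braid_words n" using Cons.prems x by auto
    have "inverse_arrows PS (PS_arrow n [(i, True)]) (PS_arrow n [(i, False)])"
      using PS_inverse_arrows[of "[(i, True)]" n] i by simp
    then have "Inverse C (on_Arr F (PS_arrow n [(i, True)])) = on_Arr F (PS_arrow n [(i, False)])"
      using on_Arr_Inverse[OF is_isoI] by (simp add: C.Inverse_eqI PS.Inverse_eqI)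
    then have "on_Arr F (PS_arrow n [x]) = (if e then fam.gen n i else Inverse C (fam.gen n i))"
      using gen[OF i] by (cases e) (simp_all add: x)
    moreover have "on_Arr F (PS_arrow n (x # w)) = on_Arr F (PS_arrow n [x]) \<cdot>\<^bsub>C\<^esub> on_Arr F (PS_arrow n w)"
      using on_Arr_Comp[of "PS_arrow n w" n n "PS_arrow n [x]" n] i w by (simp add: x)
    ultimately show ?case using Cons.IH[OF w] i by (simp add: x fam.act_Cons)
  qed
qed

context pseudosymmetric_family
begin

text \<open>
  An arrow of \<open>PS\<close> is a coset of classes of words. All words that represent it act in the same way,
  because the action factors through \<open>PS\<^sub>n\<close>.
\<close>

definition family_functor :: "(nat, nat \<times> braid_word set set, 'o, 'a) monoidal_functor"
  where "family_functor = \<lparr>on_Obj = P,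
    on_Arr = (\<lambda>f\<in>Arr PS. act (fst f) (SOME w. w \<in> braid_words (fst f) \<and> PS_arrow (fst f) w = f)),
    phi0 = \<phi>0, phi2 = \<phi>\<rparr>"

lemma family_functor_simps [simp]:
  "on_Obj family_functor = P" "phi0 family_functor = \<phi>0" "phi2 family_functor = \<phi>"
  by (simp_all add: family_functor_def)

lemma family_functor_on_Arr [simp]:
  assumes "w \<in> braid_words n"
  shows "on_Arr family_functor (PS_arrow n w) = act n w"
proof -
  let ?w = "SOME v. v \<in> braid_words n \<and> PS_arrow n v = PS_arrow n w"
  have "?w \<in> braid_words n \<and> PS_arrow n ?w = PS_arrow n w"
    by (rule someI[of _ w]) (use assms in simp)
  then have "act n ?w = act n w"
    using assms by (intro act_eq_if_PS_class_eq) (auto simp: PS_arrow_eq_iff)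
  then show ?thesis
    using assms by (simp add: family_functor_def) (simp add: PS_arrow_def)
qed

lemma braided_functor_family_functor: "braided_functor PS C family_functor"
proof unfold_locales
  fix f g U U' V V' assume "f \<in> Hom PS U U'" "g \<in> Hom PS V V'"
  then obtain u v where [simp]: "U = U'" "V = V'" "f = PS_arrow U' u" "g = PS_arrow V' v"
    and words: "u \<in> braid_words U'" "v \<in> braid_words V'"
    by (auto elim!: PS_Hom_cases)
  have "u @ shift_word U' v \<in> braid_words (U' + V')"
    using words braid_words_mono[of U' "U' + V'"] by simp
  then show "phi2 family_functor U' V' \<cdot> (on_Arr family_functor f \<boxtimes> on_Arr family_functor g)
      = on_Arr family_functor (f \<boxtimes>\<^bsub>PS\<^esub> g) \<cdot> phi2 family_functor U V"
    using words by (simp add: act_juxtapose T_\<phi>)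
next
  fix U V W
  show "phi2 family_functor U (V \<boxdot>\<^bsub>PS\<^esub> W)
      \<cdot> (Ident C (on_Obj family_functor U) \<boxtimes> phi2 family_functor V W)
      \<cdot> assoc C (on_Obj family_functor U) (on_Obj family_functor V) (on_Obj family_functor W)
    = on_Arr family_functor (assoc PS U V W) \<cdot> phi2 family_functor (U \<boxdot>\<^bsub>PS\<^esub> V) W
      \<cdot> (phi2 family_functor U V \<boxtimes> Ident C (on_Obj family_functor W))"
    using \<phi>_assoc[of U V W] by simp
next
  fix U
  show "lunit C (on_Obj family_functor U) = on_Arr family_functor (lunit PS U)
      \<cdot> phi2 family_functor (Unit PS) U \<cdot> (phi0 family_functor \<boxtimes> Ident C (on_Obj family_functor U))"
    using \<phi>_lunit[of U] by simp
  show "runit C (on_Obj family_functor U) = on_Arr family_functor (runit PS U)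
      \<cdot> phi2 family_functor U (Unit PS) \<cdot> (Ident C (on_Obj family_functor U) \<boxtimes> phi0 family_functor)"
    using \<phi>_runit[of U] by simp
next
  fix U V
  show "on_Arr family_functor (braid PS U V) \<cdot> phi2 family_functor U V
      = phi2 family_functor V U \<cdot> braid C (on_Obj family_functor U) (on_Obj family_functor V)"
    by (simp add: act_braiding_word B_\<phi>)
next
  fix f X Y assume "f \<in> Hom PS X Y"
  then obtain w where "w \<in> braid_words Y" "f = PS_arrow Y w" "X = Y"
    by (rule PS_Hom_cases)
  then show "on_Arr family_functor f \<in> Hom C (on_Obj family_functor X) (on_Obj family_functor Y)"
    by (simp add: Hom_iff)
qed (auto elim!: PS_Hom_cases simp: act_append \<phi>_Hom \<phi>0_Hom)

lemma extensional_family_functor: "extensional_functor PS family_functor"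
  by (simp add: extensional_functor_def) (simp add: family_functor_def extensional_def)

end


section \<open>Tensor powers of an object\<close>

primrec tensor_power :: "('o, 'a, 'x) monoidal_category_scheme \<Rightarrow> 'o \<Rightarrow> nat \<Rightarrow> 'o"
  where
    "tensor_power C X 0 = Unit C"
  | "tensor_power C X (Suc n) = tensor_power C X n \<boxdot>\<^bsub>C\<^esub> X"

primrec tensor_power_mult :: "('o, 'a, 'x) monoidal_category_scheme \<Rightarrow> 'o \<Rightarrow> nat \<Rightarrow> nat \<Rightarrow> 'a"
  where
    "tensor_power_mult C X m 0 = runit C (tensor_power C X m)"
  | "tensor_power_mult C X m (Suc n) = (tensor_power_mult C X m n \<boxtimes>\<^bsub>C\<^esub> Ident C X)
      \<cdot>\<^bsub>C\<^esub> Inverse C (assoc C (tensor_power C X m) (tensor_power C X n) X)"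

context monoidal_category
begin

lemma assoc_Inverse_natural:
  assumes "f \<in> Arr C" "g \<in> Arr C" "h \<in> Arr C" "Cod C f = X" "Cod C g = Y" "Cod C h = Z"
  shows "Inverse C (assoc C X Y Z) \<cdot> (f \<boxtimes> (g \<boxtimes> h))
    = ((f \<boxtimes> g) \<boxtimes> h) \<cdot> Inverse C (assoc C (Dom C f) (Dom C g) (Dom C h))"
proof -
  have XYZ: "X \<in> Obj C" "Y \<in> Obj C" "Z \<in> Obj C" using assms by auto
  let ?a = "assoc C X Y Z" and ?b = "assoc C (Dom C f) (Dom C g) (Dom C h)"
  have "Inverse C ?a \<cdot> (f \<boxtimes> (g \<boxtimes> h)) = Inverse C ?a \<cdot> ((f \<boxtimes> (g \<boxtimes> h)) \<cdot> ?b) \<cdot> Inverse C ?b"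
    using assms XYZ by simp
  also have "\<dots> = Inverse C ?a \<cdot> (?a \<cdot> ((f \<boxtimes> g) \<boxtimes> h)) \<cdot> Inverse C ?b"
    using assoc_natural'[OF assms] by simp
  also have "\<dots> = ((f \<boxtimes> g) \<boxtimes> h) \<cdot> Inverse C ?b"
    using assms XYZ by simp
  finally show ?thesis .
qed

lemma pentagon_Inverse:
  assumes [simp]: "W \<in> Obj C" "X \<in> Obj C" "Y \<in> Obj C" "Z \<in> Obj C"
  shows "Inverse C (assoc C W (X \<boxdot> Y) Z) \<cdot> (Ident C W \<boxtimes> Inverse C (assoc C X Y Z)) \<cdot> assoc C W X (Y \<boxdot> Z)
    = (assoc C W X Y \<boxtimes> Ident C Z) \<cdot> Inverse C (assoc C (W \<boxdot> X) Y Z)"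
proof (rule iso_cancel_right)
  let ?a = "assoc C"
  let ?j = "Ident C W \<boxtimes> Inverse C (?a X Y Z)"
  have "(Inverse C (?a W (X \<boxdot> Y) Z) \<cdot> ?j \<cdot> ?a W X (Y \<boxdot> Z)) \<cdot> ?a (W \<boxdot> X) Y Z
      = Inverse C (?a W (X \<boxdot> Y) Z) \<cdot> ?j \<cdot> (Ident C W \<boxtimes> ?a X Y Z) \<cdot> ?a W (X \<boxdot> Y) Z \<cdot> (?a W X Y \<boxtimes> Ident C Z)"
    by (simp add: pentagon)
  also have "\<dots> = ?a W X Y \<boxtimes> Ident C Z"
    by (simp add: interchange_assoc)
  finally show "(Inverse C (?a W (X \<boxdot> Y) Z) \<cdot> ?j \<cdot> ?a W X (Y \<boxdot> Z)) \<cdot> ?a (W \<boxdot> X) Y Z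
      = ((?a W X Y \<boxtimes> Ident C Z) \<cdot> Inverse C (?a (W \<boxdot> X) Y Z)) \<cdot> ?a (W \<boxdot> X) Y Z"
    by simp
qed simp_all

lemma tensor_power_Obj [simp]: "X \<in> Obj C \<Longrightarrow> tensor_power C X n \<in> Obj C"
  by (induction n) simp_all

lemma tensor_power_mult_simps [simp]:
  assumes "X \<in> Obj C"
  shows "is_iso C (tensor_power_mult C X m n)" "tensor_power_mult C X m n \<in> Arr C"
    "Dom C (tensor_power_mult C X m n) = tensor_power C X m \<boxdot> tensor_power C X n"
    "Cod C (tensor_power_mult C X m n) = tensor_power C X (m + n)"
proof -
  have "is_iso C (tensor_power_mult C X m n) \<and> tensor_power_mult C X m n \<in> Arr C
    \<and> Dom C (tensor_power_mult C X m n) = tensor_power C X m \<boxdot> tensor_power C X n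
    \<and> Cod C (tensor_power_mult C X m n) = tensor_power C X (m + n)"
    by (induction n) (use assms in simp_all)
  then show "is_iso C (tensor_power_mult C X m n)" "tensor_power_mult C X m n \<in> Arr C"
    "Dom C (tensor_power_mult C X m n) = tensor_power C X m \<boxdot> tensor_power C X n"
    "Cod C (tensor_power_mult C X m n) = tensor_power C X (m + n)"
    by auto
qed

text \<open>
  The induction step is an instance of the pentagon, and the base case is the coherence
  \<open>runit_Tens\<close>.
\<close>

lemma tensor_power_mult_assoc:
  assumes [simp]: "X \<in> Obj C"
  defines "P \<equiv> tensor_power C X" and "\<mu> \<equiv> tensor_power_mult C X"
  shows "\<mu> m (n + k) \<cdot> (Ident C (P m) \<boxtimes> \<mu> n k) \<cdot> assoc C (P m) (P n) (P k)
    = \<mu> (m + n) k \<cdot> (\<mu> m n \<boxtimes> Ident C (P k))"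
proof (induction k)
  case 0
  have "\<mu> m n \<cdot> ((Ident C (P m) \<boxtimes> runit C (P n)) \<cdot> assoc C (P m) (P n) (Unit C))
      = \<mu> m n \<cdot> runit C (P m \<boxdot> P n)"
    by (subst runit_Tens) (simp_all add: P_def)
  also have "\<dots> = runit C (P (m + n)) \<cdot> (\<mu> m n \<boxtimes> Ident C (Unit C))"
    by (rule runit_natural[symmetric]) (simp add: Hom_iff P_def \<mu>_def)
  finally show ?case by (simp add: P_def \<mu>_def)
next
  case (Suc k)
  note [simp] = P_def \<mu>_def
  let ?a = "assoc C" and ?i = "Ident C"
  have "\<mu> m (n + Suc k) \<cdot> (?i (P m) \<boxtimes> \<mu> n (Suc k)) \<cdot> ?a (P m) (P n) (P (Suc k))
      = (\<mu> m (n + k) \<boxtimes> ?i X) \<cdot> Inverse C (?a (P m) (P (n + k)) X)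
        \<cdot> ((?i (P m) \<boxtimes> (\<mu> n k \<boxtimes> ?i X)) \<cdot> (?i (P m) \<boxtimes> Inverse C (?a (P n) (P k) X)))
        \<cdot> ?a (P m) (P n) (P k \<boxdot> X)"
    by (simp add: interchange)
  also have "\<dots> = (\<mu> m (n + k) \<boxtimes> ?i X)
        \<cdot> (Inverse C (?a (P m) (P (n + k)) X) \<cdot> (?i (P m) \<boxtimes> (\<mu> n k \<boxtimes> ?i X)))
        \<cdot> (?i (P m) \<boxtimes> Inverse C (?a (P n) (P k) X)) \<cdot> ?a (P m) (P n) (P k \<boxdot> X)"
    by simp
  also have "\<dots> = (\<mu> m (n + k) \<boxtimes> ?i X) \<cdot> ((?i (P m) \<boxtimes> \<mu> n k) \<boxtimes> ?i X)
        \<cdot> (Inverse C (?a (P m) (P n \<boxdot> P k) X)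
        \<cdot> (?i (P m) \<boxtimes> Inverse C (?a (P n) (P k) X)) \<cdot> ?a (P m) (P n) (P k \<boxdot> X))"
    by (simp add: assoc_Inverse_natural)
  also have "\<dots> = (\<mu> m (n + k) \<boxtimes> ?i X) \<cdot> ((?i (P m) \<boxtimes> \<mu> n k) \<boxtimes> ?i X)
        \<cdot> (?a (P m) (P n) (P k) \<boxtimes> ?i X) \<cdot> Inverse C (?a (P m \<boxdot> P n) (P k) X)"
    by (simp add: pentagon_Inverse)
  also have "\<dots> = ((\<mu> m (n + k) \<cdot> (?i (P m) \<boxtimes> \<mu> n k) \<cdot> ?a (P m) (P n) (P k)) \<boxtimes> ?i X)
        \<cdot> Inverse C (?a (P m \<boxdot> P n) (P k) X)"
    by (simp add: interchange_assoc add.assoc)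
  also have "\<dots> = ((\<mu> (m + n) k \<cdot> (\<mu> m n \<boxtimes> ?i (P k))) \<boxtimes> ?i X)
        \<cdot> Inverse C (?a (P m \<boxdot> P n) (P k) X)"
    by (simp only: Suc.IH)
  also have "\<dots> = (\<mu> (m + n) k \<boxtimes> ?i X) \<cdot> (((\<mu> m n \<boxtimes> ?i (P k)) \<boxtimes> ?i X)
        \<cdot> Inverse C (?a (P m \<boxdot> P n) (P k) X))"
    by (simp add: interchange_assoc)
  also have "\<dots> = (\<mu> (m + n) k \<boxtimes> ?i X) \<cdot> (Inverse C (?a (P (m + n)) (P k) X)
        \<cdot> (\<mu> m n \<boxtimes> (?i (P k) \<boxtimes> ?i X)))"
    by (subst assoc_Inverse_natural) simp_all
  also have "\<dots> = \<mu> (m + n) (Suc k) \<cdot> (\<mu> m n \<boxtimes> ?i (P (Suc k)))"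
    by simp
  finally show ?case .
qed

lemma monoidal_family_tensor_power:
  assumes [simp]: "X \<in> Obj C"
  shows "monoidal_family C (tensor_power C X) (tensor_power_mult C X) (Ident C (Unit C))"
proof
  fix n
  let ?P = "tensor_power C X" and ?\<mu> = "tensor_power_mult C X" and ?I = "Unit C"
  \<comment> \<open>The left unit law follows from associativity, the right unit law and the triangle.\<close>
  have "?\<mu> 0 n \<cdot> (Ident C ?I \<boxtimes> ?\<mu> 0 n) \<cdot> assoc C ?I ?I (?P n)
      = ?\<mu> 0 n \<cdot> (Ident C ?I \<boxtimes> lunit C (?P n)) \<cdot> assoc C ?I ?I (?P n)"
    using tensor_power_mult_assoc[OF assms, of 0 0 n] by (simp add: triangle)
  then have "(Ident C ?I \<boxtimes> ?\<mu> 0 n) \<cdot> assoc C ?I ?I (?P n)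
      = (Ident C ?I \<boxtimes> lunit C (?P n)) \<cdot> assoc C ?I ?I (?P n)"
    by (rule iso_cancel_left) simp_all
  then have "Ident C ?I \<boxtimes> ?\<mu> 0 n = Ident C ?I \<boxtimes> lunit C (?P n)"
    by (rule iso_cancel_right) simp_all
  then have "?\<mu> 0 n = lunit C (?P n)"
    by (rule tens_Unit_cancel_left) (simp_all add: Hom_iff)
  then show "?\<mu> 0 n \<cdot> (Ident C ?I \<boxtimes> Ident C (?P n)) = lunit C (?P n)"
    by simp
qed (simp_all add: Hom_iff tensor_power_mult_assoc)

end


section \<open>Transformations between monoidal families\<close>

locale family_pair =
  P: braided_family C P \<phi> \<phi>0 + Q: braided_family C Q \<psi> \<psi>0
  for C :: "('o, 'a, 'x) braided_category_scheme" (structure)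
    and P :: "nat \<Rightarrow> 'o" and \<phi> :: "nat \<Rightarrow> nat \<Rightarrow> 'a" and \<phi>0 :: 'a
    and Q :: "nat \<Rightarrow> 'o" and \<psi> :: "nat \<Rightarrow> nat \<Rightarrow> 'a" and \<psi>0 :: 'a
begin

definition family_transformation :: "(nat \<Rightarrow> 'a) \<Rightarrow> bool"
  where "family_transformation \<eta> \<longleftrightarrow>
    (\<forall>n. \<eta> n \<in> Hom C (P n) (Q n)) \<and> \<eta> 0 \<cdot> \<phi>0 = \<psi>0 \<and>
    (\<forall>m n. \<eta> (m + n) \<cdot> \<phi> m n = \<psi> m n \<cdot> (\<eta> m \<boxtimes> \<eta> n))"

lemma family_transformation_unique:
  assumes \<eta>: "family_transformation \<eta>" and \<theta>: "family_transformation \<theta>" and 1: "\<eta> 1 = \<theta> 1"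
  shows "\<eta> n = \<theta> n"
proof (induction n)
  have [simp]: "\<eta> n \<in> Arr C" "Dom C (\<eta> n) = P n" "Cod C (\<eta> n) = Q n"
    "\<theta> n \<in> Arr C" "Dom C (\<theta> n) = P n" "Cod C (\<theta> n) = Q n" for n
    using \<eta> \<theta> by (simp_all add: family_transformation_def Hom_iff)
  case 0
  have "\<eta> 0 \<cdot> \<phi>0 = \<theta> 0 \<cdot> \<phi>0" using \<eta> \<theta> by (simp add: family_transformation_def)
  then show ?case by (rule P.iso_cancel_right) simp_all
next
  have [simp]: "\<eta> n \<in> Arr C" "Dom C (\<eta> n) = P n" "Cod C (\<eta> n) = Q n"
    "\<theta> n \<in> Arr C" "Dom C (\<theta> n) = P n" "Cod C (\<theta> n) = Q n" for n
    using \<eta> \<theta> by (simp_all add: family_transformation_def Hom_iff)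
  case (Suc n)
  have "\<eta> (n + 1) \<cdot> \<phi> n 1 = \<psi> n 1 \<cdot> (\<eta> n \<boxtimes> \<eta> 1)" "\<theta> (n + 1) \<cdot> \<phi> n 1 = \<psi> n 1 \<cdot> (\<theta> n \<boxtimes> \<theta> 1)"
    using \<eta> \<theta> unfolding family_transformation_def by blast+
  then have "\<eta> (Suc n) \<cdot> \<phi> n 1 = \<theta> (Suc n) \<cdot> \<phi> n 1" using Suc 1 by simp
  then show ?case by (rule P.iso_cancel_right) simp_all
qed

text \<open>
  As \<open>n + 1\<close> is the tensor product of \<open>n\<close> and \<open>1\<close>, this recursion is forced by compatibility with
  the structure maps.
\<close>

primrec extend :: "'a \<Rightarrow> nat \<Rightarrow> 'a"
  where
    "extend f 0 = \<psi>0 \<cdot> Inverse C \<phi>0"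
  | "extend f (Suc n) = \<psi> n 1 \<cdot> (extend f n \<boxtimes> f) \<cdot> Inverse C (\<phi> n 1)"

lemma extend_simps [simp]:
  assumes "f \<in> Hom C (P 1) (Q 1)"
  shows "extend f n \<in> Arr C" "Dom C (extend f n) = P n" "Cod C (extend f n) = Q n"
proof -
  have f: "f \<in> Arr C" "Dom C f = P 1" "Cod C f = Q 1" using assms by (auto simp: Hom_iff)
  have "extend f n \<in> Arr C \<and> Dom C (extend f n) = P n \<and> Cod C (extend f n) = Q n"
    by (induction n) (use f in simp_all)
  then show "extend f n \<in> Arr C" "Dom C (extend f n) = P n" "Cod C (extend f n) = Q n" by auto
qed

lemma extend_Suc_\<phi>:
  assumes f: "f \<in> Hom C (P 1) (Q 1)"
  shows "extend f (Suc n) \<cdot> \<phi> n 1 = \<psi> n 1 \<cdot> (extend f n \<boxtimes> f)"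
  using f by (simp add: Hom_iff)

lemma extend_one:
  assumes f: "f \<in> Hom C (P 1) (Q 1)"
  shows "extend f 1 = f"
proof -
  note [simp] = f extend_simps[OF f]
  have [simp]: "f \<in> Arr C" "Dom C f = P 1" "Cod C f = Q 1" using f by (auto simp: Hom_iff)
  have "extend f 1 \<cdot> lunit C (P 1) = (extend f (Suc 0) \<cdot> \<phi> 0 1) \<cdot> (\<phi>0 \<boxtimes> Ident C (P 1))"
    by (simp del: extend.simps flip: P.\<phi>_lunit)
  also have "\<dots> = \<psi> 0 1 \<cdot> ((extend f 0 \<cdot> \<phi>0) \<boxtimes> f)"
    unfolding extend_Suc_\<phi>[OF f] by (simp add: P.interchange del: extend.simps)
  also have "\<dots> = (\<psi> 0 1 \<cdot> (\<psi>0 \<boxtimes> Ident C (Q 1))) \<cdot> (Ident C (Unit C) \<boxtimes> f)"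
    by (simp add: P.interchange)
  also have "\<dots> = f \<cdot> lunit C (P 1)"
    unfolding Q.\<phi>_lunit by (rule P.lunit_natural) fact
  finally show ?thesis by (rule P.iso_cancel_right) simp_all
qed

text \<open>
  Precomposition with the comparison map for \<open>m\<close>, \<open>n\<close>, \<open>1\<close> reduces the step to the induction
  hypothesis, by the associativity of both families.
\<close>

lemma extend_tens:
  assumes f: "f \<in> Hom C (P 1) (Q 1)"
  shows "extend f (m + n) \<cdot> \<phi> m n = \<psi> m n \<cdot> (extend f m \<boxtimes> extend f n)"
proof (induction n)
  note [simp] = extend_simps[OF f]
  have f' [simp]: "f \<in> Arr C" "Dom C f = P 1" "Cod C f = Q 1" using f by (auto simp: Hom_iff)
  case 0
  show ?case
  proof (rule P.iso_cancel_right)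
    have "(extend f m \<cdot> \<phi> m 0) \<cdot> (Ident C (P m) \<boxtimes> \<phi>0) = extend f m \<cdot> runit C (P m)"
      by (simp add: P.\<phi>_runit)
    also have "\<dots> = runit C (Q m) \<cdot> (extend f m \<boxtimes> Ident C (Unit C))"
      by (rule P.runit_natural[symmetric]) (simp add: Hom_iff)
    also have "\<dots> = (\<psi> m 0 \<cdot> (Ident C (Q m) \<boxtimes> \<psi>0)) \<cdot> (extend f m \<boxtimes> Ident C (Unit C))"
      by (simp only: Q.\<phi>_runit)
    also have "\<dots> = (\<psi> m 0 \<cdot> (extend f m \<boxtimes> extend f 0)) \<cdot> (Ident C (P m) \<boxtimes> \<phi>0)"
      by (simp add: P.interchange)
    finally show "(extend f (m + 0) \<cdot> \<phi> m 0) \<cdot> (Ident C (P m) \<boxtimes> \<phi>0)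
      = (\<psi> m 0 \<cdot> (extend f m \<boxtimes> extend f 0)) \<cdot> (Ident C (P m) \<boxtimes> \<phi>0)" by simp
  qed (simp_all del: extend.simps)
next
  note [simp] = extend_simps[OF f]
  have f' [simp]: "f \<in> Arr C" "Dom C f = P 1" "Cod C f = Q 1" using f by (auto simp: Hom_iff)
  case (Suc n)
  let ?i = "Ident C" and ?a = "assoc C (P m) (P n) (P 1)" and ?e = "extend f"
  note [simp del] = extend.simps One_nat_def
  have s: "\<phi> m (n + 1) \<cdot> (?i (P m) \<boxtimes> \<phi> n 1) \<cdot> ?a = \<phi> (m + n) 1 \<cdot> (\<phi> m n \<boxtimes> ?i (P 1))"
    by (rule P.\<phi>_assoc)
  have t: "\<psi> m (n + 1) \<cdot> (?i (Q m) \<boxtimes> \<psi> n 1) \<cdot> assoc C (Q m) (Q n) (Q 1) = \<psi> (m + n) 1 \<cdot> (\<psi> m n \<boxtimes> ?i (Q 1))"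
    by (rule Q.\<phi>_assoc)
  have e1: "?e (k + 1) \<cdot> \<phi> k 1 = \<psi> k 1 \<cdot> (?e k \<boxtimes> f)" for k
    using extend_Suc_\<phi>[OF f, of k] by (simp only: Suc_eq_plus1)
  have "(?e (m + n + 1) \<cdot> \<phi> m (n + 1)) \<cdot> ((?i (P m) \<boxtimes> \<phi> n 1) \<cdot> ?a)
      = ?e (m + n + 1) \<cdot> (\<phi> m (n + 1) \<cdot> (?i (P m) \<boxtimes> \<phi> n 1) \<cdot> ?a)"
    by (simp add: add.assoc)
  also have "\<dots> = (?e (m + n + 1) \<cdot> \<phi> (m + n) 1) \<cdot> (\<phi> m n \<boxtimes> ?i (P 1))"
    unfolding s by simp
  also have "\<dots> = \<psi> (m + n) 1 \<cdot> ((?e (m + n) \<cdot> \<phi> m n) \<boxtimes> f)"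
    unfolding e1 by (simp add: P.interchange)
  also have "\<dots> = (\<psi> (m + n) 1 \<cdot> (\<psi> m n \<boxtimes> ?i (Q 1))) \<cdot> ((?e m \<boxtimes> ?e n) \<boxtimes> f)"
    unfolding Suc.IH by (simp add: P.interchange)
  also have "\<dots> = \<psi> m (n + 1) \<cdot> (?i (Q m) \<boxtimes> \<psi> n 1) \<cdot> (assoc C (Q m) (Q n) (Q 1) \<cdot> ((?e m \<boxtimes> ?e n) \<boxtimes> f))"
    unfolding t[symmetric] by (simp add: add.assoc)
  also have "\<dots> = \<psi> m (n + 1) \<cdot> ((?e m \<boxtimes> (\<psi> n 1 \<cdot> (?e n \<boxtimes> f))) \<cdot> ?a)"
    by (simp add: P.assoc_natural' P.interchange_assoc)
  also have "\<dots> = (\<psi> m (n + 1) \<cdot> (?e m \<boxtimes> ?e (n + 1))) \<cdot> ((?i (P m) \<boxtimes> \<phi> n 1) \<cdot> ?a)"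
    unfolding e1[symmetric] by (simp add: P.interchange_assoc)
  finally have "?e (m + (n + 1)) \<cdot> \<phi> m (n + 1) = \<psi> m (n + 1) \<cdot> (?e m \<boxtimes> ?e (n + 1))"
    unfolding add.assoc by (rule P.iso_cancel_right) (simp_all add: add.assoc)
  then show ?case by (simp only: Suc_eq_plus1)
qed

lemma family_transformation_extend:
  assumes f: "f \<in> Hom C (P 1) (Q 1)"
  shows "family_transformation (extend f)"
proof -
  note [simp] = extend_simps[OF f]
  have "extend f 0 \<cdot> \<phi>0 = \<psi>0" by simp
  then show ?thesis
    using extend_tens[OF f] by (simp add: family_transformation_def Hom_iff del: extend.simps)
qed

text \<open>
  Transformations of families are compatible with the transported tensor products and braidings,
  and therefore with the actions of the braid groups.
\<close>

context
  fixes \<eta> :: "nat \<Rightarrow> 'a"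
  assumes \<eta>: "family_transformation \<eta>"
begin

lemma \<eta>_simps [simp]: "\<eta> n \<in> Arr C" "Dom C (\<eta> n) = P n" "Cod C (\<eta> n) = Q n"
  using \<eta> by (simp_all add: family_transformation_def Hom_iff)

lemma \<eta>_\<phi>: "\<eta> (m + n) \<cdot> \<phi> m n = \<psi> m n \<cdot> (\<eta> m \<boxtimes> \<eta> n)"
  using \<eta> by (simp add: family_transformation_def)

lemma \<eta>_T:
  assumes "P.endo m g" "P.endo n h" "Q.endo m g'" "Q.endo n h'"
    "\<eta> m \<cdot> g = g' \<cdot> \<eta> m" "\<eta> n \<cdot> h = h' \<cdot> \<eta> n"
  shows "\<eta> (m + n) \<cdot> P.T m n g h = Q.T m n g' h' \<cdot> \<eta> (m + n)"
proof (rule P.iso_cancel_right)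
  have "(\<eta> (m + n) \<cdot> P.T m n g h) \<cdot> \<phi> m n = (\<eta> (m + n) \<cdot> \<phi> m n) \<cdot> (g \<boxtimes> h)"
    using assms by (simp add: P.T_\<phi>)
  also have "\<dots> = \<psi> m n \<cdot> ((\<eta> m \<cdot> g) \<boxtimes> (\<eta> n \<cdot> h))"
    unfolding \<eta>_\<phi> using assms(1-4) by (simp add: P.interchange)
  also have "\<dots> = (Q.T m n g' h' \<cdot> \<psi> m n) \<cdot> (\<eta> m \<boxtimes> \<eta> n)"
    using assms by (simp add: Q.T_\<phi> P.interchange)
  also have "\<dots> = Q.T m n g' h' \<cdot> (\<eta> (m + n) \<cdot> \<phi> m n)"
    unfolding \<eta>_\<phi> using assms(1-4) by simp
  finally show "(\<eta> (m + n) \<cdot> P.T m n g h) \<cdot> \<phi> m n = (Q.T m n g' h' \<cdot> \<eta> (m + n)) \<cdot> \<phi> m n"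
    using assms(1-4) by simp
qed (use assms in simp_all)

lemma \<eta>_B: "\<eta> (m + n) \<cdot> P.B m n = Q.B m n \<cdot> \<eta> (m + n)"
proof (rule P.iso_cancel_right)
  have "(\<eta> (m + n) \<cdot> P.B m n) \<cdot> \<phi> m n = (\<eta> (n + m) \<cdot> \<phi> n m) \<cdot> braid C (P m) (P n)"
    by (simp add: P.B_\<phi> add.commute[of n m])
  also have "\<dots> = \<psi> n m \<cdot> (braid C (Q m) (Q n) \<cdot> (\<eta> m \<boxtimes> \<eta> n))"
    unfolding \<eta>_\<phi> by (simp add: P.braid_natural')
  also have "\<dots> = (Q.B m n \<cdot> \<psi> m n) \<cdot> (\<eta> m \<boxtimes> \<eta> n)"
    unfolding Q.B_\<phi> by simp
  also have "\<dots> = (Q.B m n \<cdot> \<eta> (m + n)) \<cdot> \<phi> m n"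
    by (simp add: \<eta>_\<phi>)
  finally show "(\<eta> (m + n) \<cdot> P.B m n) \<cdot> \<phi> m n = (Q.B m n \<cdot> \<eta> (m + n)) \<cdot> \<phi> m n" .
qed simp_all

lemma \<eta>_gen:
  assumes i: "1 \<le> i" "i < n"
  shows "\<eta> n \<cdot> P.gen n i = Q.gen n i \<cdot> \<eta> n"
proof -
  have e: "i - 1 + 2 = i + 1" "i + 1 + (n - (i + 1)) = n" using i by auto
  have b: "\<eta> 2 \<cdot> P.B 1 1 = Q.B 1 1 \<cdot> \<eta> 2" using \<eta>_B[of 1 1] by (simp add: numeral_2_eq_2)
  let ?x = "P.T (i - 1) 2 (Ident C (P (i - 1))) (P.B 1 1)"
    and ?y = "Q.T (i - 1) 2 (Ident C (Q (i - 1))) (Q.B 1 1)"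
  have "\<eta> (i - 1 + 2) \<cdot> ?x = ?y \<cdot> \<eta> (i - 1 + 2)"
    by (rule \<eta>_T) (use b P.endo_B11 Q.endo_B11 in simp_all)
  moreover have "P.endo (i - 1 + 2) ?x" "Q.endo (i - 1 + 2) ?y"
    using P.endo_B11 Q.endo_B11 by simp_all
  ultimately have "\<eta> (i + 1 + (n - (i + 1))) \<cdot> P.gen n i = Q.gen n i \<cdot> \<eta> (i + 1 + (n - (i + 1)))"
    unfolding P.gen_def Q.gen_def e(1) by (intro \<eta>_T) simp_all
  then show ?thesis unfolding e(2) .
qed

lemma \<eta>_act: "w \<in> braid_words n \<Longrightarrow> \<eta> n \<cdot> P.act n w = Q.act n w \<cdot> \<eta> n"
proof (induction w)
  case (Cons x w)
  obtain i e where x: "x = (i, e)" by (cases x)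
  have i: "1 \<le> i" "i < n" and w: "w \<in> braid_words n" using Cons.prems x by auto
  have "\<eta> n \<cdot> Inverse C (P.gen n i) = Inverse C (Q.gen n i) \<cdot> Q.gen n i \<cdot> \<eta> n \<cdot> Inverse C (P.gen n i)"
    using i by simp
  also have "\<dots> = Inverse C (Q.gen n i) \<cdot> (\<eta> n \<cdot> P.gen n i) \<cdot> Inverse C (P.gen n i)"
    unfolding \<eta>_gen[OF i] using i by simp
  also have "\<dots> = Inverse C (Q.gen n i) \<cdot> \<eta> n"
    using i by simp
  finally have g: "\<eta> n \<cdot> (if e then P.gen n i else Inverse C (P.gen n i))
      = (if e then Q.gen n i else Inverse C (Q.gen n i)) \<cdot> \<eta> n"
    using \<eta>_gen[OF i] by simp
  let ?p = "if e then P.gen n i else Inverse C (P.gen n i)"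
    and ?q = "if e then Q.gen n i else Inverse C (Q.gen n i)"
  have p: "P.endo n ?p" and q: "Q.endo n ?q" using i by simp_all
  have "\<eta> n \<cdot> (?p \<cdot> P.act n w) = (\<eta> n \<cdot> ?p) \<cdot> P.act n w"
    by (rule P.Comp_assoc_simp[symmetric]) (use p w in simp_all)
  also have "\<dots> = ?q \<cdot> (\<eta> n \<cdot> P.act n w)"
    unfolding g by (rule P.Comp_assoc_simp) (use q w in simp_all)
  also have "\<dots> = (?q \<cdot> Q.act n w) \<cdot> \<eta> n"
    unfolding Cons.IH[OF w] by (rule P.Comp_assoc_simp[symmetric]) (use q w in simp_all)
  finally show ?case using i by (simp add: x P.act_Cons Q.act_Cons)
qed simp

end

end


section \<open>The category of braided functors\<close>

lemma monoidal_transformation_iff: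
  assumes "monoidal_functor A C F" "monoidal_functor A C G"
  shows "monoidal_transformation A C F G \<eta> \<longleftrightarrow>
    (\<forall>X\<in>Obj A. \<eta> X \<in> Hom C (on_Obj F X) (on_Obj G X)) \<and>
    (\<forall>f\<in>Arr A. \<eta> (Cod A f) \<cdot>\<^bsub>C\<^esub> on_Arr F f = on_Arr G f \<cdot>\<^bsub>C\<^esub> \<eta> (Dom A f)) \<and>
    \<eta> (Unit A) \<cdot>\<^bsub>C\<^esub> phi0 F = phi0 G \<and>
    (\<forall>U\<in>Obj A. \<forall>V\<in>Obj A. \<eta> (U \<boxdot>\<^bsub>A\<^esub> V) \<cdot>\<^bsub>C\<^esub> phi2 F U V = phi2 G U V \<cdot>\<^bsub>C\<^esub> (\<eta> U \<boxtimes>\<^bsub>C\<^esub> \<eta> V))"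
    (is "_ \<longleftrightarrow> ?R")
proof
  assume "monoidal_transformation A C F G \<eta>"
  then interpret monoidal_transformation A C F G \<eta> .
  show ?R
    using component_Hom naturality component_Unit component_Tens by (auto simp: Hom_iff)
next
  interpret F: monoidal_functor A C F by fact
  interpret G: monoidal_functor A C G by fact
  assume ?R
  then show "monoidal_transformation A C F G \<eta>"
    by unfold_locales (auto simp: Hom_iff)
qed

lemma monoidal_functor_simps:
  assumes "monoidal_functor A C F" "U \<in> Obj A" "V \<in> Obj A"
  shows "phi2 F U V \<in> Arr C" "Dom C (phi2 F U V) = on_Obj F U \<boxdot>\<^bsub>C\<^esub> on_Obj F V"
    "Cod C (phi2 F U V) = on_Obj F (U \<boxdot>\<^bsub>A\<^esub> V)"
    "phi0 F \<in> Arr C" "Dom C (phi0 F) = Unit C" "Cod C (phi0 F) = on_Obj F (Unit A)"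
  using monoidal_functor.phi2_Hom[OF assms] monoidal_functor.phi0_Hom[OF assms(1)]
  by (simp_all add: Hom_iff)

lemma Br_simps:
  "Obj (Br A C) = {F. braided_functor A C F \<and> extensional_functor A F}"
  "f \<in> Arr (Br A C) \<longleftrightarrow> fst f \<in> Obj (Br A C) \<and> fst (snd f) \<in> Obj (Br A C) \<and>
    monoidal_transformation A C (fst f) (fst (snd f)) (snd (snd f)) \<and> snd (snd f) \<in> extensional (Obj A)"
  "Dom (Br A C) f = fst f" "Cod (Br A C) f = fst (snd f)"
  "Ident (Br A C) F = (F, F, \<lambda>X\<in>Obj A. Ident C (on_Obj F X))"
  "g \<cdot>\<^bsub>Br A C\<^esub> f = (fst f, fst (snd g), \<lambda>X\<in>Obj A. snd (snd g) X \<cdot>\<^bsub>C\<^esub> snd (snd f) X)"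
  by (auto simp: Br_def Let_def split_beta)

lemma Hom_Br_iff:
  "(F', G', \<eta>) \<in> Hom (Br A C) F G \<longleftrightarrow> F' = F \<and> G' = G \<and> F \<in> Obj (Br A C) \<and> G \<in> Obj (Br A C) \<and>
    monoidal_transformation A C F G \<eta> \<and> \<eta> \<in> extensional (Obj A)"
  by (auto simp: Hom_iff Br_simps)

lemma monoidal_transformation_Ident:
  assumes "monoidal_functor A C F"
  shows "monoidal_transformation A C F F (\<lambda>X\<in>Obj A. Ident C (on_Obj F X))"
proof -
  interpret F: monoidal_functor A C F by fact
  note [simp] = monoidal_functor_simps[OF assms]
  have [simp]: "phi0 F \<in> Arr C" "Dom C (phi0 F) = Unit C" "Cod C (phi0 F) = on_Obj F (Unit A)"
    using F.phi0_Hom by (simp_all add: Hom_iff)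
  show ?thesis
    unfolding monoidal_transformation_iff[OF assms assms] by (simp add: Hom_iff)
qed

lemma monoidal_transformation_Comp:
  assumes "monoidal_transformation A C F G \<eta>" "monoidal_transformation A C G H \<theta>"
  shows "monoidal_transformation A C F H (\<lambda>X\<in>Obj A. \<theta> X \<cdot>\<^bsub>C\<^esub> \<eta> X)"
proof -
  interpret \<eta>: monoidal_transformation A C F G \<eta> by fact
  interpret \<theta>: monoidal_transformation A C G H \<theta> by fact
  have F: "monoidal_functor A C F" and G: "monoidal_functor A C G" and H: "monoidal_functor A C H"
    by unfold_locales
  have [simp]: "\<eta> X \<in> Arr C" "Dom C (\<eta> X) = on_Obj F X" "Cod C (\<eta> X) = on_Obj G X"
    "\<theta> X \<in> Arr C" "Dom C (\<theta> X) = on_Obj G X" "Cod C (\<theta> X) = on_Obj H X" if "X \<in> Obj A" for X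
    using \<eta>.component_Hom[OF that] \<theta>.component_Hom[OF that] by (simp_all add: Hom_iff)
  have [simp]: "Unit A \<in> Obj A" by (rule \<eta>.F.A.Unit_Obj)
  note [simp] = monoidal_functor_simps[OF F] monoidal_functor_simps[OF G] monoidal_functor_simps[OF H]
  have nat: "(\<theta> (Cod A f) \<cdot>\<^bsub>C\<^esub> \<eta> (Cod A f)) \<cdot>\<^bsub>C\<^esub> on_Arr F f = on_Arr H f \<cdot>\<^bsub>C\<^esub> \<theta> (Dom A f) \<cdot>\<^bsub>C\<^esub> \<eta> (Dom A f)"
    if f: "f \<in> Arr A" for f
  proof -
    have "(\<theta> (Cod A f) \<cdot>\<^bsub>C\<^esub> \<eta> (Cod A f)) \<cdot>\<^bsub>C\<^esub> on_Arr F f = \<theta> (Cod A f) \<cdot>\<^bsub>C\<^esub> (\<eta> (Cod A f) \<cdot>\<^bsub>C\<^esub> on_Arr F f)"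
      using f by simp
    also have "\<dots> = (\<theta> (Cod A f) \<cdot>\<^bsub>C\<^esub> on_Arr G f) \<cdot>\<^bsub>C\<^esub> \<eta> (Dom A f)"
      using \<eta>.naturality[of f "Dom A f" "Cod A f"] f by (simp add: Hom_iff)
    also have "\<dots> = on_Arr H f \<cdot>\<^bsub>C\<^esub> \<theta> (Dom A f) \<cdot>\<^bsub>C\<^esub> \<eta> (Dom A f)"
      using \<theta>.naturality[of f "Dom A f" "Cod A f"] f by (simp add: Hom_iff)
    finally show ?thesis .
  qed
  have unit: "(\<theta> (Unit A) \<cdot>\<^bsub>C\<^esub> \<eta> (Unit A)) \<cdot>\<^bsub>C\<^esub> phi0 F = phi0 H"
    using \<eta>.component_Unit \<theta>.component_Unit monoidal_functor_simps(4-6)[OF F, of "Unit A" "Unit A"] by simp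
  have tens: "(\<theta> (U \<boxdot>\<^bsub>A\<^esub> V) \<cdot>\<^bsub>C\<^esub> \<eta> (U \<boxdot>\<^bsub>A\<^esub> V)) \<cdot>\<^bsub>C\<^esub> phi2 F U V
      = phi2 H U V \<cdot>\<^bsub>C\<^esub> ((\<theta> U \<cdot>\<^bsub>C\<^esub> \<eta> U) \<boxtimes>\<^bsub>C\<^esub> (\<theta> V \<cdot>\<^bsub>C\<^esub> \<eta> V))" if UV: "U \<in> Obj A" "V \<in> Obj A" for U V
  proof -
    have o: "U \<boxdot>\<^bsub>A\<^esub> V \<in> Obj A" using UV by (rule \<eta>.F.A.Tens_Obj)
    have "(\<theta> (U \<boxdot>\<^bsub>A\<^esub> V) \<cdot>\<^bsub>C\<^esub> \<eta> (U \<boxdot>\<^bsub>A\<^esub> V)) \<cdot>\<^bsub>C\<^esub> phi2 F U V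
        = (\<theta> (U \<boxdot>\<^bsub>A\<^esub> V) \<cdot>\<^bsub>C\<^esub> phi2 G U V) \<cdot>\<^bsub>C\<^esub> (\<eta> U \<boxtimes>\<^bsub>C\<^esub> \<eta> V)"
      using UV o \<eta>.component_Tens[OF UV] by simp
    also have "\<dots> = phi2 H U V \<cdot>\<^bsub>C\<^esub> ((\<theta> U \<cdot>\<^bsub>C\<^esub> \<eta> U) \<boxtimes>\<^bsub>C\<^esub> (\<theta> V \<cdot>\<^bsub>C\<^esub> \<eta> V))"
      using UV \<theta>.component_Tens[OF UV] by (simp add: \<eta>.F.C.interchange)
    finally show ?thesis .
  qed
  show ?thesis
    unfolding monoidal_transformation_iff[OF F H] using nat unit tens by (simp add: Hom_iff)
qed

lemma braided_functor_monoidal: "braided_functor A C F \<Longrightarrow> monoidal_functor A C F"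
  by (simp add: braided_functor_def)

lemma category_Br:
  fixes A :: "('o, 'a, 'x) braided_category_scheme" and C :: "('p, 'b, 'y) braided_category_scheme"
  assumes "braided_category A" "braided_category C"
  shows "category (Br A C)"
proof -
  interpret A: braided_category A by fact
  interpret C: braided_category C by fact
  have comp: "\<eta> X \<in> Arr C \<and> Dom C (\<eta> X) = on_Obj F X \<and> Cod C (\<eta> X) = on_Obj G X"
    if "monoidal_transformation A C F G \<eta>" "X \<in> Obj A"
    for F G :: "('o, 'a, 'p, 'b) monoidal_functor" and \<eta> X
  proof -
    interpret monoidal_transformation A C F G \<eta> by fact
    show ?thesis using component_Hom[OF that(2)] by (simp add: Hom_iff)
  qed
  have obj: "on_Obj F X \<in> Obj C" if "braided_functor A C F" "X \<in> Obj A"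
    for F :: "('o, 'a, 'p, 'b) monoidal_functor" and X
  proof -
    interpret braided_functor A C F by fact
    show ?thesis by (rule on_Obj_Obj) fact
  qed
  show ?thesis
  proof
    fix F assume "F \<in> Obj (Br A C)"
    then show "Ident (Br A C) F \<in> Hom (Br A C) F F"
      by (simp add: Hom_iff Br_simps monoidal_transformation_Ident braided_functor_monoidal)
  next
    fix f g F G H assume "f \<in> Hom (Br A C) F G" "g \<in> Hom (Br A C) G H"
    then show "g \<cdot>\<^bsub>Br A C\<^esub> f \<in> Hom (Br A C) F H"
      by (auto simp: Hom_iff Br_simps intro: monoidal_transformation_Comp)
  next
    fix f F G assume "f \<in> Hom (Br A C) F G"
    then obtain \<eta> where f: "f = (F, G, \<eta>)" "(F, G, \<eta>) \<in> Hom (Br A C) F G"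
      by (cases f) (auto simp: Hom_iff Br_simps)
    then have h: "monoidal_transformation A C F G \<eta>" "\<eta> \<in> extensional (Obj A)"
      "braided_functor A C F" "braided_functor A C G"
      by (auto simp: Hom_Br_iff Br_simps)
    show "f \<cdot>\<^bsub>Br A C\<^esub> Ident (Br A C) F = f" "Ident (Br A C) G \<cdot>\<^bsub>Br A C\<^esub> f = f"
      using comp[OF h(1)] h by (auto simp: f Br_simps obj intro!: extensionalityI[of _ "Obj A"])
  next
    fix f g h F G H K
    assume "f \<in> Hom (Br A C) F G" "g \<in> Hom (Br A C) G H" "h \<in> Hom (Br A C) H K"
    then obtain \<eta> \<theta> \<kappa> where f: "f = (F, G, \<eta>)" "g = (G, H, \<theta>)" "h = (H, K, \<kappa>)"
      and t: "monoidal_transformation A C F G \<eta>" "monoidal_transformation A C G H \<theta>"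
        "monoidal_transformation A C H K \<kappa>"
      by (cases f, cases g, cases h) (auto simp: Hom_iff Br_simps)
    show "(h \<cdot>\<^bsub>Br A C\<^esub> g) \<cdot>\<^bsub>Br A C\<^esub> f = h \<cdot>\<^bsub>Br A C\<^esub> g \<cdot>\<^bsub>Br A C\<^esub> f"
      using comp[OF t(1)] comp[OF t(2)] comp[OF t(3)]
      by (auto simp: f Br_simps intro!: restrict_ext)
  qed (simp_all add: Br_simps)
qed


section \<open>The equivalence\<close>

lemma Theta_simps [simp]:
  "on_Obj Theta F = on_Obj F 1" "on_Arr Theta (F, G, \<eta>) = \<eta> 1"
  by (simp_all add: Theta_def)

text \<open>
  Naturality is automatic: all arrows of \<open>PS\<close> act through braidings and tensor products.
\<close>

lemma monoidal_transformation_iff_family_transformation: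
  assumes F: "braided_functor PS C F" and G: "braided_functor PS C G"
  shows "monoidal_transformation PS C F G \<eta> \<longleftrightarrow>
    family_pair.family_transformation C (on_Obj F) (phi2 F) (phi0 F) (on_Obj G) (phi2 G) (phi0 G) \<eta>"
proof -
  interpret family_pair C "on_Obj F" "phi2 F" "phi0 F" "on_Obj G" "phi2 G" "phi0 G"
    using F G by (intro family_pair.intro braided_family_of_functor)
  have "\<eta> (Cod PS f) \<cdot>\<^bsub>C\<^esub> on_Arr F f = on_Arr G f \<cdot>\<^bsub>C\<^esub> \<eta> (Dom PS f)"
    if "family_transformation \<eta>" "f \<in> Arr PS" for f
    using that(2) \<eta>_act[OF that(1)] braided_functor_on_Arr[OF F] braided_functor_on_Arr[OF G]
    by (auto elim!: PS_Arr_cases)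
  then show ?thesis
    unfolding monoidal_transformation_iff[OF braided_functor_monoidal[OF F] braided_functor_monoidal[OF G]]
    by (auto simp: family_transformation_def)
qed

theorem theorem5p12:
  fixes C :: "('o, 'a) braided_category"
  assumes "pseudosymmetric_braided_category C"
  shows "equivalence_of_categories (Br PS C) C Theta"
proof (rule fully_faithful_essentially_surjective_equivalence)
  interpret C: pseudosymmetric_braided_category C by fact
  interpret Br: category "Br PS C"
    by (rule category_Br) unfold_locales
  have Hom_1: "\<eta> 1 \<in> Hom C (on_Obj F 1) (on_Obj G 1)"
    if "monoidal_transformation PS C F G \<eta>" for F G :: "(nat, nat \<times> braid_word set set, 'o, 'a) monoidal_functor" and \<eta>
  proof -
    interpret monoidal_transformation PS C F G \<eta> by fact
    show ?thesis using component_Hom[of 1] by simp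
  qed
  show "functor (Br PS C) C Theta"
  proof
    fix F assume F: "F \<in> Obj (Br PS C)"
    then interpret braided_functor PS C F by (simp add: Br_simps)
    show "on_Obj Theta F \<in> Obj C" using on_Obj_Obj[of 1] by simp
    show "on_Arr Theta (Ident (Br PS C) F) = Ident C (on_Obj Theta F)"
      by (simp add: Br_simps)
  next
    fix f F G assume "f \<in> Hom (Br PS C) F G"
    then show "on_Arr Theta f \<in> Hom C (on_Obj Theta F) (on_Obj Theta G)"
      using Hom_1 by (cases f) (auto simp: Hom_Br_iff simp del: One_nat_def)
  next
    fix f g F G H assume "f \<in> Hom (Br PS C) F G" "g \<in> Hom (Br PS C) G H"
    then show "on_Arr Theta (g \<cdot>\<^bsub>Br PS C\<^esub> f) = on_Arr Theta g \<cdot>\<^bsub>C\<^esub> on_Arr Theta f"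
      by (cases f, cases g) (simp add: Br_simps)
  qed
next
  fix F G g assume "F \<in> Obj (Br PS C)" "G \<in> Obj (Br PS C)"
    and g: "g \<in> Hom C (on_Obj Theta F) (on_Obj Theta G)"
  then have F: "braided_functor PS C F" and G: "braided_functor PS C G"
    and FG: "F \<in> Obj (Br PS C)" "G \<in> Obj (Br PS C)"
    by (simp_all add: Br_simps)
  interpret family_pair C "on_Obj F" "phi2 F" "phi0 F" "on_Obj G" "phi2 G" "phi0 G"
    using F G by (intro family_pair.intro braided_family_of_functor)
  have g': "g \<in> Hom C (on_Obj F 1) (on_Obj G 1)" using g by simp
  have "(F, G, extend g) \<in> Hom (Br PS C) F G"
    using family_transformation_extend[OF g'] FG
    by (simp add: Hom_Br_iff monoidal_transformation_iff_family_transformation[OF F G] extensional_def)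
  moreover have "on_Arr Theta (F, G, extend g) = g"
    using extend_one[OF g'] by simp
  ultimately show "\<exists>f\<in>Hom (Br PS C) F G. on_Arr Theta f = g" by blast
next
  fix F G f f' assume "f \<in> Hom (Br PS C) F G" "f' \<in> Hom (Br PS C) F G"
    and eq: "on_Arr Theta f = on_Arr Theta f'"
  then obtain \<eta> \<eta>' where f: "f = (F, G, \<eta>)" "f' = (F, G, \<eta>')"
    and FG: "braided_functor PS C F" "braided_functor PS C G"
    and t: "monoidal_transformation PS C F G \<eta>" "monoidal_transformation PS C F G \<eta>'"
    by (cases f, cases f') (auto simp: Hom_iff Br_simps)
  interpret family_pair C "on_Obj F" "phi2 F" "phi0 F" "on_Obj G" "phi2 G" "phi0 G"
    using FG by (intro family_pair.intro braided_family_of_functor)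
  have "\<eta> = \<eta>'"
    using family_transformation_unique[of \<eta> \<eta>'] t eq
    by (simp add: monoidal_transformation_iff_family_transformation[OF FG] f fun_eq_iff)
  then show "f = f'" by (simp add: f)
next
  interpret C: pseudosymmetric_braided_category C by fact
  fix X assume X: "X \<in> Obj C"
  interpret pw: monoidal_family C "tensor_power C X" "tensor_power_mult C X" "Ident C (Unit C)"
    by (rule C.monoidal_family_tensor_power[OF X])
  interpret pw: pseudosymmetric_family C "tensor_power C X" "tensor_power_mult C X" "Ident C (Unit C)"
    by unfold_locales
  have "pw.family_functor \<in> Obj (Br PS C)"
    by (simp add: Br_simps pw.braided_functor_family_functor pw.extensional_family_functor)
  \<comment> \<open>The first tensor power is \<open>I \<otimes> X\<close> rather than \<open>X\<close>.\<close>
  moreover have "is_iso C (lunit C X)" "lunit C X \<in> Hom C (on_Obj Theta pw.family_functor) X"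
    using X by (simp_all add: Hom_iff)
  ultimately show "\<exists>F\<in>Obj (Br PS C). \<exists>e. is_iso C e \<and> e \<in> Hom C (on_Obj Theta F) X"
    by blast
qed

end
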